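(* Let $n\ge 2$ be an integer. Assume that the coupling operators $C_{i\,i-1}$, $i=2,\dots,n$, satisfy the Coupling hypothesis of order $n$, where the operators $\Pi_i$, $i=2,\dots,n$, satisfy the Coupling observability hypothesis of order $n$. Let $\mathbf{B}_n^{*}$ be any given operator satisfying the Admissibility hypothesis and the Observability hypothesis of index $n$. Then there exists $T_n^{*}>0$ such that for all $i=1,\dots,n$ there exist constants $d_{i,n}(T)>0$ such that for every solution $W=(w_1,\dots,w_n,w_1',\dots,w_n')$ of the bi-diagonal cascade system and all $T>T_n^{*}$, $$e_{1+i-n}(W_i)(0)\le d_{i,n}(T)\int_0^T\|\mathbf{B}_n^{*}(W_n)\|_{G_n}^2\,dt\qquad \forall\, i=1,\dots,n,$$ with $d_{i,n}(T)\le \frac{K}{T^3}$ for $i\in\{1,\dots,n-1\}$ and $d_{n,n}(T)\le\frac{K}{T}$, where $K$ is bounded with respect to $T$.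
   Context: Abstract setting. $H$ is a Hilbert space with norm $|\cdot|$ and scalar product $\langle\cdot,\cdot\rangle$. $A:D(A)\subset H\to H$ is a positive self-adjoint operator with compact resolvent such that, for some $\omega>0$, $|Au|\ge\omega|u|$ for all $u\in D(A)$. For $k\in\mathbb N$, $H_k=D(A^{k/2})$ with norm $|A^{k/2}\cdot|$ ($H_0=H$), and $H_{-k}$ is the dual of $H_k$ with pivot space $H$, with norm $|A^{-k/2}\cdot|$. For $k\in\mathbb Z$ and a pair $W=(w,w')$, $e_k(W)=\frac12\big(|A^{k/2}w|^2+|A^{(k-1)/2}w'|^2\big)$. Coupling hypothesis of order $n$. For all $i\in\{2,\dots,n\}$: $C_{i\,i-1}$ is a bounded operator on $H$; $C_{i\,i-1}^{*}\in\mathcal L(H_k)$ for $k\in\{0,1,\dots,n-i+1\}$; $\|C_{i\,i-1}\|=\beta_i$ and $|C_{i\,i-1}w|^2\le\beta_i\langle C_{i\,i-1}w,w\rangle$ for all $w\in H$; there exists $\alpha_i>0$ such that $\alpha_i|\Pi_iw|^2\le\langle C_{i\,i-1}w,w\rangle$ for all $w\in H$. Coupling observability hypothesis of order $n$. For all $i\in\{2,\dots,n\}$: $\Pi_i\in\mathcal L(H)$ and there exists $T_{0,i}>0$ such that for all $T>T_{0,i}$ there exists $\gamma_i(T)>0$ such that all solutions $w$ of $w''+Aw=0$ satisfy $\int_0^T|\Pi_iw'|^2dt\ge\gamma_i(T)e_1(W)(0)$, where $W=(w,w')$. Admissibility hypothesis of index $n$. $G_n$ is a Hilbert space (identified with its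 dual), $\mathbf{B}_n^{*}\in\mathcal L(H_2\times H;G_n)$, and for all $T>0$ there exists $D_n(T)>0$ such that all solutions $w$ of $w''+Aw=f\in L^2([0,T];H)$ satisfy, with $W=(w,w')$, $$\int_0^T\|\mathbf{B}_n^{*}(w,w')\|_{G_n}^2dt\le D_n(T)\Big(e_1(W)(0)+e_1(W)(T)+\int_0^Te_1(W)(t)\,dt+\int_0^T|f|^2dt\Big).$$ For solutions of energy regularity ($(w,w')(0)\in H_1\times H$) the function $\mathbf{B}_n^{*}(w,w')\in L^2(0,T;G_n)$ is understood through the extension by density given by this inequality. Observability hypothesis of index $n$. There exists $T_{0,n}>0$ such that for all $T>T_{0,n}$ there exists $R_n(T)>0$ such that all solutions $w$ of $w''+Aw=0$ satisfy $\int_0^T\|\mathbf{B}_n^{*}(w,w')\|_{G_n}^2dt\ge R_n(T)e_1(W)(0)$. Bi-diagonal cascade system of order $n$: $$w_1''+Aw_1=0,\qquad w_i''+Aw_i+C_{i\,i-1}w_{i-1}=0\quad(2\le i\le n),$$ with initial data $(w_1,\dots,w_n,w_1',\dots,w_n')(0)\in\mathcal H_n=H_1^n\times H^n$. For a solution, $W_i=(w_i,w_i')$. *)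

theory Defs
  imports "HOL-Analysis.Analysis"
begin

text \<open>
  An unbounded operator is given by its domain \<open>D\<close> and a total function \<open>A\<close> whose values
  outside \<open>D\<close> are irrelevant. Hilbert spaces are types of sort \<open>{real_inner, complete_space}\<close>;
  complex Hilbert spaces are covered by restriction of scalars.
\<close>

section \<open>Self-adjoint operators with compact resolvent\<close>

text \<open>The last clause says that the graph of \<open>A\<close> is the graph of its adjoint.\<close>

definition self_adjoint_op :: "'h::real_inner set \<Rightarrow> ('h \<Rightarrow> 'h) \<Rightarrow> bool" where
  "self_adjoint_op D A \<longleftrightarrow>
     subspace D \<and> closure D = UNIV \<and>
     (\<forall>u\<in>D. \<forall>v\<in>D. A (u + v) = A u + A v) \<and>
     (\<forall>c. \<forall>u\<in>D. A (c *\<^sub>R u) = c *\<^sub>R A u) \<and>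
     (\<forall>v z. (v \<in> D \<and> A v = z) \<longleftrightarrow> (\<forall>u\<in>D. A u \<bullet> v = u \<bullet> z))"

definition positive_op :: "'h::real_inner set \<Rightarrow> ('h \<Rightarrow> 'h) \<Rightarrow> bool" where
  "positive_op D A \<longleftrightarrow> (\<forall>u\<in>D. 0 \<le> A u \<bullet> u)"

definition compact_op :: "('h::real_normed_vector \<Rightarrow> 'h) \<Rightarrow> bool" where
  "compact_op K \<longleftrightarrow> bounded_linear K \<and> compact (closure (K ` cball 0 1))"

definition compact_resolvent :: "'h::real_normed_vector set \<Rightarrow> ('h \<Rightarrow> 'h) \<Rightarrow> bool" where
  "compact_resolvent D A \<longleftrightarrow>
     (\<exists>\<mu> R. compact_op R \<and>
        (\<forall>f. R f \<in> D \<and> A (R f) - \<mu> *\<^sub>R R f = f) \<and>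
        (\<forall>u\<in>D. R (A u - \<mu> *\<^sub>R u) = u))"

section \<open>Fractional powers and the scale of spaces\<close>

text \<open>
  For a self-adjoint \<open>A\<close> with compact resolvent the spectrum is the set of eigenvalues, and the
  functional calculus gives \<open>A\<^sup>s u = (\<Sum>\<lambda>. \<lambda>\<^sup>s P\<^sub>\<lambda> u)\<close>, where \<open>P\<^sub>\<lambda>\<close> is the orthogonal projection
  onto the eigenspace of \<open>\<lambda>\<close>, on the domain of those \<open>u\<close> with \<open>(\<Sum>\<lambda>. \<lambda>\<^sup>2\<^sup>s |P\<^sub>\<lambda> u|\<^sup>2) < \<infinity>\<close>.
  All eigenvalues are positive in the setting considered, and for \<open>s \<le> 0\<close> the domain is the
  whole space.
\<close>

definition eigenspace :: "'h::real_vector set \<Rightarrow> ('h \<Rightarrow> 'h) \<Rightarrow> real \<Rightarrow> 'h set" where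
  "eigenspace D A l = {u \<in> D. A u = l *\<^sub>R u}"

definition eigenvalues :: "'h::real_vector set \<Rightarrow> ('h \<Rightarrow> 'h) \<Rightarrow> real set" where
  "eigenvalues D A = {l. \<exists>u \<in> eigenspace D A l. u \<noteq> 0}"

definition orth_proj :: "'h::real_inner set \<Rightarrow> 'h \<Rightarrow> 'h" where
  "orth_proj S u = (THE p. p \<in> S \<and> (\<forall>v\<in>S. (u - p) \<bullet> v = 0))"

definition pow_dom :: "'h::real_inner set \<Rightarrow> ('h \<Rightarrow> 'h) \<Rightarrow> real \<Rightarrow> 'h set" where
  "pow_dom D A s =
     {u. (\<lambda>l. l powr (2 * s) * (norm (orth_proj (eigenspace D A l) u))\<^sup>2)
            summable_on eigenvalues D A}"

definition op_pow :: "'h::real_inner set \<Rightarrow> ('h \<Rightarrow> 'h) \<Rightarrow> real \<Rightarrow> 'h \<Rightarrow> 'h" where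
  "op_pow D A s u =
     (\<Sum>\<^sub>\<infinity>l\<in>eigenvalues D A. l powr s *\<^sub>R orth_proj (eigenspace D A l) u)"

text \<open>\<open>Hsp D A k\<close> is \<open>H\<^sub>k = D(A\<^sup>k\<^sup>/\<^sup>2)\<close> and \<open>Hnorm D A k\<close> the norm \<open>|A\<^sup>k\<^sup>/\<^sup>2 u|\<close>.\<close>

definition Hsp :: "'h::real_inner set \<Rightarrow> ('h \<Rightarrow> 'h) \<Rightarrow> nat \<Rightarrow> 'h set" where
  "Hsp D A k = pow_dom D A (real k / 2)"

definition Hnorm :: "'h::real_inner set \<Rightarrow> ('h \<Rightarrow> 'h) \<Rightarrow> int \<Rightarrow> 'h \<Rightarrow> real" where
  "Hnorm D A k u = norm (op_pow D A (real_of_int k / 2) u)"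

definition energy :: "'h::real_inner set \<Rightarrow> ('h \<Rightarrow> 'h) \<Rightarrow> int \<Rightarrow> 'h \<times> 'h \<Rightarrow> real" where
  "energy D A k W = ((Hnorm D A k (fst W))\<^sup>2 + (Hnorm D A (k - 1) (snd W))\<^sup>2) / 2"

definition bounded_on_H :: "'h::real_inner set \<Rightarrow> ('h \<Rightarrow> 'h) \<Rightarrow> nat \<Rightarrow> ('h \<Rightarrow> 'h) \<Rightarrow> bool" where
  "bounded_on_H D A k L \<longleftrightarrow>
     (\<forall>u \<in> Hsp D A k. L u \<in> Hsp D A k) \<and>
     (\<exists>M. \<forall>u \<in> Hsp D A k. Hnorm D A (int k) (L u) \<le> M * Hnorm D A (int k) u)"

section \<open>Solutions\<close>

text \<open>
  Solutions of \<open>w'' + A w = f\<close> of energy regularity on an interval \<open>I\<close> starting at 0, i.e.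
  \<open>w \<in> C(I; H\<^sub>1) \<inter> C\<^sup>1(I; H)\<close>. The equation is understood in \<open>H\<^sub>-\<^sub>1\<close>, the dual of \<open>H\<^sub>1\<close>: it is
  tested with \<open>\<phi> \<in> H\<^sub>1\<close>, where \<open>A w\<close> acts as \<open>\<langle>A\<^sup>1\<^sup>/\<^sup>2 w, A\<^sup>1\<^sup>/\<^sup>2 \<phi>\<rangle>\<close>, and integrated once in time.
\<close>

definition wave_solution ::
  "'h::real_inner set \<Rightarrow> ('h \<Rightarrow> 'h) \<Rightarrow> real set \<Rightarrow> (real \<Rightarrow> 'h) \<Rightarrow> (real \<Rightarrow> 'h) \<Rightarrow> (real \<Rightarrow> 'h) \<Rightarrow> bool"
  where
  "wave_solution D A I f w w' \<longleftrightarrow>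
     (\<forall>t\<in>I. w t \<in> Hsp D A 1) \<and>
     continuous_on I (\<lambda>t. op_pow D A (1/2) (w t)) \<and>
     (\<forall>t\<in>I. (w has_vector_derivative w' t) (at t within I)) \<and>
     continuous_on I w' \<and>
     (\<forall>\<phi> \<in> Hsp D A 1. \<forall>t\<in>I.
        ((\<lambda>s. f s \<bullet> \<phi> - op_pow D A (1/2) (w s) \<bullet> op_pow D A (1/2) \<phi>)
           has_integral (w' t \<bullet> \<phi> - w' 0 \<bullet> \<phi>)) {0..t})"

definition L2_on :: "real \<Rightarrow> (real \<Rightarrow> 'a::real_normed_vector) \<Rightarrow> bool" where
  "L2_on T f \<longleftrightarrow>
     f \<in> borel_measurable (lebesgue_on {0..T}) \<and> (\<lambda>t. (norm (f t))\<^sup>2) integrable_on {0..T}"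

definition L2_tendsto ::
  "real \<Rightarrow> (nat \<Rightarrow> real \<Rightarrow> 'a::real_normed_vector) \<Rightarrow> (real \<Rightarrow> 'a) \<Rightarrow> bool" where
  "L2_tendsto T fs f \<longleftrightarrow>
     (\<forall>m. (\<lambda>t. (norm (fs m t - f t))\<^sup>2) integrable_on {0..T}) \<and>
     (\<lambda>m. integral {0..T} (\<lambda>t. (norm (fs m t - f t))\<^sup>2)) \<longlonglongrightarrow> 0"

text \<open>
  Solutions on \<open>[0,T]\<close> with \<open>f \<in> L\<^sup>2(0,T;H)\<close> and moreover \<open>w \<in> C([0,T]; H\<^sub>2)\<close>: for these an
  operator bounded on \<open>H\<^sub>2 \<times> H\<close> can be applied to \<open>(w,w')\<close> pointwise in time.
\<close>

definition regular_solution ::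
  "'h::real_inner set \<Rightarrow> ('h \<Rightarrow> 'h) \<Rightarrow> real \<Rightarrow> (real \<Rightarrow> 'h) \<Rightarrow> (real \<Rightarrow> 'h) \<Rightarrow> (real \<Rightarrow> 'h) \<Rightarrow> bool"
  where
  "regular_solution D A T f w w' \<longleftrightarrow>
     L2_on T f \<and> wave_solution D A {0..T} f w w' \<and>
     (\<forall>t\<in>{0..T}. w t \<in> Hsp D A 2) \<and> continuous_on {0..T} (\<lambda>t. op_pow D A 1 (w t))"

definition cascade_solution ::
  "'h::real_inner set \<Rightarrow> ('h \<Rightarrow> 'h) \<Rightarrow> nat \<Rightarrow> (nat \<Rightarrow> 'h \<Rightarrow> 'h) \<Rightarrow>
     (nat \<Rightarrow> real \<Rightarrow> 'h) \<Rightarrow> (nat \<Rightarrow> real \<Rightarrow> 'h) \<Rightarrow> bool" where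
  "cascade_solution D A n C w w' \<longleftrightarrow>
     wave_solution D A {0..} (\<lambda>t. 0) (w 1) (w' 1) \<and>
     (\<forall>i\<in>{2..n}. wave_solution D A {0..} (\<lambda>t. - C i (w (i - 1) t)) (w i) (w' i))"

section \<open>Hypotheses\<close>

text \<open>\<open>C i\<close> stands for \<open>C\<^sub>i\<^sub>,\<^sub>i\<^sub>-\<^sub>1\<close>.\<close>

definition coupling_hyp ::
  "'h::real_inner set \<Rightarrow> ('h \<Rightarrow> 'h) \<Rightarrow> nat \<Rightarrow> (nat \<Rightarrow> 'h \<Rightarrow> 'h) \<Rightarrow> (nat \<Rightarrow> 'h \<Rightarrow> 'h) \<Rightarrow>
     (nat \<Rightarrow> real) \<Rightarrow> bool" where
  "coupling_hyp D A n C P \<beta> \<longleftrightarrow>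
     (\<forall>i\<in>{2..n}.
        bounded_linear (C i) \<and>
        (\<forall>k\<in>{0..n - i + 1}. bounded_on_H D A k (adjoint (C i))) \<and>
        onorm (C i) = \<beta> i \<and>
        (\<forall>w. (norm (C i w))\<^sup>2 \<le> \<beta> i * (C i w \<bullet> w)) \<and>
        (\<exists>\<alpha>>0. \<forall>w. \<alpha> * (norm (P i w))\<^sup>2 \<le> C i w \<bullet> w))"

definition coupling_observability_hyp ::
  "'h::real_inner set \<Rightarrow> ('h \<Rightarrow> 'h) \<Rightarrow> nat \<Rightarrow> (nat \<Rightarrow> 'h \<Rightarrow> 'h) \<Rightarrow> bool" where
  "coupling_observability_hyp D A n P \<longleftrightarrow>
     (\<forall>i\<in>{2..n}.
        bounded_linear (P i) \<and>
        (\<exists>T0>0. \<forall>T>T0. \<exists>\<gamma>>0. \<forall>w w'. wave_solution D A {0..} (\<lambda>t. 0) w w' \<longrightarrow>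
           \<gamma> * energy D A 1 (w 0, w' 0) \<le> integral {0..T} (\<lambda>t. (norm (P i (w' t)))\<^sup>2)))"

text \<open>
  \<open>B \<in> \<L>(H\<^sub>2 \<times> H; G)\<close>; the values of \<open>B\<close> outside \<open>H\<^sub>2 \<times> H\<close> are irrelevant. The norm of a pair
  is the Euclidean one.
\<close>

definition bounded_H2_H ::
  "'h::real_inner set \<Rightarrow> ('h \<Rightarrow> 'h) \<Rightarrow> ('h \<times> 'h \<Rightarrow> 'g::real_normed_vector) \<Rightarrow> bool" where
  "bounded_H2_H D A B \<longleftrightarrow>
     (\<forall>U \<in> Hsp D A 2 \<times> UNIV. \<forall>V \<in> Hsp D A 2 \<times> UNIV. B (U + V) = B U + B V) \<and>
     (\<forall>c. \<forall>U \<in> Hsp D A 2 \<times> UNIV. B (c *\<^sub>R U) = c *\<^sub>R B U) \<and>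
     (\<exists>M. \<forall>u \<in> Hsp D A 2. \<forall>v. norm (B (u, v)) \<le> M * norm (op_pow D A 1 u, v))"

definition admissibility_hyp ::
  "'h::real_inner set \<Rightarrow> ('h \<Rightarrow> 'h) \<Rightarrow> ('h \<times> 'h \<Rightarrow> 'g::real_normed_vector) \<Rightarrow> bool" where
  "admissibility_hyp D A B \<longleftrightarrow>
     bounded_H2_H D A B \<and>
     (\<forall>T>0. \<exists>K>0. \<forall>f w w'. regular_solution D A T f w w' \<longrightarrow>
        integral {0..T} (\<lambda>t. (norm (B (w t, w' t)))\<^sup>2)
          \<le> K * (energy D A 1 (w 0, w' 0) + energy D A 1 (w T, w' T)
                 + integral {0..T} (\<lambda>t. energy D A 1 (w t, w' t))
                 + integral {0..T} (\<lambda>t. (norm (f t))\<^sup>2)))"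

text \<open>
  Extension of \<open>w \<mapsto> B(w,w')\<close> by density to solutions of energy regularity: \<open>g\<close> is the \<open>L\<^sup>2\<close>
  limit of \<open>B(w\<^sub>m,w\<^sub>m')\<close> for regular solutions \<open>w\<^sub>m\<close> whose initial data converge in \<open>H\<^sub>1 \<times> H\<close> and
  whose right-hand sides converge in \<open>L\<^sup>2(0,T;H)\<close>. Under the admissibility hypothesis
  such a \<open>g\<close> exists and is unique up to null sets, so the choice in \<open>observation\<close> is harmless.
\<close>

definition is_observation ::
  "'h::real_inner set \<Rightarrow> ('h \<Rightarrow> 'h) \<Rightarrow> ('h \<times> 'h \<Rightarrow> 'g::real_normed_vector) \<Rightarrow> real \<Rightarrow>
     (real \<Rightarrow> 'h) \<Rightarrow> (real \<Rightarrow> 'h) \<Rightarrow> (real \<Rightarrow> 'g) \<Rightarrow> bool" where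
  "is_observation D A B T w w' g \<longleftrightarrow>
     L2_on T g \<and>
     (\<exists>f fs ws ws'.
        L2_on T f \<and> wave_solution D A {0..T} f w w' \<and>
        (\<forall>m. regular_solution D A T (fs m) (ws m) (ws' m)) \<and>
        (\<lambda>m. energy D A 1 (ws m 0 - w 0, ws' m 0 - w' 0)) \<longlonglongrightarrow> 0 \<and>
        L2_tendsto T fs f \<and>
        L2_tendsto T (\<lambda>m t. B (ws m t, ws' m t)) g)"

definition observation ::
  "'h::real_inner set \<Rightarrow> ('h \<Rightarrow> 'h) \<Rightarrow> ('h \<times> 'h \<Rightarrow> 'g::real_normed_vector) \<Rightarrow> real \<Rightarrow>
     (real \<Rightarrow> 'h) \<Rightarrow> (real \<Rightarrow> 'h) \<Rightarrow> real \<Rightarrow> 'g" where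
  "observation D A B T w w' = (SOME g. is_observation D A B T w w' g)"

definition observability_hyp ::
  "'h::real_inner set \<Rightarrow> ('h \<Rightarrow> 'h) \<Rightarrow> ('h \<times> 'h \<Rightarrow> 'g::real_normed_vector) \<Rightarrow> bool" where
  "observability_hyp D A B \<longleftrightarrow>
     (\<exists>T0>0. \<forall>T>T0. \<exists>R>0. \<forall>w w'. wave_solution D A {0..} (\<lambda>t. 0) w w' \<longrightarrow>
        R * energy D A 1 (w 0, w' 0)
          \<le> integral {0..T} (\<lambda>t. (norm (observation D A B T w w' t))\<^sup>2))"

end

theory Submission
  imports Defs
begin

text \<open>
  The proof is an induction on the order of the cascade, with an arbitrary observation \<open>g \<ge> 0\<close> of the
  last component that bounds its energy over windows of fixed length up to its source. The estimates
  are proved at all times of \<open>[0,T]\<close>, not only at time 0, so that no backward solutions are needed.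

  For the step from \<open>m\<close> to \<open>m + 1\<close>, the primitive in time of the first \<open>m\<close> components is again a cascade.
  The induction hypothesis for it with the observation \<open>\<Pi>\<^sub>m\<^sub>+\<^sub>1 w\<^sub>m\<close>, which is dominated by the coupling,
  bounds the energies of these components by \<open>X = \<integral>\<^sub>0\<^sup>T \<langle>C\<^sub>m\<^sub>+\<^sub>1 w\<^sub>m, w\<^sub>m\<rangle>\<close>, with a factor \<open>T\<^sup>-\<^sup>3\<close> for \<open>i < m\<close> and
  \<open>T\<^sup>-\<^sup>1\<close> for \<open>i = m\<close>. Multiplying the equations of \<open>w\<^sub>m\<close> and \<open>w\<^sub>m\<^sub>+\<^sub>1\<close> by each other gives
  \<open>X = - [\<langle>w\<^sub>m\<^sub>+\<^sub>1', w\<^sub>m\<rangle> - \<langle>w\<^sub>m\<^sub>+\<^sub>1, w\<^sub>m'\<rangle>]\<^sub>0\<^sup>T + \<integral>\<^sub>0\<^sup>T \<langle>C\<^sub>m w\<^sub>m\<^sub>-\<^sub>1, w\<^sub>m\<^sub>+\<^sub>1\<rangle>\<close>, hence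
  \<open>X \<le> c T\<^sup>-\<^sup>1 (E(0) + E(T)) + c T\<^sup>-\<^sup>2 \<integral>\<^sub>0\<^sup>T E\<close> for the energy \<open>E\<close> of \<open>w\<^sub>m\<^sub>+\<^sub>1\<close>. Since the source of \<open>w\<^sub>m\<^sub>+\<^sub>1\<close> is at
  most \<open>c X\<close> in \<open>L\<^sup>2\<close>, averaging replaces the end point terms by \<open>c T\<^sup>-\<^sup>2 \<integral>\<^sub>0\<^sup>T E\<close>, and for large \<open>T\<close> the windows
  bound \<open>\<integral>\<^sub>0\<^sup>T E\<close> by \<open>\<integral>\<^sub>0\<^sup>T g\<close>.
\<close>

text \<open>The coupling observability hypothesis sees a velocity, whereas the coupling term sees
  the position \<open>w m\<close>. This mismatch is why a primitive is used: there
  \<open>w m\<close> is the velocity, at the price of one step down in the scale of energies. It is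
  also why \<open>g\<close> is arbitrary: inside the induction the observation is a bounded
  operator, and \<open>B\<close> enters only at the end. The cubic rate is a product:
  \<open>w m\<close> is bounded by \<open>1/T\<close> times the coupling integral, and the latter by
  \<open>1/T^2\<close> times the observation. For earlier components the product is better and is
  weakened to the same rate. A second obstacle is low regularity. The velocity is only in H, so it
  is not a test function for the weak equation, and the sources in the density extension are only
  square integrable. Energy bounds are therefore obtained by duality with finite sums of eigenmodes.
  Moreover, the extension of \<open>B\<close> brings its own sources, so sources must be unique up
  to null sets; this rests on separability, a consequence of the compact resolvent.\<close>

section \<open>Hilbert spaces and the spectral theorem\<close>

lemma quadratic_nonneg_imp_linear_zero:
  fixes a b :: real
  assumes "\<And>t. 0 \<le> t\<^sup>2 * a - 2 * t * b"
  shows "b = 0"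
proof (rule ccontr)
  assume b: "b \<noteq> 0"
  have a: "a \<ge> 0" using assms[of 1] assms[of "-1"] by simp
  \<comment> \<open>The minimiser would be \<open>b / a\<close>; the summand 1 keeps the denominator
    positive when \<open>a = 0\<close>, and the value is still negative.\<close>
  have "0 \<le> (b / (a + 1))\<^sup>2 * a - 2 * (b / (a + 1)) * b" by (rule assms)
  also have "\<dots> = b\<^sup>2 * (a / (a + 1)\<^sup>2 - 2 / (a + 1))"
    by (simp add: power2_eq_square field_simps)
  also have "a / (a + 1)\<^sup>2 - 2 / (a + 1) = - (a + 2) / (a + 1)\<^sup>2"
    using a by (simp add: power2_eq_square divide_simps)
  finally have "0 \<le> b\<^sup>2 * (- (a + 2) / (a + 1)\<^sup>2)" .
  moreover have "b\<^sup>2 * (- (a + 2) / (a + 1)\<^sup>2) < 0"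
    using a b by (intro mult_pos_neg divide_neg_pos) auto
  ultimately show False by simp
qed

text \<open>A minimising sequence for the distance to \<open>u\<close> is Cauchy by the
  parallelogram law, since midpoints stay in \<open>S\<close>. Varying its limit along some
  \<open>x\<close> in \<open>S\<close> gives a nonnegative quadratic in \<open>t\<close>, whose
  linear coefficient must vanish.\<close>

lemma orthogonal_projection_exists:
  fixes S :: "'h::{real_inner,complete_space} set"
  assumes cl: "closed S" and sub: "subspace S"
  shows "\<exists>p\<in>S. \<forall>v\<in>S. (u - p) \<bullet> v = 0"
proof -
  define q where "q v = (norm (u - v))\<^sup>2" for v
  define \<delta> where "\<delta> = Inf (q ` S)"
  have bdd: "bdd_below (q ` S)" by (rule bdd_belowI[of _ 0]) (auto simp: q_def)
  have ne: "q ` S \<noteq> {}" using subspace_0[OF sub] by auto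
  have lb: "\<delta> \<le> q v" if "v \<in> S" for v
    unfolding \<delta>_def by (rule cInf_lower) (use that bdd in auto)
  have "\<exists>v\<in>S. q v < \<delta> + 1 / real (Suc k)" for k
  proof -
    have "\<delta> < \<delta> + 1 / real (Suc k)" by simp
    from cInf_lessD[OF ne this[unfolded \<delta>_def[symmetric], unfolded \<delta>_def]]
    show ?thesis unfolding \<delta>_def by auto
  qed
  then obtain v where v: "\<And>k. v k \<in> S" and vq: "\<And>k. q (v k) < \<delta> + 1 / real (Suc k)"
    by metis
  have par: "(norm (x - y))\<^sup>2 = 2 * q x + 2 * q y - 4 * q ((1/2) *\<^sub>R (x + y))" for x y
    unfolding q_def power2_norm_eq_inner by (simp add: algebra_simps inner_commute)
  have est: "(norm (v j - v k))\<^sup>2 \<le> 2 / real (Suc j) + 2 / real (Suc k)" for j k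
  proof -
    have "(1/2) *\<^sub>R (v j + v k) \<in> S"
      using v sub by (intro subspace_scale subspace_add)
    then have "\<delta> \<le> q ((1/2) *\<^sub>R (v j + v k))" by (rule lb)
    then show ?thesis using par[of "v j" "v k"] vq[of j] vq[of k] by linarith
  qed
  have "Cauchy v"
  proof (rule metric_CauchyI)
    fix e :: real assume e: "0 < e"
    obtain N where N: "4 / e\<^sup>2 < real N" using reals_Archimedean2 by blast
    have "dist (v j) (v k) < e" if jk: "N \<le> j" "N \<le> k" for j k
    proof -
      have N0: "0 < real N" by (rule le_less_trans[OF _ N]) simp
      have "2 / real (Suc j) \<le> 2 / real (Suc N)" "2 / real (Suc k) \<le> 2 / real (Suc N)"
        using jk by (auto intro!: divide_left_mono)
      then have "(norm (v j - v k))\<^sup>2 \<le> 4 / real (Suc N)" using est[of j k] by simp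
      also have "\<dots> < 4 / real N" using N0 by (intro divide_strict_left_mono) auto
      also have "\<dots> < e\<^sup>2" using N N0 e by (simp add: field_simps)
      finally show ?thesis using e by (simp add: dist_norm power2_less_imp_less)
    qed
    then show "\<exists>M. \<forall>m\<ge>M. \<forall>n\<ge>M. dist (v m) (v n) < e" by blast
  qed
  then obtain p where p: "v \<longlonglongrightarrow> p" using Cauchy_convergent_iff convergent_def by blast
  have pS: "p \<in> S" using closed_sequentially[OF cl v p] .
  have "(\<lambda>k. q (v k)) \<longlonglongrightarrow> q p" unfolding q_def using p by (intro tendsto_intros)
  moreover have "(\<lambda>k. \<delta> + 1 / real (Suc k)) \<longlonglongrightarrow> \<delta> + 0"
    by (intro tendsto_intros LIMSEQ_Suc lim_1_over_n)
  ultimately have qp: "q p \<le> \<delta>"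
    using less_imp_le[OF vq] by (intro LIMSEQ_le[of "\<lambda>k. q (v k)" _ "\<lambda>k. \<delta> + 1 / real (Suc k)"]) auto
  have "(u - p) \<bullet> x = 0" if x: "x \<in> S" for x
  proof (rule quadratic_nonneg_imp_linear_zero[where a = "x \<bullet> x"])
    fix t :: real
    have "p + t *\<^sub>R x \<in> S" using pS x sub by (intro subspace_scale subspace_add)
    then have "q p \<le> q (p + t *\<^sub>R x)" using lb qp by force
    then show "0 \<le> t\<^sup>2 * (x \<bullet> x) - 2 * t * ((u - p) \<bullet> x)"
      unfolding q_def power2_norm_eq_inner
      by (simp add: algebra_simps inner_commute power2_eq_square)
  qed
  then show ?thesis using pS by blast
qed

section \<open>Orthogonal projections, Riesz representation and adjoints\<close>

lemma
  fixes S :: "'h::{real_inner,complete_space} set"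
  assumes cl: "closed S" and sub: "subspace S"
  shows orth_proj_in: "orth_proj S u \<in> S"
    and orth_proj_orth: "v \<in> S \<Longrightarrow> (u - orth_proj S u) \<bullet> v = 0"
proof -
  obtain p where p: "p \<in> S" "\<forall>v\<in>S. (u - p) \<bullet> v = 0"
    using orthogonal_projection_exists[OF assms] by blast
  have uniq: "r = p" if "r \<in> S \<and> (\<forall>v\<in>S. (u - r) \<bullet> v = 0)" for r
  proof -
    have d: "r - p \<in> S" using that p sub by (intro subspace_diff) auto
    have "(r - p) \<bullet> (r - p) = (u - p) \<bullet> (r - p) - (u - r) \<bullet> (r - p)"
      by (simp add: algebra_simps)
    also have "\<dots> = 0" using p that d by auto
    finally show ?thesis by simp
  qed
  have "orth_proj S u \<in> S \<and> (\<forall>v\<in>S. (u - orth_proj S u) \<bullet> v = 0)"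
    unfolding orth_proj_def
  proof (rule theI[where a = p and P = "\<lambda>p. p \<in> S \<and> (\<forall>v\<in>S. (u - p) \<bullet> v = 0)"])
    show "p \<in> S \<and> (\<forall>v\<in>S. (u - p) \<bullet> v = 0)" using p by blast
  qed (rule uniq)
  then show "orth_proj S u \<in> S" "v \<in> S \<Longrightarrow> (u - orth_proj S u) \<bullet> v = 0" by auto
qed

lemma orth_proj_eqI:
  fixes S :: "'h::{real_inner,complete_space} set"
  assumes cl: "closed S" and sub: "subspace S"
    and "p \<in> S" and "\<And>v. v \<in> S \<Longrightarrow> (u - p) \<bullet> v = 0"
  shows "orth_proj S u = p"
proof -
  have d: "orth_proj S u - p \<in> S"
    using orth_proj_in[OF cl sub] assms(3) sub by (intro subspace_diff) auto
  have "(orth_proj S u - p) \<bullet> (orth_proj S u - p)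
      = (u - p) \<bullet> (orth_proj S u - p) - (u - orth_proj S u) \<bullet> (orth_proj S u - p)"
    by (simp add: algebra_simps)
  also have "\<dots> = 0" using orth_proj_orth[OF cl sub d] assms(4)[OF d] by auto
  finally show ?thesis by simp
qed

text \<open>The orthogonal complement of the kernel is a line, spanned by the component
  \<open>p\<close> of any \<open>y\<close> with \<open>f y \<noteq> 0\<close>. Subtracting the right
  multiple of \<open>p\<close> from \<open>x\<close> lands in the kernel, which reads off
  \<open>f x\<close>.\<close>

theorem riesz_representation:
  fixes f :: "'h::{real_inner,complete_space} \<Rightarrow> real"
  assumes "bounded_linear f"
  shows "\<exists>z. \<forall>x. f x = x \<bullet> z"
proof (cases "\<forall>x. f x = 0")
  case True
  then show ?thesis by (intro exI[of _ 0]) simp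
next
  case False
  then obtain y where y: "f y \<noteq> 0" by blast
  interpret f: bounded_linear f by fact
  define N where "N = {x. f x = 0}"
  have cl: "closed N"
    unfolding N_def by (intro closed_Collect_eq linear_continuous_on assms continuous_on_const)
  have sub: "subspace N" unfolding N_def subspace_def by (simp add: f.add f.scaleR f.zero)
  define p where "p = y - orth_proj N y"
  have "orth_proj N y \<in> N" by (rule orth_proj_in[OF cl sub])
  then have fp: "f p = f y" by (simp add: p_def N_def f.diff)
  have orth: "p \<bullet> v = 0" if "f v = 0" for v
    unfolding p_def by (rule orth_proj_orth[OF cl sub]) (simp add: N_def that)
  have p0: "p \<bullet> p \<noteq> 0" using fp y f.zero by (metis inner_eq_zero_iff)
  have "f x = x \<bullet> ((f y / (p \<bullet> p)) *\<^sub>R p)" for x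
  proof -
    have "p \<bullet> (x - (f x / f y) *\<^sub>R p) = 0" by (rule orth) (simp add: f.diff f.scaleR fp y)
    then have "p \<bullet> x = (f x / f y) * (p \<bullet> p)" by (simp add: inner_diff_right)
    then show ?thesis using y p0 by (simp add: inner_commute field_simps)
  qed
  then show ?thesis by blast
qed

text \<open>\<open>adjoint\<close> is a choice among maps with this property, so the content is that
  one exists; Riesz supplies it.\<close>

lemma adjoint_property:
  fixes L :: "'h::{real_inner,complete_space} \<Rightarrow> 'h"
  assumes "bounded_linear L"
  shows "L x \<bullet> y = x \<bullet> adjoint L y"
proof -
  have "\<exists>z. \<forall>x. L x \<bullet> y = x \<bullet> z" for y
    by (rule riesz_representation)
       (intro bounded_linear_compose[OF bounded_linear_inner_left assms, unfolded o_def])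
  then obtain g where "\<And>y x. L x \<bullet> y = x \<bullet> g y" by metis
  then have "\<exists>g. \<forall>x y. L x \<bullet> y = x \<bullet> g y" by blast
  from someI_ex[OF this] show ?thesis unfolding adjoint_def by blast
qed

text \<open>A sequence maximising \<open>norm (R x)\<close> on the unit ball of \<open>N\<close>
  consists of approximate eigenvectors of the square of \<open>R\<close>, and compactness makes its
  images converge. Working in an invariant subspace allows the use in the orthogonal complement of
  all eigenspaces.\<close>

theorem compact_symmetric_eigenvector:
  fixes R :: "'h::{real_inner,complete_space} \<Rightarrow> 'h" and N :: "'h set"
  assumes R: "compact_op R" and sym: "\<And>x y. R x \<bullet> y = x \<bullet> R y"
    and cl: "closed N" and sub: "subspace N" and inv: "\<And>x. x \<in> N \<Longrightarrow> R x \<in> N"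
    and y: "y \<in> N" "R y \<noteq> 0"
  shows "\<exists>v\<in>N. \<exists>l. v \<noteq> 0 \<and> l \<noteq> 0 \<and> R v = l *\<^sub>R v"
proof -
  interpret R: bounded_linear R using R by (simp add: compact_op_def)
  define U where "U = N \<inter> cball 0 1"
  define r where "r = Sup ((\<lambda>x. norm (R x)) ` U)"
  obtain M where M: "\<And>x. norm (R x) \<le> norm x * M" using R.bounded by blast
  have M0: "norm (R x) \<le> \<bar>M\<bar>" if "norm x \<le> 1" for x
  proof -
    have "norm (R x) \<le> norm x * \<bar>M\<bar>"
      using M[of x] by (meson abs_ge_self mult_left_mono norm_ge_zero order_trans)
    also have "\<dots> \<le> 1 * \<bar>M\<bar>" using that by (intro mult_right_mono) auto
    finally show ?thesis by simp
  qed
  have bdd: "bdd_above ((\<lambda>x. norm (R x)) ` U)"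
    by (rule bdd_aboveI[of _ "\<bar>M\<bar>"]) (auto simp: U_def M0)
  have ub: "norm (R x) \<le> r" if "x \<in> U" for x
    unfolding r_def by (rule cSup_upper) (use that bdd in auto)
  have ubN: "norm (R x) \<le> r * norm x" if "x \<in> N" for x
  proof (cases "x = 0")
    case True then show ?thesis by (simp add: R.zero)
  next
    case False
    have "(1 / norm x) *\<^sub>R x \<in> U" using that sub False by (simp add: U_def subspace_scale)
    from ub[OF this] show ?thesis using False by (simp add: R.scaleR field_simps)
  qed
  have r0: "r > 0"
  proof -
    have "0 < norm (R y)" using y by simp
    also have "\<dots> \<le> r * norm y" by (rule ubN[OF y(1)])
    finally show ?thesis by (metis norm_ge_zero not_less zero_less_mult_iff)
  qed
  have ne: "(\<lambda>x. norm (R x)) ` U \<noteq> {}" using subspace_0[OF sub] by (auto simp: U_def)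
  have "\<exists>x\<in>U. r - 1 / real (Suc k) < norm (R x)" for k
  proof -
    have "r - 1 / real (Suc k) < Sup ((\<lambda>x. norm (R x)) ` U)" unfolding r_def by simp
    from less_cSupD[OF ne this] show ?thesis by auto
  qed
  then obtain x where x: "\<And>k. x k \<in> U" and xr: "\<And>k. r - 1 / real (Suc k) < norm (R (x k))"
    by metis
  have "compact (closure (R ` cball 0 1))" using R by (simp add: compact_op_def)
  moreover have "\<forall>k. R (x k) \<in> closure (R ` cball 0 1)"
    using x closure_subset by (fastforce simp: U_def)
  ultimately obtain z h where h: "strict_mono (h :: nat \<Rightarrow> nat)"
      and z: "((\<lambda>k. R (x k)) \<circ> h) \<longlonglongrightarrow> z"
    unfolding compact_def by metis
  have nlim: "(\<lambda>k. norm (R (x k))) \<longlonglongrightarrow> r"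
  proof (rule tendsto_sandwich[of "\<lambda>k. r - 1 / real (Suc k)" _ _ "\<lambda>_. r"])
    have "(\<lambda>k. r - 1 / real (Suc k)) \<longlonglongrightarrow> r - 0"
      by (intro tendsto_intros LIMSEQ_Suc lim_1_over_n)
    then show "(\<lambda>k. r - 1 / real (Suc k)) \<longlonglongrightarrow> r" by simp
    show "\<forall>\<^sub>F k in sequentially. r - 1 / real (Suc k) \<le> norm (R (x k))"
      using xr by (intro always_eventually allI less_imp_le)
  qed (use ub x in auto)
  have nlim': "(\<lambda>k. norm (R (x (h k)))) \<longlonglongrightarrow> r"
    using LIMSEQ_subseq_LIMSEQ[OF nlim h] by (simp add: o_def)
  have z': "(\<lambda>k. R (x (h k))) \<longlonglongrightarrow> z" using z by (simp add: o_def)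
  have nz: "norm z = r" using tendsto_norm[OF z'] nlim' LIMSEQ_unique by blast
  \<comment> \<open>In the expanded square the cross term is \<open>(norm (R x))\<^sup>2\<close> by
    symmetry, and the other two terms are each at most the fourth power of \<open>r\<close>. So the
    defect is controlled by the distance of \<open>norm (R x)\<close> from its supremum.\<close>
  have lim0: "(\<lambda>k. (norm (R (R (x (h k))) - r\<^sup>2 *\<^sub>R x (h k)))\<^sup>2) \<longlonglongrightarrow> 0"
  proof (rule tendsto_sandwich[of "\<lambda>_. 0" _ _ "\<lambda>k. 2 * r\<^sup>2 * (r\<^sup>2 - (norm (R (x (h k))))\<^sup>2)"])
    show "\<forall>\<^sub>F k in sequentially. (norm (R (R (x (h k))) - r\<^sup>2 *\<^sub>R x (h k)))\<^sup>2
        \<le> 2 * r\<^sup>2 * (r\<^sup>2 - (norm (R (x (h k))))\<^sup>2)"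
    proof (intro always_eventually allI)
      fix k
      let ?x = "x (h k)"
      have xN: "?x \<in> N" and xn: "norm ?x \<le> 1" using x[of "h k"] by (auto simp: U_def)
      have "norm (R (R ?x)) \<le> r * norm (R ?x)" by (rule ubN[OF inv[OF xN]])
      also have "\<dots> \<le> r * r" using ub[OF x[of "h k"]] r0 by (intro mult_left_mono) auto
      finally have "(norm (R (R ?x)))\<^sup>2 \<le> (r * r)\<^sup>2" by (intro power_mono) auto
      moreover have "(r\<^sup>2)\<^sup>2 * (norm ?x)\<^sup>2 \<le> (r\<^sup>2)\<^sup>2 * 1"
        using xn by (intro mult_left_mono) (auto simp: power_le_one)
      moreover have "(norm (R (R ?x) - r\<^sup>2 *\<^sub>R ?x))\<^sup>2
         = (norm (R (R ?x)))\<^sup>2 - 2 * r\<^sup>2 * (R (R ?x) \<bullet> ?x) + (r\<^sup>2)\<^sup>2 * (norm ?x)\<^sup>2"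
        unfolding power2_norm_eq_inner
        by (simp add: algebra_simps inner_commute power2_eq_square)
      moreover have "R (R ?x) \<bullet> ?x = (norm (R ?x))\<^sup>2"
        by (simp add: sym power2_norm_eq_inner)
      ultimately show "(norm (R (R ?x) - r\<^sup>2 *\<^sub>R ?x))\<^sup>2 \<le> 2 * r\<^sup>2 * (r\<^sup>2 - (norm (R ?x))\<^sup>2)"
        by (simp add: algebra_simps power2_eq_square)
    qed
    have "(\<lambda>k. 2 * r\<^sup>2 * (r\<^sup>2 - (norm (R (x (h k))))\<^sup>2)) \<longlonglongrightarrow> 2 * r\<^sup>2 * (r\<^sup>2 - r\<^sup>2)"
      using nlim' by (intro tendsto_intros)
    then show "(\<lambda>k. 2 * r\<^sup>2 * (r\<^sup>2 - (norm (R (x (h k))))\<^sup>2)) \<longlonglongrightarrow> 0" by simp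
  qed auto
  have d0: "(\<lambda>k. R (R (x (h k))) - r\<^sup>2 *\<^sub>R x (h k)) \<longlonglongrightarrow> 0"
    using tendsto_real_sqrt[OF lim0] by (simp add: tendsto_norm_zero_iff)
  have Rz: "(\<lambda>k. R (R (x (h k)))) \<longlonglongrightarrow> R z" by (rule R.tendsto[OF z'])
  have "(\<lambda>k. R (R (x (h k))) - (R (R (x (h k))) - r\<^sup>2 *\<^sub>R x (h k))) \<longlonglongrightarrow> R z - 0"
    by (intro tendsto_diff Rz d0)
  then have rx: "(\<lambda>k. r\<^sup>2 *\<^sub>R x (h k)) \<longlonglongrightarrow> R z" by simp
  have zN: "z \<in> N"
    by (rule closed_sequentially[OF cl _ z']) (use x inv in \<open>auto simp: U_def\<close>)
  have "(\<lambda>k. R (r\<^sup>2 *\<^sub>R x (h k))) \<longlonglongrightarrow> R (R z)" by (rule R.tendsto[OF rx])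
  moreover have "(\<lambda>k. R (r\<^sup>2 *\<^sub>R x (h k))) \<longlonglongrightarrow> r\<^sup>2 *\<^sub>R z"
    unfolding R.scaleR by (intro tendsto_intros z')
  ultimately have RRz: "R (R z) = r\<^sup>2 *\<^sub>R z" using LIMSEQ_unique by blast
  show ?thesis
  \<comment> \<open>The operator \<open>R\<close> squared minus \<open>r\<^sup>2\<close> factors, so
    either \<open>z\<close> has the eigenvalue \<open>- r\<close> or
    \<open>R z + r *\<^sub>R z\<close> has the eigenvalue \<open>r\<close>.\<close>
  proof (cases "R z + r *\<^sub>R z = 0")
    case True
    then have "R z = (- r) *\<^sub>R z" by (simp add: add_eq_0_iff2)
    then show ?thesis using zN nz r0 by (intro bexI[of _ z] exI[of _ "- r"]) auto
  next
    case False
    have "R (R z + r *\<^sub>R z) = r *\<^sub>R (R z + r *\<^sub>R z)"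
      by (simp add: R.add R.scaleR RRz scaleR_add_right power2_eq_square)
    moreover have "R z + r *\<^sub>R z \<in> N" using zN inv sub by (intro subspace_add subspace_scale)
    ultimately show ?thesis using False r0 by (intro bexI[of _ "R z + r *\<^sub>R z"] exI[of _ r]) auto
  qed
qed

text \<open>Finite nets of radius \<open>1 / Suc m\<close> make the compact closure separable, and
  homogeneity extends this from the unit ball to the whole range. Separability of the space comes
  from here.\<close>

lemma compact_op_countable_dense:
  fixes R :: "'h::real_normed_vector \<Rightarrow> 'h"
  assumes "compact_op R"
  shows "\<exists>Q. countable Q \<and> (\<forall>x. \<exists>c. R x \<in> (\<lambda>q. c *\<^sub>R q) ` closure Q)"
proof -
  interpret R: bounded_linear R using assms by (simp add: compact_op_def)
  let ?K = "closure (R ` cball 0 1)"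
  have "compact ?K" using assms by (simp add: compact_op_def)
  then have "\<forall>e>0. \<exists>k. finite k \<and> ?K \<subseteq> (\<Union>x\<in>k. ball x e)"
    by (simp add: compact_eq_totally_bounded)
  then have "\<forall>m. \<exists>k. finite k \<and> ?K \<subseteq> (\<Union>x\<in>k. ball x (1 / real (Suc m)))" by simp
  then obtain k where k: "\<And>m. finite (k m)" "\<And>m. ?K \<subseteq> (\<Union>x\<in>k m. ball x (1 / real (Suc m)))"
    by metis
  define Q where "Q = (\<Union>m. k m)"
  have "?K \<subseteq> closure Q"
  proof
    fix y assume y: "y \<in> ?K"
    show "y \<in> closure Q"
      unfolding closure_approachable
    proof (intro allI impI)
      fix e :: real assume "0 < e"
      then obtain m where m: "1 / real (Suc m) < e" using nat_approx_posE by metis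
      obtain x where x: "x \<in> k m" "dist x y < 1 / real (Suc m)" using k(2)[of m] y by auto
      then show "\<exists>x\<in>Q. dist x y < e" using m unfolding Q_def by force
    qed
  qed
  moreover have "\<exists>c. \<exists>q\<in>?K. R x = c *\<^sub>R q" for x
  proof -
    have "R x = (norm x) *\<^sub>R R ((1 / norm x) *\<^sub>R x)" by (cases "x = 0") (auto simp: R.scaleR R.zero)
    moreover have "R ((1 / norm x) *\<^sub>R x) \<in> ?K"
      by (rule subsetD[OF closure_subset]) (auto simp: divide_simps)
    ultimately show ?thesis by blast
  qed
  moreover have "countable Q" unfolding Q_def using k(1) by (auto intro: countable_finite)
  ultimately show ?thesis by (intro exI[of _ Q]) blast
qed

section \<open>Eigenvalues and eigenspaces of the operator\<close>

locale wave_operator =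
  fixes D :: "'h::{real_inner,complete_space} set" and A :: "'h \<Rightarrow> 'h" and \<omega> :: real
  assumes self_adjoint: "self_adjoint_op D A" and positive: "positive_op D A"
    and resolvent: "compact_resolvent D A"
    and \<omega>_pos: "\<omega> > 0" and bounded_below: "\<forall>u\<in>D. \<omega> * norm u \<le> norm (A u)"
begin

abbreviation "E l \<equiv> eigenspace D A l"
abbreviation "\<sigma> \<equiv> eigenvalues D A"

lemma subspace_D: "subspace D" and dense_D: "closure D = UNIV"
  and A_scale: "u \<in> D \<Longrightarrow> A (c *\<^sub>R u) = c *\<^sub>R A u"
  and A_adjoint: "(v \<in> D \<and> A v = z) \<longleftrightarrow> (\<forall>u\<in>D. A u \<bullet> v = u \<bullet> z)"
  using self_adjoint unfolding self_adjoint_op_def by blast+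

lemma A_sym: "u \<in> D \<Longrightarrow> v \<in> D \<Longrightarrow> A u \<bullet> v = u \<bullet> A v"
  using A_adjoint[of v "A v"] by blast

lemma A_0: "A 0 = 0"
  using A_scale[of 0 0] subspace_0[OF subspace_D] by simp

text \<open>Self-adjointness turns membership in the domain together with the eigenvalue equation
  into a family of continuous linear conditions, so closedness is immediate although
  \<open>A\<close> is unbounded.\<close>

lemma eigenspace_alt: "E l = {v. \<forall>u\<in>D. A u \<bullet> v = u \<bullet> (l *\<^sub>R v)}"
  unfolding eigenspace_def using A_adjoint by blast

lemma closed_E: "closed (E l)"
  unfolding eigenspace_alt Collect_ball_eq
  by (intro closed_INT ballI closed_Collect_eq continuous_intros)

lemma subspace_E: "subspace (E l)"
  unfolding eigenspace_alt subspace_def by (auto simp: inner_add_right distrib_left)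

lemma \<sigma>_ge: assumes "l \<in> \<sigma>" shows "\<omega> \<le> l"
proof -
  obtain u where u: "u \<in> D" "A u = l *\<^sub>R u" "u \<noteq> 0"
    using assms by (auto simp: eigenvalues_def eigenspace_def)
  have "0 \<le> l * (u \<bullet> u)" using positive u by (force simp: positive_op_def)
  then have "0 \<le> l" using u by (metis inner_gt_zero_iff not_le zero_le_mult_iff)
  moreover have "\<omega> * norm u \<le> \<bar>l\<bar> * norm u" using bounded_below u by force
  ultimately show ?thesis using u by simp
qed

lemma \<sigma>_pos: "l \<in> \<sigma> \<Longrightarrow> 0 < l" using \<sigma>_ge \<omega>_pos by fastforce

lemma E_orth:
  assumes "u \<in> E l" "v \<in> E m" "l \<noteq> m" shows "u \<bullet> v = 0"
proof -
  have "l * (u \<bullet> v) = m * (u \<bullet> v)"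
    using A_sym[of u v] assms by (auto simp: eigenspace_def)
  then show ?thesis using assms by simp
qed

lemma E_trivial: "l \<notin> \<sigma> \<Longrightarrow> u \<in> E l \<Longrightarrow> u = 0"
  unfolding eigenvalues_def by blast

lemma resolvent_obtain:
  obtains R \<mu> where "compact_op R" "\<And>f. R f \<in> D" "\<And>f. A (R f) - \<mu> *\<^sub>R R f = f"
    "\<And>u. u \<in> D \<Longrightarrow> R (A u - \<mu> *\<^sub>R u) = u"
proof -
  from resolvent obtain \<mu> R where "compact_op R"
    "(\<forall>f. R f \<in> D \<and> A (R f) - \<mu> *\<^sub>R R f = f) \<and> (\<forall>u\<in>D. R (A u - \<mu> *\<^sub>R u) = u)"
    unfolding compact_resolvent_def by (elim exE conjE) (rule that, auto)
  then show thesis by (intro that[of R \<mu>]) auto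
qed

text \<open>The orthogonal complement of all eigenspaces is closed and invariant under the
  resolvent. If it were not trivial, the resolvent would have an eigenvector in it; this is also an
  eigenvector of \<open>A\<close> and hence orthogonal to itself.\<close>

theorem eigenspaces_total:
  assumes orth: "\<And>l v. v \<in> E l \<Longrightarrow> x \<bullet> v = 0"
  shows "x = 0"
proof (rule ccontr)
  assume x0: "x \<noteq> 0"
  obtain \<mu> R where cR: "compact_op R" and RD: "\<And>f. R f \<in> D" and AR: "\<And>f. A (R f) - \<mu> *\<^sub>R R f = f"
    and RA: "\<And>u. u \<in> D \<Longrightarrow> R (A u - \<mu> *\<^sub>R u) = u" using resolvent_obtain by metis
  interpret R: bounded_linear R using cR by (simp add: compact_op_def)
  define N where "N = {y. \<forall>l. \<forall>v\<in>E l. y \<bullet> v = 0}"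
  have Rsym: "R f \<bullet> g = f \<bullet> R g" for f g
  proof -
    have "R f \<bullet> g = R f \<bullet> (A (R g) - \<mu> *\<^sub>R R g)" by (simp add: AR)
    also have "\<dots> = (A (R f) - \<mu> *\<^sub>R R f) \<bullet> R g"
      using A_sym[OF RD RD] by (simp add: inner_diff_left inner_diff_right)
    also have "\<dots> = f \<bullet> R g" by (simp add: AR)
    finally show ?thesis .
  qed
  have cl: "closed N"
    unfolding N_def Ball_def by (intro closed_Collect_all closed_Collect_imp closed_Collect_eq continuous_intros) simp
  have sub: "subspace N"
    unfolding N_def subspace_def by (simp add: inner_add_left)
  have inv: "R y \<in> N" if y: "y \<in> N" for y
    unfolding N_def
  proof (intro CollectI allI ballI)
    fix l v assume v: "v \<in> E l"
    have "R (A v - \<mu> *\<^sub>R v) = v" using RA[of v] v by (simp add: eigenspace_def)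
    then have e: "(l - \<mu>) *\<^sub>R R v = v"
      using v by (simp add: eigenspace_def R.diff R.scaleR scaleR_diff_left)
    show "R y \<bullet> v = 0"
    \<comment> \<open>The resolvent exists at \<open>\<mu>\<close>, so the eigenspace of
      \<open>\<mu>\<close> contains only the zero vector.\<close>
    proof (cases "l = \<mu>")
      case True then have "v = 0" using e by simp
      then show ?thesis by simp
    next
      case False
      have "R y \<bullet> v = y \<bullet> R v" by (rule Rsym)
      also have "R v = (1 / (l - \<mu>)) *\<^sub>R v" using False by (subst e[symmetric]) simp
      also have "y \<bullet> \<dots> = 0" using y v by (simp add: N_def)
      finally show ?thesis .
    qed
  qed
  have xN: "x \<in> N" using orth by (auto simp: N_def)
  have Rx: "R x \<noteq> 0" using AR[of x] x0 A_0 by auto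
  obtain v l where v: "v \<in> N" "v \<noteq> 0" "l \<noteq> 0" "R v = l *\<^sub>R v"
    using compact_symmetric_eigenvector[OF cR Rsym cl sub inv xN Rx] by blast
  have vD: "v \<in> D"
    using RD[of "(1 / l) *\<^sub>R v"] v by (simp add: R.scaleR)
  have "l *\<^sub>R A v - (\<mu> * l) *\<^sub>R v = v" using AR[of v] v A_scale[OF vD] by simp
  then have "A v = (1 / l) *\<^sub>R (v + (\<mu> * l) *\<^sub>R v)"
    using v(3) by (metis diff_add_cancel divide_self_if scaleR_one scaleR_scaleR times_divide_eq_left mult_1)
  \<comment> \<open>An eigenvalue \<open>l\<close> of the resolvent corresponds to the eigenvalue
    \<open>\<mu> + 1 / l\<close> of \<open>A\<close>.\<close>
  then have "v \<in> E ((1 + \<mu> * l) / l)" using vD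
    by (simp add: eigenspace_def add_divide_distrib scaleR_add_left scaleR_add_right)
  then have "v \<bullet> v = 0" using v(1) unfolding N_def by blast
  then show False using v by simp
qed

end

section \<open>Unordered orthogonal series\<close>

lemma norm_sum_orthogonal:
  fixes x :: "'i \<Rightarrow> 'h::real_inner"
  assumes "finite F" and "\<And>i j. i \<in> F \<Longrightarrow> j \<in> F \<Longrightarrow> i \<noteq> j \<Longrightarrow> x i \<bullet> x j = 0"
  shows "(norm (\<Sum>i\<in>F. x i))\<^sup>2 = (\<Sum>i\<in>F. (norm (x i))\<^sup>2)"
  using assms
proof (induction F rule: finite_induct)
  case (insert i F)
  have "x i \<bullet> (\<Sum>i\<in>F. x i) = 0"
    unfolding inner_sum_right by (rule sum.neutral) (use insert in auto)
  then have "(norm (x i + (\<Sum>i\<in>F. x i)))\<^sup>2 = (norm (x i))\<^sup>2 + (norm (\<Sum>i\<in>F. x i))\<^sup>2"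
    by (simp add: power2_norm_eq_inner inner_add_left inner_add_right inner_commute)
  then show ?case using insert by simp
qed simp

text \<open>By Pythagoras the squared distance between partial sums over nested finite sets is a
  difference of scalar partial sums, so the net of finite partial sums is Cauchy. Nets are used
  because sums over the spectrum carry no order.\<close>

lemma summable_on_orthogonal:
  fixes x :: "'i \<Rightarrow> 'h::{real_inner,complete_space}"
  assumes orth: "\<And>i j. i \<in> I \<Longrightarrow> j \<in> I \<Longrightarrow> i \<noteq> j \<Longrightarrow> x i \<bullet> x j = 0"
    and sm: "(\<lambda>i. (norm (x i))\<^sup>2) summable_on I"
  shows "x summable_on I"
proof -
  define a where "a i = (norm (x i))\<^sup>2" for i
  obtain L where L: "(sum a \<longlongrightarrow> L) (finite_subsets_at_top I)"
    using sm unfolding summable_on_def has_sum_def a_def by blast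
  have "\<exists>P. eventually P (finite_subsets_at_top I) \<and>
      (\<forall>F F'. P F \<and> P F' \<longrightarrow> dist (sum x F) (sum x F') < e)" if e: "e > 0" for e
  proof -
    have "\<forall>\<^sub>F F in finite_subsets_at_top I. dist (sum a F) L < e\<^sup>2 / 16"
      using L e by (intro tendstoD) auto
    then obtain F0 where F0: "finite F0" "F0 \<subseteq> I"
        and near: "\<And>F. finite F \<Longrightarrow> F0 \<subseteq> F \<Longrightarrow> F \<subseteq> I \<Longrightarrow> dist (sum a F) L < e\<^sup>2 / 16"
      unfolding eventually_finite_subsets_at_top by metis
    define P where "P F \<longleftrightarrow> finite F \<and> F0 \<subseteq> F \<and> F \<subseteq> I" for F
    have tail: "norm (sum x F - sum x F0) < e / 2" if F: "P F" for F
    proof -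
      have fin: "finite F" "F0 \<subseteq> F" "F \<subseteq> I" using F by (auto simp: P_def)
      have "sum x F - sum x F0 = sum x (F - F0)" using fin by (simp add: sum_diff)
      then have "(norm (sum x F - sum x F0))\<^sup>2 = (norm (sum x (F - F0)))\<^sup>2" by simp
      also have "\<dots> = sum a (F - F0)"
        unfolding a_def by (rule norm_sum_orthogonal) (use fin in \<open>auto intro!: orth\<close>)
      also have "sum a (F - F0) = sum a F - sum a F0" using fin by (simp add: sum_diff)
      also have "\<dots> < e\<^sup>2 / 8"
        using near[of F] near[of F0] fin F0 unfolding dist_real_def abs_less_iff by auto
      also have "\<dots> \<le> (e / 2)\<^sup>2" by (simp add: power2_eq_square)
      finally show ?thesis by (rule power2_less_imp_less) (use e in simp)
    qed
    have "dist (sum x F) (sum x F') < e" if "P F" "P F'" for F F'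
      using tail[OF that(1)] tail[OF that(2)]
      by (metis dist_norm dist_triangle_half_r norm_minus_commute)
    moreover have "eventually P (finite_subsets_at_top I)"
      unfolding eventually_finite_subsets_at_top P_def using F0 by blast
    ultimately show ?thesis by blast
  qed
  then have "cauchy_filter (filtermap (sum x) (finite_subsets_at_top I))"
    by (simp add: cauchy_filter_metric_filtermap)
  moreover have "complete (UNIV :: 'h set)"
    by (meson Cauchy_convergent UNIV_I complete_def convergent_def)
  ultimately obtain y where "(sum x \<longlongrightarrow> y) (finite_subsets_at_top I)"
    using complete_uniform[where S = UNIV] by (force simp: filterlim_def)
  then show ?thesis unfolding summable_on_def has_sum_def by blast
qed

lemma has_sum_norm_orthogonal:
  fixes x :: "'i \<Rightarrow> 'h::real_inner"
  assumes orth: "\<And>i j. i \<in> I \<Longrightarrow> j \<in> I \<Longrightarrow> i \<noteq> j \<Longrightarrow> x i \<bullet> x j = 0"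
    and y: "(x has_sum y) I"
  shows "((\<lambda>i. (norm (x i))\<^sup>2) has_sum (norm y)\<^sup>2) I"
  unfolding has_sum_def
proof (rule Lim_transform_eventually)
  show "((\<lambda>F. (norm (sum x F))\<^sup>2) \<longlongrightarrow> (norm y)\<^sup>2) (finite_subsets_at_top I)"
    using y unfolding has_sum_def by (intro tendsto_intros)
  show "\<forall>\<^sub>F F in finite_subsets_at_top I. (norm (sum x F))\<^sup>2 = (\<Sum>i\<in>F. (norm (x i))\<^sup>2)"
    by (rule eventually_finite_subsets_at_top_weakI) (auto intro!: norm_sum_orthogonal orth)
qed

section \<open>Functional calculus\<close>

context wave_operator
begin

abbreviation "P l \<equiv> orth_proj (E l)"

lemma P_in: "P l u \<in> E l" by (rule orth_proj_in[OF closed_E subspace_E])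

lemma inner_P: assumes "v \<in> E l" shows "u \<bullet> v = P l u \<bullet> v"
  using orth_proj_orth[OF closed_E subspace_E assms, of u] by (simp add: inner_diff_left)

lemma P_eqI: assumes "p \<in> E l" "\<And>v. v \<in> E l \<Longrightarrow> u \<bullet> v = p \<bullet> v" shows "P l u = p"
  by (rule orth_proj_eqI[OF closed_E subspace_E]) (use assms in \<open>auto simp: inner_diff_left\<close>)

lemma P_sym: "P l u \<bullet> P l v = u \<bullet> P l v"
  using inner_P[OF P_in[of l v], of u] by simp

lemma P_self: "v \<in> E l \<Longrightarrow> P l v = v" by (rule P_eqI) auto

lemma P_other: "v \<in> E m \<Longrightarrow> m \<noteq> l \<Longrightarrow> P l v = 0"
  by (rule P_eqI) (auto simp: E_orth subspace_0[OF subspace_E])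

lemma P_add: "P l (u + v) = P l u + P l v"
  by (rule P_eqI) (auto simp: inner_add_left inner_P[symmetric] intro: subspace_add[OF subspace_E] P_in)

lemma P_scale: "P l (c *\<^sub>R u) = c *\<^sub>R P l u"
  by (rule P_eqI) (auto simp: inner_P[symmetric] intro: subspace_scale[OF subspace_E] P_in)

lemma norm_P_le: "norm (P l u) \<le> norm u"
proof (cases "P l u = 0")
  case False
  have "norm (P l u) * norm (P l u) = u \<bullet> P l u"
    by (metis P_sym power2_eq_square power2_norm_eq_inner)
  also have "\<dots> \<le> norm u * norm (P l u)" by (rule norm_cauchy_schwarz)
  finally show ?thesis using False by simp
qed simp

lemma bounded_linear_P: "bounded_linear (P l)"
  by (rule bounded_linear_intro[where K = 1]) (auto simp: P_add P_scale norm_P_le)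

lemmas linear_P = bounded_linear.linear[OF bounded_linear_P]
lemmas P_diff = linear_diff[OF linear_P]
lemmas P_zero [simp] = linear_0[OF linear_P]

lemma P_scaled_orth: "i \<noteq> j \<Longrightarrow> (a *\<^sub>R P i u) \<bullet> (b *\<^sub>R P j v) = 0"
  using E_orth[OF P_in P_in] by simp

lemma P_scaled_in: "c *\<^sub>R P l u \<in> E l" by (intro subspace_scale[OF subspace_E] P_in)

text \<open>The projection is continuous and may be applied termwise; by orthogonality a single term
  survives.\<close>

lemma P_family_sum:
  assumes x: "\<And>l. l \<in> \<sigma> \<Longrightarrow> x l \<in> E l" and y: "(x has_sum y) \<sigma>" and l: "l \<in> \<sigma>"
  shows "P l y = x l"
proof -
  have "((\<lambda>m. P l (x m)) has_sum P l y) \<sigma>" by (rule has_sum_bounded_linear[OF bounded_linear_P y])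
  moreover have "((\<lambda>m. P l (x m)) has_sum x l) \<sigma>"
    by (rule has_sum_finite_neutralI[of "{l}"]) (use x l P_other P_self in auto)
  ultimately show ?thesis by (rule has_sum_unique)
qed

lemma eq_if_P_eq: assumes "\<And>l. l \<in> \<sigma> \<Longrightarrow> P l u = P l v" shows "u = v"
proof -
  have "u - v = 0"
  proof (rule eigenspaces_total)
    fix l w assume w: "w \<in> E l"
    have "(u - v) \<bullet> w = P l (u - v) \<bullet> w" by (rule inner_P[OF w])
    also have "\<dots> = 0" using assms[of l] E_trivial[OF _ w] by (cases "l \<in> \<sigma>") (auto simp: P_diff)
    finally show "(u - v) \<bullet> w = 0" .
  qed
  then show ?thesis by simp
qed

lemma bessel: assumes "finite F" "F \<subseteq> \<sigma>" shows "(\<Sum>l\<in>F. (norm (P l u))\<^sup>2) \<le> (norm u)\<^sup>2"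
proof -
  let ?s = "\<Sum>l\<in>F. P l u"
  have n: "(norm ?s)\<^sup>2 = (\<Sum>l\<in>F. (norm (P l u))\<^sup>2)"
    by (rule norm_sum_orthogonal) (use assms in \<open>auto intro: E_orth P_in\<close>)
  have "u \<bullet> ?s = (\<Sum>l\<in>F. (norm (P l u))\<^sup>2)"
    by (simp add: inner_sum_right power2_norm_eq_inner P_sym)
  then have "0 \<le> (norm u)\<^sup>2 - (norm ?s)\<^sup>2"
    using n zero_le_power2[of "norm (u - ?s)"]
    by (simp add: power2_norm_eq_inner inner_diff_left inner_diff_right inner_commute)
  then show ?thesis using n by simp
qed

lemma P_square_summable: "(\<lambda>l. (norm (P l u))\<^sup>2) summable_on \<sigma>"
  by (rule nonneg_bdd_above_summable_on) (auto intro!: bdd_aboveI[of _ "(norm u)\<^sup>2"] bessel)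

text \<open>Bessel's inequality gives convergence. The sum has the same projections as
  \<open>u\<close>, and by totality of the eigenspaces these determine the vector.\<close>

theorem spectral_decomposition: "((\<lambda>l. P l u) has_sum u) \<sigma>"
proof -
  have "(\<lambda>l. P l u) summable_on \<sigma>"
    by (rule summable_on_orthogonal) (simp_all add: P_square_summable E_orth[OF P_in P_in])
  then have *: "((\<lambda>l. P l u) has_sum (\<Sum>\<^sub>\<infinity>l\<in>\<sigma>. P l u)) \<sigma>" by simp
  have "P l (\<Sum>\<^sub>\<infinity>l\<in>\<sigma>. P l u) = P l u" if "l \<in> \<sigma>" for l
    by (rule P_family_sum[OF P_in * that])
  then have "(\<Sum>\<^sub>\<infinity>l\<in>\<sigma>. P l u) = u" by (rule eq_if_P_eq)
  then show ?thesis using * by simp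
qed

lemma parseval: "((\<lambda>l. P l u \<bullet> P l v) has_sum u \<bullet> v) \<sigma>"
proof -
  have "((\<lambda>l. u \<bullet> P l v) has_sum u \<bullet> v) \<sigma>"
    by (rule has_sum_bounded_linear[OF bounded_linear_inner_right spectral_decomposition])
  then show ?thesis by (simp add: P_sym)
qed

text \<open>The operator m(A) for an arbitrary multiplier on the spectrum. Powers, the cosine and
  sine of the wave group and the spectral cutoffs are all instances, so their algebra is proved
  once.\<close>

definition fc :: "(real \<Rightarrow> real) \<Rightarrow> 'h \<Rightarrow> 'h" where
  "fc m u = (\<Sum>\<^sub>\<infinity>l\<in>\<sigma>. m l *\<^sub>R P l u)"

definition fdom :: "(real \<Rightarrow> real) \<Rightarrow> 'h set" where
  "fdom m = {u. (\<lambda>l. (norm (m l *\<^sub>R P l u))\<^sup>2) summable_on \<sigma>}"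

lemma op_pow_eq_fc: "op_pow D A s = fc (\<lambda>l. l powr s)"
  by (auto simp: op_pow_def fc_def)

lemma pow_dom_eq_fdom: "pow_dom D A s = fdom (\<lambda>l. l powr s)"
proof -
  have "l powr (2 * s) = (l powr s)\<^sup>2" for l :: real
    by (metis mult.commute mult_2 powr_add power2_eq_square)
  then show ?thesis by (auto simp: pow_dom_def fdom_def power_mult_distrib)
qed

lemma fc_has_sum: assumes "u \<in> fdom m" shows "((\<lambda>l. m l *\<^sub>R P l u) has_sum fc m u) \<sigma>"
proof -
  have "(\<lambda>l. m l *\<^sub>R P l u) summable_on \<sigma>"
    by (rule summable_on_orthogonal[OF P_scaled_orth]) (use assms in \<open>auto simp: fdom_def\<close>)
  then show ?thesis by (simp add: fc_def)
qed

lemma P_fc: "u \<in> fdom m \<Longrightarrow> l \<in> \<sigma> \<Longrightarrow> P l (fc m u) = m l *\<^sub>R P l u"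
  by (rule P_family_sum[OF P_scaled_in fc_has_sum])

text \<open>Membership in the domain comes for free, since the projections of the vector
  \<open>z\<close> are square summable. Identities between operators thus reduce to identities
  between multipliers.\<close>

lemma fcI:
  assumes "\<And>l. l \<in> \<sigma> \<Longrightarrow> P l z = m l *\<^sub>R P l u"
  shows "u \<in> fdom m" and "fc m u = z"
proof -
  have "(\<lambda>l. (norm (m l *\<^sub>R P l u))\<^sup>2) summable_on \<sigma> \<longleftrightarrow> (\<lambda>l. (norm (P l z))\<^sup>2) summable_on \<sigma>"
    by (rule summable_on_cong) (simp add: assms)
  then show u: "u \<in> fdom m" using P_square_summable by (simp add: fdom_def)
  show "fc m u = z" by (rule eq_if_P_eq) (simp add: P_fc u assms)
qed

lemma norm_fc: "u \<in> fdom m \<Longrightarrow> ((\<lambda>l. (m l)\<^sup>2 * (norm (P l u))\<^sup>2) has_sum (norm (fc m u))\<^sup>2) \<sigma>"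
  using has_sum_norm_orthogonal[OF P_scaled_orth fc_has_sum]
  by (simp add: power_mult_distrib)

lemma fdom_mono:
  assumes u: "u \<in> fdom m" and le: "\<And>l. l \<in> \<sigma> \<Longrightarrow> \<bar>k l\<bar> \<le> c * \<bar>m l\<bar>"
  shows "u \<in> fdom k" and "norm (fc k u) \<le> \<bar>c\<bar> * norm (fc m u)"
proof -
  have le2: "(k l)\<^sup>2 * (norm (P l u))\<^sup>2 \<le> c\<^sup>2 * ((m l)\<^sup>2 * (norm (P l u))\<^sup>2)" if "l \<in> \<sigma>" for l
  proof -
    have "\<bar>k l\<bar>\<^sup>2 \<le> (c * \<bar>m l\<bar>)\<^sup>2" using le[OF that] by (intro power_mono) auto
    then have "(k l)\<^sup>2 \<le> c\<^sup>2 * (m l)\<^sup>2" by (simp add: power_mult_distrib)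
    then show ?thesis using mult_right_mono[of "(k l)\<^sup>2" "c\<^sup>2 * (m l)\<^sup>2" "(norm (P l u))\<^sup>2"] by (simp add: mult.assoc)
  qed
  have hs: "((\<lambda>l. c\<^sup>2 * ((m l)\<^sup>2 * (norm (P l u))\<^sup>2)) has_sum c\<^sup>2 * (norm (fc m u))\<^sup>2) \<sigma>"
    by (rule has_sum_cmult_right[OF norm_fc[OF u]])
  have "(\<lambda>l. (k l)\<^sup>2 * (norm (P l u))\<^sup>2) summable_on \<sigma>"
    by (rule summable_on_comparison_test[OF has_sum_imp_summable[OF hs]]) (use le2 in auto)
  then show v: "u \<in> fdom k" by (simp add: fdom_def power_mult_distrib)
  have "(norm (fc k u))\<^sup>2 \<le> c\<^sup>2 * (norm (fc m u))\<^sup>2"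
    by (rule has_sum_mono[OF norm_fc[OF v] hs]) (use le2 in auto)
  also have "\<dots> = (\<bar>c\<bar> * norm (fc m u))\<^sup>2" by (simp add: power_mult_distrib)
  finally show "norm (fc k u) \<le> \<bar>c\<bar> * norm (fc m u)" by (rule power2_le_imp_le) simp
qed

lemma fc_one: "fc (\<lambda>l. 1) u = u" "u \<in> fdom (\<lambda>l. 1)"
  using fcI[of u "\<lambda>l. 1" u] by auto

lemma fc_bounded:
  assumes "\<And>l. l \<in> \<sigma> \<Longrightarrow> \<bar>m l\<bar> \<le> c"
  shows "u \<in> fdom m" and "norm (fc m u) \<le> \<bar>c\<bar> * norm u"
  using fdom_mono[OF fc_one(2), of m c u] assms by (auto simp: fc_one)

lemma fdom_add: assumes "u \<in> fdom m" "v \<in> fdom m"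
  shows "u + v \<in> fdom m" "fc m (u + v) = fc m u + fc m v"
  by (rule fcI[of "fc m u + fc m v"]; simp add: P_add P_fc assms scaleR_add_right)+

lemma fdom_scale: assumes "u \<in> fdom m"
  shows "c *\<^sub>R u \<in> fdom m" "fc m (c *\<^sub>R u) = c *\<^sub>R fc m u"
  by (rule fcI[of "c *\<^sub>R fc m u"]; simp add: P_scale P_fc assms)+

lemma fdom_diff: assumes "u \<in> fdom m" "v \<in> fdom m"
  shows "u - v \<in> fdom m" "fc m (u - v) = fc m u - fc m v"
  by (rule fcI[of "fc m u - fc m v"]; simp add: P_diff P_fc assms scaleR_diff_right)+

lemma fdom_zero [simp]: "0 \<in> fdom m" "fc m 0 = 0"
  by (rule fcI[of 0]; simp)+

lemma subspace_fdom: "subspace (fdom m)"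
  by (auto simp: subspace_def fdom_add fdom_scale)

lemma bounded_linear_fc:
  assumes "\<And>l. l \<in> \<sigma> \<Longrightarrow> \<bar>m l\<bar> \<le> c"
  shows "bounded_linear (fc m)"
  by (rule bounded_linear_intro[where K = "\<bar>c\<bar>"])
     (auto simp: fdom_add fdom_scale fc_bounded(1)[OF assms] fc_bounded(2)[OF assms] mult.commute)

lemma fc_fc:
  assumes "u \<in> fdom m"
  shows "fc m u \<in> fdom k \<longleftrightarrow> u \<in> fdom (\<lambda>l. k l * m l)"
    and "fc m u \<in> fdom k \<Longrightarrow> fc k (fc m u) = fc (\<lambda>l. k l * m l) u"
proof -
  have "(\<lambda>l. (norm (k l *\<^sub>R P l (fc m u)))\<^sup>2) summable_on \<sigma>
      \<longleftrightarrow> (\<lambda>l. (norm ((k l * m l) *\<^sub>R P l u))\<^sup>2) summable_on \<sigma>"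
    by (rule summable_on_cong) (simp add: P_fc assms abs_mult mult.assoc)
  then show "fc m u \<in> fdom k \<longleftrightarrow> u \<in> fdom (\<lambda>l. k l * m l)" by (simp add: fdom_def)
  assume "fc m u \<in> fdom k"
  then show "fc k (fc m u) = fc (\<lambda>l. k l * m l) u"
    by (intro fcI(2)[symmetric]) (simp add: P_fc assms)
qed

lemma fc_cong: "(\<And>l. l \<in> \<sigma> \<Longrightarrow> m l = k l) \<Longrightarrow> fc m = fc k"
  unfolding fc_def by (intro ext infsum_cong) auto

lemma fdom_cong: assumes "\<And>l. l \<in> \<sigma> \<Longrightarrow> m l = k l" shows "fdom m = fdom k"
proof -
  have "(\<lambda>l. (norm (m l *\<^sub>R P l u))\<^sup>2) summable_on \<sigma> \<longleftrightarrow> (\<lambda>l. (norm (k l *\<^sub>R P l u))\<^sup>2) summable_on \<sigma>" for u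
    by (rule summable_on_cong) (simp add: assms)
  then show ?thesis by (simp add: fdom_def)
qed

lemma fc_sym: assumes "u \<in> fdom m" "v \<in> fdom m" shows "fc m u \<bullet> v = u \<bullet> fc m v"
proof -
  have "((\<lambda>l. P l (fc m u) \<bullet> P l v) has_sum fc m u \<bullet> v) \<sigma>" by (rule parseval)
  moreover have "((\<lambda>l. P l u \<bullet> P l (fc m v)) has_sum u \<bullet> fc m v) \<sigma>" by (rule parseval)
  moreover have "((\<lambda>l. P l (fc m u) \<bullet> P l v) has_sum fc m u \<bullet> v) \<sigma>
      \<longleftrightarrow> ((\<lambda>l. P l u \<bullet> P l (fc m v)) has_sum fc m u \<bullet> v) \<sigma>"
    by (rule has_sum_cong) (simp add: P_fc assms)
  ultimately show ?thesis using has_sum_unique by blast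
qed

lemma fc_eigenvector: assumes "v \<in> E l" shows "v \<in> fdom m" "fc m v = m l *\<^sub>R v"
proof -
  have "P k (m l *\<^sub>R v) = m k *\<^sub>R P k v" for k
    using assms by (cases "k = l") (auto simp: P_scale P_self P_other)
  then show "v \<in> fdom m" "fc m v = m l *\<^sub>R v" by (auto intro: fcI)
qed

text \<open>Dominated convergence over the spectrum: pointwise convergence handles a finite set
  \<open>F\<close> of eigenvalues carrying almost all of the norm of \<open>u\<close>, and the
  uniform bound handles the rest.\<close>

theorem fc_tendsto:
  assumes lim: "\<And>l. l \<in> \<sigma> \<Longrightarrow> ((\<lambda>k. m k l) \<longlongrightarrow> m0 l) G"
    and bd: "\<And>k l. l \<in> \<sigma> \<Longrightarrow> \<bar>m k l\<bar> \<le> c" and bd0: "\<And>l. l \<in> \<sigma> \<Longrightarrow> \<bar>m0 l\<bar> \<le> c"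
  shows "((\<lambda>k. fc (m k) u) \<longlongrightarrow> fc m0 u) G"
proof -
  define d where "d k l = m k l - m0 l" for k l
  have dle: "\<bar>d k l\<bar> \<le> 2 * c" if "l \<in> \<sigma>" for k l
    using bd[OF that, of k] bd0[OF that] by (simp add: d_def)
  have diff: "fc (m k) u - fc m0 u = fc (d k) u" for k
    by (rule fcI(2)[symmetric])
       (simp add: P_diff P_fc fc_bounded(1)[OF bd] fc_bounded(1)[OF bd0] d_def scaleR_diff_left)
  have "\<forall>\<^sub>F k in G. norm (fc (d k) u) < e" if e: "e > 0" for e
  proof -
    \<comment> \<open>The tail, weighted by \<open>4 * c\<^sup>2\<close>, then costs at most half of
      \<open>e\<^sup>2\<close>; the summand 1 avoids a division by zero.\<close>
    define \<epsilon> where "\<epsilon> = e\<^sup>2 / (2 * (4 * c\<^sup>2 + 1))"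
    have c0: "0 < 4 * c\<^sup>2 + 1" by (simp add: add_nonneg_pos)
    have \<epsilon>: "\<epsilon> > 0" using e c0 by (simp add: \<epsilon>_def)
    define a where "a l = (norm (P l u))\<^sup>2" for l
    have hs: "(a has_sum (norm u)\<^sup>2) \<sigma>"
      using norm_fc[OF fc_one(2)] by (simp add: a_def[abs_def] fc_one)
    have "\<forall>\<^sub>F F in finite_subsets_at_top \<sigma>. dist (sum a F) ((norm u)\<^sup>2) < \<epsilon>"
      using hs \<epsilon> unfolding has_sum_def by (intro tendstoD) auto
    then obtain F where F: "finite F" "F \<subseteq> \<sigma>" "dist (sum a F) ((norm u)\<^sup>2) < \<epsilon>"
      unfolding eventually_finite_subsets_at_top by blast
    have tail: "sum a (K - F) \<le> \<epsilon>" if "finite K" "K \<subseteq> \<sigma>" for K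
    proof -
      have "sum a (K - F) + sum a F = sum a (K \<union> F)"
        using that F by (metis Un_Diff_cancel2 Diff_disjoint finite_Diff inf_commute sum.union_disjoint)
      also have "\<dots> \<le> (norm u)\<^sup>2"
        by (rule finite_sum_le_has_sum[OF hs]) (use that F in \<open>auto simp: a_def\<close>)
      finally show ?thesis using F(3) by (simp add: dist_real_def)
    qed
    have main: "(norm (fc (d k) u))\<^sup>2 \<le> (\<Sum>l\<in>F. (d k l)\<^sup>2 * a l) + 4 * c\<^sup>2 * \<epsilon>" for k
    proof (rule has_sum_le_finite_sums[OF norm_fc[OF fc_bounded(1)[OF dle]]])
      fix K assume K: "finite K" "K \<subseteq> \<sigma>"
      have "(\<Sum>l\<in>K. (d k l)\<^sup>2 * a l) \<le> (\<Sum>l\<in>F. (d k l)\<^sup>2 * a l) + (\<Sum>l\<in>K - F. (d k l)\<^sup>2 * a l)"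
      proof -
        have "(\<Sum>l\<in>K. (d k l)\<^sup>2 * a l) \<le> (\<Sum>l\<in>F \<union> (K - F). (d k l)\<^sup>2 * a l)"
          by (rule sum_mono2) (use K F in \<open>auto simp: a_def\<close>)
        then show ?thesis using K F by (subst (asm) sum.union_disjoint) auto
      qed
      also have "(\<Sum>l\<in>K - F. (d k l)\<^sup>2 * a l) \<le> (\<Sum>l\<in>K - F. 4 * c\<^sup>2 * a l)"
      proof (intro sum_mono mult_right_mono)
        fix l assume "l \<in> K - F"
        then have "\<bar>d k l\<bar>\<^sup>2 \<le> (2 * c)\<^sup>2" using dle K by (intro power_mono) auto
        then show "(d k l)\<^sup>2 \<le> 4 * c\<^sup>2" by (simp add: power_mult_distrib)
      qed (simp add: a_def)
      also have "\<dots> \<le> 4 * c\<^sup>2 * \<epsilon>"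
        unfolding sum_distrib_left[symmetric] by (rule mult_left_mono[OF tail[OF K]]) simp
      finally show "(\<Sum>l\<in>K. (d k l)\<^sup>2 * (norm (P l u))\<^sup>2) \<le> (\<Sum>l\<in>F. (d k l)\<^sup>2 * a l) + 4 * c\<^sup>2 * \<epsilon>"
        by (simp add: a_def)
    qed
    have "((\<lambda>k. \<Sum>l\<in>F. (d k l)\<^sup>2 * a l) \<longlongrightarrow> (\<Sum>l\<in>F. (m0 l - m0 l)\<^sup>2 * a l)) G"
      unfolding d_def using F by (intro tendsto_intros lim) auto
    then have "\<forall>\<^sub>F k in G. dist (\<Sum>l\<in>F. (d k l)\<^sup>2 * a l) 0 < e\<^sup>2 / 2"
      using e by (intro tendstoD) auto
    then show ?thesis
    proof eventually_elim
      case (elim k)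
      have "4 * c\<^sup>2 * \<epsilon> \<le> (4 * c\<^sup>2 + 1) * \<epsilon>" using \<epsilon> by (intro mult_right_mono) auto
      also have "\<dots> = e\<^sup>2 / 2" using c0 by (simp add: \<epsilon>_def field_simps)
      finally have "(norm (fc (d k) u))\<^sup>2 < e\<^sup>2" using main[of k] elim by (simp add: dist_real_def)
      then show ?case by (rule power2_less_imp_less) (use e in simp)
    qed
  qed
  then show ?thesis
    unfolding tendsto_iff dist_norm diff by blast
qed

section \<open>Powers of the operator and negative norms\<close>

lemma powr_neg_bound: assumes "s \<le> 0" "l \<in> \<sigma>" shows "\<bar>l powr s\<bar> \<le> \<omega> powr s"
  using powr_mono2'[of s \<omega> l] \<omega>_pos \<sigma>_ge assms by auto

lemma pow_neg_dom: "s \<le> 0 \<Longrightarrow> u \<in> fdom (\<lambda>l. l powr s)"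
  by (rule fc_bounded(1)) (rule powr_neg_bound)

lemma bounded_linear_op_pow: "s \<le> 0 \<Longrightarrow> bounded_linear (op_pow D A s)"
  unfolding op_pow_eq_fc by (rule bounded_linear_fc) (rule powr_neg_bound)

lemma op_pow_zero: "op_pow D A 0 u = u"
  unfolding op_pow_eq_fc using fc_cong[of "\<lambda>l. l powr 0" "\<lambda>l. 1"] \<sigma>_pos fc_one by force

lemma op_pow_comp:
  assumes "t \<le> 0" and "s + t \<le> 0"
  shows "op_pow D A t u \<in> pow_dom D A s" and "op_pow D A s (op_pow D A t u) = op_pow D A (s + t) u"
proof -
  have e: "fc (\<lambda>l. l powr s * l powr t) = fc (\<lambda>l. l powr (s + t))"
    "fdom (\<lambda>l. l powr s * l powr t) = fdom (\<lambda>l. l powr (s + t))"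
    by (intro fc_cong fdom_cong; simp add: powr_add)+
  show "op_pow D A t u \<in> pow_dom D A s"
    unfolding op_pow_eq_fc pow_dom_eq_fdom using fc_fc(1)[OF pow_neg_dom[OF assms(1)], of u "\<lambda>l. l powr s"]
    by (simp add: e pow_neg_dom[OF assms(2)])
  then show "op_pow D A s (op_pow D A t u) = op_pow D A (s + t) u"
    unfolding op_pow_eq_fc pow_dom_eq_fdom using fc_fc(2)[OF pow_neg_dom[OF assms(1)], of u "\<lambda>l. l powr s"]
    by (simp add: e)
qed

lemma op_pow_inverse:
  assumes "0 \<le> s" "u \<in> pow_dom D A s"
  shows "op_pow D A (- s) (op_pow D A s u) = u"
proof -
  have u: "u \<in> fdom (\<lambda>l. l powr s)" using assms by (simp add: pow_dom_eq_fdom)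
  have "fc (\<lambda>l. l powr - s) (fc (\<lambda>l. l powr s) u) = fc (\<lambda>l. l powr - s * l powr s) u"
    by (rule fc_fc(2)[OF u pow_neg_dom]) (use assms in simp)
  also have "fc (\<lambda>l. l powr - s * l powr s) = fc (\<lambda>l. 1)"
    by (rule fc_cong) (use \<sigma>_pos in \<open>fastforce simp flip: powr_add\<close>)
  finally show ?thesis by (simp add: op_pow_eq_fc fc_one)
qed

lemma op_pow_sym:
  assumes "u \<in> pow_dom D A s" "v \<in> pow_dom D A s"
  shows "op_pow D A s u \<bullet> v = u \<bullet> op_pow D A s v"
  using fc_sym assms by (simp add: op_pow_eq_fc pow_dom_eq_fdom)

lemma op_pow_neg_sym: "s \<le> 0 \<Longrightarrow> op_pow D A s u \<bullet> v = u \<bullet> op_pow D A s v"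
  by (rule op_pow_sym) (simp_all add: pow_dom_eq_fdom pow_neg_dom)

lemma op_pow_norm_mono:
  assumes "s \<le> t" "u \<in> pow_dom D A t"
  shows "u \<in> pow_dom D A s" "norm (op_pow D A s u) \<le> \<omega> powr (s - t) * norm (op_pow D A t u)"
proof -
  have "\<bar>l powr s\<bar> \<le> \<omega> powr (s - t) * \<bar>l powr t\<bar>" if "l \<in> \<sigma>" for l
  proof -
    have "l powr s = l powr (s - t) * l powr t" by (simp flip: powr_add)
    also have "\<dots> \<le> \<omega> powr (s - t) * l powr t"
      using powr_neg_bound[of "s - t" l] assms that by (intro mult_right_mono) auto
    finally show ?thesis by simp
  qed
  from fdom_mono[OF _ this] assms
  show "u \<in> pow_dom D A s" "norm (op_pow D A s u) \<le> \<omega> powr (s - t) * norm (op_pow D A t u)"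
    by (auto simp: op_pow_eq_fc pow_dom_eq_fdom)
qed

abbreviation "H1 \<equiv> pow_dom D A (1/2)"
abbreviation "H2 \<equiv> pow_dom D A 1"
abbreviation "half \<equiv> op_pow D A (1/2)"
abbreviation "S \<equiv> op_pow D A (- (1/2))"

lemma Hsp_1: "Hsp D A 1 = H1" and Hsp_2: "Hsp D A 2 = H2"
  by (simp_all add: Hsp_def)

lemma subspace_pow_dom: "subspace (pow_dom D A s)" by (simp add: pow_dom_eq_fdom subspace_fdom)

lemma half_diff: "u \<in> H1 \<Longrightarrow> v \<in> H1 \<Longrightarrow> half (u - v) = half u - half v"
  by (simp add: pow_dom_eq_fdom op_pow_eq_fc fdom_diff)

lemma S_half: "u \<in> H1 \<Longrightarrow> S (half u) = u"
  using op_pow_inverse[of "1/2" u] by simp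

lemma half_S: "S u \<in> H1" "half (S u) = u"
  using op_pow_comp[of "- (1/2)" "1/2" u] by (simp_all add: op_pow_zero)

lemma S_S: "S (S u) = op_pow D A (-1) u"
  using op_pow_comp(2)[of "- (1/2)" "- (1/2)" u] by simp

lemma bounded_linear_S: "bounded_linear S"
  by (rule bounded_linear_op_pow) simp

lemma S_sym: "S u \<bullet> v = u \<bullet> S v"
  by (rule op_pow_neg_sym) simp

lemma Hnorm_0: "Hnorm D A 0 u = norm u" by (simp add: Hnorm_def op_pow_zero)

lemma Hnorm_1: "Hnorm D A 1 u = norm (half u)" by (simp add: Hnorm_def)

lemma Hnorm_m1: "Hnorm D A (-1) u = norm (S u)" by (simp add: Hnorm_def)

lemma energy_1: "energy D A 1 (u, v) = ((norm (half u))\<^sup>2 + (norm v)\<^sup>2) / 2"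
  by (simp add: energy_def Hnorm_0 Hnorm_1)

lemma energy_nonneg: "0 \<le> energy D A k W"
  by (simp add: energy_def)

text \<open>With \<open>k \<le> 0\<close> every vector is in the domain of both powers, so
  \<open>Hnorm\<close> is a genuine norm and not the default value of a divergent series.\<close>

lemma Hnorm_mono:
  assumes "j \<le> k" "k \<le> 0"
  shows "Hnorm D A j u \<le> \<omega> powr (real_of_int (j - k) / 2) * Hnorm D A k u"
  using op_pow_norm_mono(2)[of "real_of_int j / 2" "real_of_int k / 2" u] assms
  by (simp add: Hnorm_def pow_dom_eq_fdom pow_neg_dom diff_divide_distrib)

lemma Hnorm_add_le: "k \<le> 0 \<Longrightarrow> Hnorm D A k (u + v) \<le> Hnorm D A k u + Hnorm D A k v"
  unfolding Hnorm_def
  by (subst linear_add[OF bounded_linear.linear[OF bounded_linear_op_pow]]) (auto intro: norm_triangle_ineq)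

text \<open>By duality: the norm of index \<open>- int k\<close> is tested against
  \<open>Hsp D A k\<close>, and there \<open>L\<close> is moved to its adjoint.\<close>

theorem negative_norm_bound:
  assumes L: "bounded_linear L" and adj: "bounded_on_H D A k (adjoint L)"
  shows "\<exists>M>0. \<forall>x. Hnorm D A (- int k) (L x) \<le> M * Hnorm D A (- int k) x"
proof -
  let ?s = "real k / 2"
  let ?S = "op_pow D A (- ?s)"
  obtain M where inH: "\<And>u. u \<in> Hsp D A k \<Longrightarrow> adjoint L u \<in> Hsp D A k"
    and M: "\<And>u. u \<in> Hsp D A k \<Longrightarrow> Hnorm D A (int k) (adjoint L u) \<le> M * Hnorm D A (int k) u"
    using adj unfolding bounded_on_H_def by blast
  have "norm (?S (L x)) \<le> (\<bar>M\<bar> + 1) * norm (?S x)" for x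
  proof (cases "?S (L x) = 0")
    case False
    \<comment> \<open>\<open>?S z\<close> is the optimal test vector: its norm of index
      \<open>k\<close> is \<open>norm z\<close>, and its pairing with \<open>L x\<close> is the
      square of \<open>norm z\<close>.\<close>
    define z where "z = ?S (L x)"
    have z1: "?S z \<in> Hsp D A k" "op_pow D A ?s (?S z) = z"
      using op_pow_comp[of "- ?s" "?s" z] by (simp_all add: Hsp_def op_pow_zero)
    define y where "y = adjoint L (?S z)"
    have y: "y \<in> Hsp D A k" "norm (op_pow D A ?s y) \<le> M * norm z"
      using inH[OF z1(1)] M[OF z1(1)] by (simp_all add: y_def Hnorm_def z1(2))
    have "norm z * norm z = L x \<bullet> ?S z"
      by (simp add: z_def op_pow_neg_sym power2_norm_eq_inner flip: power2_eq_square)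
    also have "\<dots> = x \<bullet> y" unfolding y_def by (rule adjoint_property[OF L])
    also have "\<dots> = x \<bullet> ?S (op_pow D A ?s y)"
      using y(1) by (simp add: op_pow_inverse Hsp_def)
    also have "\<dots> = ?S x \<bullet> op_pow D A ?s y" by (simp add: op_pow_neg_sym)
    also have "\<dots> \<le> norm (?S x) * norm (op_pow D A ?s y)" by (rule norm_cauchy_schwarz)
    also have "\<dots> \<le> norm (?S x) * ((\<bar>M\<bar> + 1) * norm z)"
    proof (rule mult_left_mono)
      have "M * norm z \<le> (\<bar>M\<bar> + 1) * norm z" by (rule mult_right_mono) auto
      then show "norm (op_pow D A ?s y) \<le> (\<bar>M\<bar> + 1) * norm z" using y(2) by simp
    qed simp
    finally have "norm z * norm z \<le> (\<bar>M\<bar> + 1) * norm (?S x) * norm z" by (simp add: ac_simps)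
    then show ?thesis using False by (simp add: z_def)
  qed simp
  then show ?thesis
    by (intro exI[of _ "\<bar>M\<bar> + 1"]) (auto simp: Hnorm_def)
qed

end

section \<open>Solutions of the wave equation\<close>

text \<open>Increments are of smaller order than the length, uniformly in the position, so the
  derivative is zero everywhere. This serves where a sum is constant although its terms need not be
  differentiable.\<close>

lemma constant_if_locally_superlinear:
  fixes \<Phi> :: "real \<Rightarrow> real"
  assumes ab: "a \<le> b"
    and small: "\<And>e. e > 0 \<Longrightarrow> \<exists>d>0. \<forall>x y. a \<le> x \<and> x \<le> y \<and> y \<le> b \<and> y - x < d
                  \<longrightarrow> \<bar>\<Phi> y - \<Phi> x\<bar> \<le> e * (y - x)"
  shows "\<Phi> a = \<Phi> b"
proof -
  have "(\<Phi> has_derivative (\<lambda>h. 0)) (at x within {a..b})" if x: "x \<in> {a..b}" for x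
    unfolding has_derivative_within_alt
  proof (intro conjI allI impI)
    fix e :: real assume "e > 0"
    then obtain d where d: "d > 0" and D: "\<And>x y. a \<le> x \<Longrightarrow> x \<le> y \<Longrightarrow> y \<le> b \<Longrightarrow> y - x < d
        \<Longrightarrow> \<bar>\<Phi> y - \<Phi> x\<bar> \<le> e * (y - x)"
      using small by meson
    have "norm (\<Phi> y - \<Phi> x - 0) \<le> e * norm (y - x)" if y: "y \<in> {a..b}" "norm (y - x) < d" for y
    proof (cases "x \<le> y")
      case True then show ?thesis using D[of x y] x y by simp
    next
      case False then show ?thesis using D[of y x] x y by (simp add: abs_minus_commute)
    qed
    then show "\<exists>d>0. \<forall>y\<in>{a..b}. norm (y - x) < d \<longrightarrow> norm (\<Phi> y - \<Phi> x - 0) \<le> e * norm (y - x)"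
      using d by blast
  qed simp
  then obtain c where "\<forall>x\<in>{a..b}. \<Phi> x = c"
    using has_derivative_zero_constant[of "{a..b}" \<Phi>] by auto
  then show ?thesis using ab by simp
qed

lemma vector_derivative_lipschitz:
  fixes z :: "real \<Rightarrow> 'h::real_normed_vector"
  assumes z: "\<And>t. t \<in> {a..b} \<Longrightarrow> (z has_vector_derivative z' t) (at t within {a..b})"
    and L: "\<And>t. t \<in> {a..b} \<Longrightarrow> norm (z' t) \<le> L" and xy: "x \<in> {a..b}" "y \<in> {a..b}"
  shows "norm (z y - z x) \<le> L * \<bar>y - x\<bar>"
proof -
  have "norm (z y - z x) \<le> L * norm (y - x)"
  proof (rule differentiable_bound[of "{a..b}" z "\<lambda>t h. h *\<^sub>R z' t"])
    show "onorm (\<lambda>h. h *\<^sub>R z' t) \<le> L" if "t \<in> {a..b}" for t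
      using L[OF that] by (intro onorm_le) (simp add: mult.commute[of L] mult_left_mono)
  qed (use z xy in \<open>auto simp: has_vector_derivative_def\<close>)
  then show ?thesis by simp
qed

lemma bounded_on_interval:
  fixes z :: "real \<Rightarrow> 'h::real_normed_vector"
  assumes "continuous_on {a..b} z"
  obtains L where "L > 0" "\<And>t. t \<in> {a..b} \<Longrightarrow> norm (z t) \<le> L"
proof -
  have "bounded (z ` {a..b})"
    by (rule compact_imp_bounded[OF compact_continuous_image[OF assms]]) simp
  then show thesis using that unfolding bounded_pos by blast
qed

lemma uniformly_close_on_interval:
  fixes z :: "real \<Rightarrow> 'h::real_normed_vector"
  assumes "continuous_on {a..b} z" "e > 0"
  obtains d where "d > 0" "\<And>x y. x \<in> {a..b} \<Longrightarrow> y \<in> {a..b} \<Longrightarrow> \<bar>y - x\<bar> < d \<Longrightarrow> norm (z y - z x) < e"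
proof -
  have "uniformly_continuous_on {a..b} z"
    by (rule compact_uniformly_continuous) (use assms in auto)
  then show thesis using that assms(2) unfolding uniformly_continuous_on_def dist_norm by (metis real_norm_def)
qed

text \<open>\<open>f\<close> need not be continuous, so \<open>v \<bullet> z\<close> need not be differentiable. But the increment of the
  difference of the two sides over \<open>[x,y]\<close> is \<open>o(y - x)\<close> uniformly, which forces it to be constant.\<close>

lemma weak_integration_by_parts:
  fixes v z z' f p q :: "real \<Rightarrow> 'h::real_inner"
  assumes ab: "a \<le> b"
    and v: "continuous_on {a..b} v"
    and z: "\<And>t. t \<in> {a..b} \<Longrightarrow> (z has_vector_derivative z' t) (at t within {a..b})"
    and z': "continuous_on {a..b} z'" and p: "continuous_on {a..b} p" and q: "continuous_on {a..b} q"
    and nf: "(\<lambda>t. norm (f t)) integrable_on {a..b}" and fz: "(\<lambda>t. f t \<bullet> z t) integrable_on {a..b}"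
    and weak: "\<And>s t. a \<le> s \<Longrightarrow> s \<le> t \<Longrightarrow> t \<le> b \<Longrightarrow>
      ((\<lambda>\<tau>. f \<tau> \<bullet> z t - p \<tau> \<bullet> q t) has_integral (v t - v s) \<bullet> z t) {s..t}"
  shows "((\<lambda>t. f t \<bullet> z t - p t \<bullet> q t + v t \<bullet> z' t) has_integral (v b \<bullet> z b - v a \<bullet> z a)) {a..b}"
proof -
  define G where "G t = f t \<bullet> z t - p t \<bullet> q t + v t \<bullet> z' t" for t
  have G: "G integrable_on {a..b}" unfolding G_def
    by (intro integrable_add integrable_diff fz integrable_continuous_real continuous_intros p q v z')
  define \<Phi> where "\<Phi> t = v t \<bullet> z t - integral {a..t} G" for t
  obtain L where L: "L > 0" "\<And>t. t \<in> {a..b} \<Longrightarrow> norm (z' t) \<le> L" using bounded_on_interval[OF z'] by blast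
  obtain M where M: "M > 0" "\<And>t. t \<in> {a..b} \<Longrightarrow> norm (p t) \<le> M" using bounded_on_interval[OF p] by blast
  have "\<Phi> a = \<Phi> b"
  proof (rule constant_if_locally_superlinear[OF ab])
    fix e :: real assume e: "e > 0"
    \<comment> \<open>Three errors arise below, of sizes \<open>L * \<epsilon>\<close>,
      \<open>M * \<epsilon>\<close> and \<open>L * \<epsilon>\<close> per unit length.\<close>
    define \<epsilon> where "\<epsilon> = e / (2 * L + M)"
    have \<epsilon>: "\<epsilon> > 0" using e L M by (simp add: \<epsilon>_def)
    obtain d1 where d1: "d1 > 0" "\<And>x y. x \<in> {a..b} \<Longrightarrow> y \<in> {a..b} \<Longrightarrow> \<bar>y - x\<bar> < d1 \<Longrightarrow> norm (v y - v x) < \<epsilon>"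
      using uniformly_close_on_interval[OF v \<epsilon>] by blast
    obtain d2 where d2: "d2 > 0" "\<And>x y. x \<in> {a..b} \<Longrightarrow> y \<in> {a..b} \<Longrightarrow> \<bar>y - x\<bar> < d2 \<Longrightarrow> norm (q y - q x) < \<epsilon>"
      using uniformly_close_on_interval[OF q \<epsilon>] by blast
    obtain d3 where d3: "d3 > 0" "\<And>x y. x \<in> {a..b} \<Longrightarrow> y \<in> {a..b} \<Longrightarrow> \<bar>y - x\<bar> < d3 \<Longrightarrow>
        norm (integral {a..y} (\<lambda>t. norm (f t)) - integral {a..x} (\<lambda>t. norm (f t))) < \<epsilon>"
      using uniformly_close_on_interval[OF indefinite_integral_continuous_1[OF nf] \<epsilon>] by blast
    have "\<bar>\<Phi> y - \<Phi> x\<bar> \<le> e * (y - x)"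
      if xy: "a \<le> x" "x \<le> y" "y \<le> b" "y - x < min d1 (min d2 d3)" for x y
    proof -
      have sub: "{x..y} \<subseteq> {a..b}" using xy by auto
      have xin: "x \<in> {a..b}" "y \<in> {a..b}" using xy by auto
      have Gxy: "G integrable_on {x..y}" by (rule integrable_subinterval_real[OF G sub])
      have G1: "integral {a..y} G - integral {a..x} G = integral {x..y} G"
        using Henstock_Kurzweil_Integration.integral_combine[of a x y G] integrable_subinterval_real[OF G, of a y] xy by simp
      have nfxy: "(\<lambda>t. norm (f t)) integrable_on {x..y}" by (rule integrable_subinterval_real[OF nf sub])
      have F1: "integral {x..y} (\<lambda>t. norm (f t)) \<le> \<epsilon>"
      proof -
        have "integral {a..y} (\<lambda>t. norm (f t)) - integral {a..x} (\<lambda>t. norm (f t)) = integral {x..y} (\<lambda>t. norm (f t))"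
          using Henstock_Kurzweil_Integration.integral_combine[of a x y "\<lambda>t. norm (f t)"] integrable_subinterval_real[OF nf, of a y] xy by simp
        then show ?thesis using d3(2)[of x y] xin xy by simp
      qed
      have c: "((\<lambda>\<tau>. v x \<bullet> z' \<tau>) has_integral v x \<bullet> (z y - z x)) {x..y}"
      proof -
        have "((\<lambda>t. v x \<bullet> z t) has_vector_derivative v x \<bullet> z' t) (at t within {x..y})" if "t \<in> {x..y}" for t
          using has_vector_derivative_within_subset[OF z sub, of t] that sub
          by (intro bounded_linear.has_vector_derivative[OF bounded_linear_inner_right]) auto
        from fundamental_theorem_of_calculus[OF xy(2) this] show ?thesis by (simp add: inner_diff_right)
      qed
      have w: "((\<lambda>\<tau>. f \<tau> \<bullet> z y - p \<tau> \<bullet> q y) has_integral (v y - v x) \<bullet> z y) {x..y}"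
        by (rule weak) (use xy in auto)
      \<comment> \<open>The weak equation is used with the test vector frozen at time
        \<open>y\<close>, and \<open>v\<close> is frozen at time \<open>x\<close>. Each remaining
        product contains a difference: that of \<open>z\<close> is Lipschitz and meets a small
        integral of \<open>norm (f t)\<close>; those of \<open>q\<close> and \<open>v\<close> are
        small by uniform continuity.\<close>
      have main: "((\<lambda>\<tau>. f \<tau> \<bullet> (z y - z \<tau>) - p \<tau> \<bullet> (q y - q \<tau>) + (v x - v \<tau>) \<bullet> z' \<tau>) has_integral (\<Phi> y - \<Phi> x)) {x..y}"
      proof (rule has_integral_eq_rhs)
        show "((\<lambda>\<tau>. f \<tau> \<bullet> (z y - z \<tau>) - p \<tau> \<bullet> (q y - q \<tau>) + (v x - v \<tau>) \<bullet> z' \<tau>)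
            has_integral (v y - v x) \<bullet> z y + v x \<bullet> (z y - z x) - integral {x..y} G) {x..y}"
          by (rule has_integral_eq[OF _ has_integral_diff[OF has_integral_add[OF w c] integrable_integral[OF Gxy]]])
             (simp add: G_def inner_diff_left inner_diff_right)
        show "\<Phi> y - \<Phi> x = (v y - v x) \<bullet> z y + v x \<bullet> (z y - z x) - integral {x..y} G"
          using G1 by (simp add: \<Phi>_def inner_diff_left inner_diff_right)
      qed
      define g where "g \<tau> = norm (f \<tau>) * (L * (y - x)) + (M * \<epsilon> + L * \<epsilon>)" for \<tau>
      have gi: "(g has_integral integral {x..y} (\<lambda>t. norm (f t)) * (L * (y - x)) + (y - x) * (M * \<epsilon> + L * \<epsilon>)) {x..y}"
        unfolding g_def
        using has_integral_const_real[of "M * \<epsilon> + L * \<epsilon>" x y] xy(2)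
        by (intro has_integral_add has_integral_mult_left integrable_integral nfxy) simp
      have "norm (integral {x..y} (\<lambda>\<tau>. f \<tau> \<bullet> (z y - z \<tau>) - p \<tau> \<bullet> (q y - q \<tau>) + (v x - v \<tau>) \<bullet> z' \<tau>))
          \<le> integral {x..y} g"
      proof (rule integral_norm_bound_integral)
        show "(\<lambda>\<tau>. f \<tau> \<bullet> (z y - z \<tau>) - p \<tau> \<bullet> (q y - q \<tau>) + (v x - v \<tau>) \<bullet> z' \<tau>) integrable_on {x..y}"
          "g integrable_on {x..y}" using main gi by (auto simp: integrable_on_def)
        fix \<tau> assume \<tau>: "\<tau> \<in> {x..y}"
        then have \<tau>': "\<tau> \<in> {a..b}" using sub by auto
        have "\<bar>f \<tau> \<bullet> (z y - z \<tau>)\<bar> \<le> norm (f \<tau>) * norm (z y - z \<tau>)" by (rule Cauchy_Schwarz_ineq2)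
        also have "norm (z y - z \<tau>) \<le> L * \<bar>y - \<tau>\<bar>"
          using vector_derivative_lipschitz[OF z L(2) \<tau>' xin(2)] by simp
        also have "\<dots> \<le> L * (y - x)" using \<tau> L by simp
        finally have 1: "\<bar>f \<tau> \<bullet> (z y - z \<tau>)\<bar> \<le> norm (f \<tau>) * (L * (y - x))"
          by (simp add: mult_left_mono)
        have "\<bar>p \<tau> \<bullet> (q y - q \<tau>)\<bar> \<le> norm (p \<tau>) * norm (q y - q \<tau>)" by (rule Cauchy_Schwarz_ineq2)
        also have "\<dots> \<le> M * \<epsilon>"
          using M(2)[OF \<tau>'] d2(2)[OF \<tau>' xin(2)] \<tau> xy M(1) by (intro mult_mono) auto
        finally have 2: "\<bar>p \<tau> \<bullet> (q y - q \<tau>)\<bar> \<le> M * \<epsilon>" .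
        have "\<bar>(v x - v \<tau>) \<bullet> z' \<tau>\<bar> \<le> norm (v x - v \<tau>) * norm (z' \<tau>)" by (rule Cauchy_Schwarz_ineq2)
        also have "\<dots> \<le> \<epsilon> * L"
          using L(2)[OF \<tau>'] d1(2)[OF xin(1) \<tau>'] \<tau> xy \<epsilon> by (intro mult_mono) (auto simp: norm_minus_commute)
        finally have 3: "\<bar>(v x - v \<tau>) \<bullet> z' \<tau>\<bar> \<le> L * \<epsilon>" by (simp add: mult.commute)
        show "norm (f \<tau> \<bullet> (z y - z \<tau>) - p \<tau> \<bullet> (q y - q \<tau>) + (v x - v \<tau>) \<bullet> z' \<tau>) \<le> g \<tau>"
          using 1 2 3 unfolding g_def real_norm_def by linarith
      qed
      then have "\<bar>\<Phi> y - \<Phi> x\<bar> \<le> integral {x..y} g"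
        using integral_unique[OF main] by simp
      also have "\<dots> = integral {x..y} (\<lambda>t. norm (f t)) * (L * (y - x)) + (y - x) * (M * \<epsilon> + L * \<epsilon>)"
        by (rule integral_unique[OF gi])
      also have "\<dots> \<le> \<epsilon> * (L * (y - x)) + (y - x) * (M * \<epsilon> + L * \<epsilon>)"
        using F1 L xy by (intro add_right_mono mult_right_mono) auto
      also have "\<dots> = \<epsilon> * (2 * L + M) * (y - x)" by (simp add: algebra_simps)
      also have "\<dots> = e * (y - x)" using L M by (simp add: \<epsilon>_def)
      finally show ?thesis .
    qed
    then show "\<exists>d>0. \<forall>x y. a \<le> x \<and> x \<le> y \<and> y \<le> b \<and> y - x < d \<longrightarrow> \<bar>\<Phi> y - \<Phi> x\<bar> \<le> e * (y - x)"
      using d1(1) d2(1) d3(1) by (intro exI[of _ "min d1 (min d2 d3)"]) auto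
  qed
  then have "integral {a..b} G = v b \<bullet> z b - v a \<bullet> z a" by (simp add: \<Phi>_def)
  then show ?thesis using G unfolding G_def[symmetric] by (simp add: has_integral_iff)
qed

text \<open>Only scalar integrals against fixed vectors are given. Testing with the first-order
  remainder \<open>Z\<close> itself turns the scalar identity into a bound on the norm of
  \<open>Z\<close>.\<close>

lemma has_vector_derivative_weakI:
  fixes z y :: "real \<Rightarrow> 'h::real_inner"
  assumes y: "continuous_on {0..} y"
    and eq: "\<And>t \<phi>. t \<ge> 0 \<Longrightarrow> ((\<lambda>\<tau>. y \<tau> \<bullet> \<phi>) has_integral (z t - z 0) \<bullet> \<phi>) {0..t}" and t: "t \<ge> 0"
  shows "(z has_vector_derivative y t) (at t within {0..})"
  unfolding has_vector_derivative_def has_derivative_within_alt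
proof (intro conjI allI impI)
  fix e :: real assume e: "e > 0"
  obtain d where d: "d > 0" "\<And>\<tau>. \<tau> \<ge> 0 \<Longrightarrow> \<bar>\<tau> - t\<bar> < d \<Longrightarrow> norm (y \<tau> - y t) < e"
    using y t e unfolding continuous_on_iff dist_norm real_norm_def by (metis atLeast_iff)
  have step: "norm (z v - z u - (v - u) *\<^sub>R y t) \<le> e * (v - u)"
    if uv: "0 \<le> u" "u \<le> v" and near: "\<And>\<tau>. \<tau> \<in> {u..v} \<Longrightarrow> \<bar>\<tau> - t\<bar> < d" for u v
  proof -
    define Z where "Z = z v - z u - (v - u) *\<^sub>R y t"
    have i: "(\<lambda>\<tau>. y \<tau> \<bullet> Z) integrable_on {0..v}" using eq[of v Z] uv by auto
    have "integral {0..u} (\<lambda>\<tau>. y \<tau> \<bullet> Z) + integral {u..v} (\<lambda>\<tau>. y \<tau> \<bullet> Z) = integral {0..v} (\<lambda>\<tau>. y \<tau> \<bullet> Z)"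
      by (rule Henstock_Kurzweil_Integration.integral_combine) (use uv i in auto)
    then have "integral {u..v} (\<lambda>\<tau>. y \<tau> \<bullet> Z) = (z v - z u) \<bullet> Z"
      using integral_unique[OF eq[of u Z]] integral_unique[OF eq[of v Z]] uv by (simp add: inner_diff_left)
    then have I: "((\<lambda>\<tau>. y \<tau> \<bullet> Z) has_integral (z v - z u) \<bullet> Z) {u..v}"
      using integrable_subinterval_real[OF i, of u v] uv by (simp add: has_integral_iff)
    have "((\<lambda>\<tau>. y \<tau> \<bullet> Z - y t \<bullet> Z) has_integral (z v - z u) \<bullet> Z - (v - u) * (y t \<bullet> Z)) {u..v}"
      using has_integral_const_real[of "y t \<bullet> Z" u v] uv by (intro has_integral_diff I) simp
    then have J: "((\<lambda>\<tau>. (y \<tau> - y t) \<bullet> Z) has_integral Z \<bullet> Z) {u..v}"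
      by (simp add: Z_def inner_diff_left)
    have K: "((\<lambda>\<tau>. e * norm Z) has_integral (v - u) * (e * norm Z)) {u..v}"
      using has_integral_const_real[of "e * norm Z" u v] uv by simp
    have "Z \<bullet> Z \<le> (v - u) * (e * norm Z)"
    proof (rule has_integral_le[OF J K])
      fix \<tau> assume \<tau>: "\<tau> \<in> {u..v}"
      have "(y \<tau> - y t) \<bullet> Z \<le> norm (y \<tau> - y t) * norm Z" by (rule norm_cauchy_schwarz)
      also have "\<dots> \<le> e * norm Z"
        using d(2)[of \<tau>] near[OF \<tau>] \<tau> uv by (intro mult_right_mono) auto
      finally show "(y \<tau> - y t) \<bullet> Z \<le> e * norm Z" .
    qed
    then have "norm Z * norm Z \<le> (e * (v - u)) * norm Z"
      by (simp add: power2_norm_eq_inner[symmetric] power2_eq_square ac_simps)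
    then have "norm Z \<le> e * (v - u)" using uv e by (cases "norm Z = 0") auto
    then show ?thesis by (simp add: Z_def)
  qed
  have "norm (z s - z t - (s - t) *\<^sub>R y t) \<le> e * norm (s - t)" if s: "s \<in> {0..}" "norm (s - t) < d" for s
  proof (cases "t \<le> s")
    case True
    then show ?thesis using step[of t s] s t by auto
  next
    case False
    then have "norm (z t - z s - (t - s) *\<^sub>R y t) \<le> e * (t - s)"
      using s t by (intro step) auto
    moreover have "z s - z t - (s - t) *\<^sub>R y t = - (z t - z s - (t - s) *\<^sub>R y t)"
      by (simp add: algebra_simps)
    ultimately show ?thesis using False by (simp only: norm_minus_cancel) simp
  qed
  then show "\<exists>d>0. \<forall>s\<in>{0..}. norm (s - t) < d \<longrightarrow> norm (z s - z t - (s - t) *\<^sub>R y t) \<le> e * norm (s - t)"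
    using d(1) by blast
qed (simp add: bounded_linear_scaleR_left)

text \<open>Continuity in the test vector is what extends an identity of integrals from eigenvectors
  to all vectors.\<close>

lemma bounded_linear_integral_inner:
  fixes y :: "real \<Rightarrow> 'h::real_inner"
  assumes y: "continuous_on {a..b} y" and ab: "a \<le> b"
  shows "bounded_linear (\<lambda>\<phi>. integral {a..b} (\<lambda>\<tau>. y \<tau> \<bullet> \<phi>))"
proof -
  obtain L where L: "L > 0" "\<And>t. t \<in> {a..b} \<Longrightarrow> norm (y t) \<le> L" using bounded_on_interval[OF y] by blast
  have i: "(\<lambda>\<tau>. y \<tau> \<bullet> \<phi>) integrable_on {a..b}" for \<phi>
    by (intro integrable_continuous_real continuous_intros y)
  show ?thesis
  proof (rule bounded_linear_intro[where K = "L * (b - a)"])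
    fix \<phi>
    have "norm (integral {a..b} (\<lambda>\<tau>. y \<tau> \<bullet> \<phi>)) \<le> integral {a..b} (\<lambda>\<tau>. L * norm \<phi>)"
    proof (rule integral_norm_bound_integral[OF i])
      fix \<tau> assume "\<tau> \<in> {a..b}"
      have "norm (y \<tau> \<bullet> \<phi>) \<le> norm (y \<tau>) * norm \<phi>" by (simp add: Cauchy_Schwarz_ineq2)
      also have "\<dots> \<le> L * norm \<phi>" using L(2)[OF \<open>\<tau> \<in> {a..b}\<close>] by (intro mult_right_mono) auto
      finally show "norm (y \<tau> \<bullet> \<phi>) \<le> L * norm \<phi>" .
    qed auto
    then show "norm (integral {a..b} (\<lambda>\<tau>. y \<tau> \<bullet> \<phi>)) \<le> norm \<phi> * (L * (b - a))" using ab by (simp add: ac_simps)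
  qed (simp_all add: inner_add_right Henstock_Kurzweil_Integration.integral_add[OF i i])
qed

section \<open>Basic operations on solutions\<close>

context wave_operator
begin

lemma wave_solution_alt:
  "wave_solution D A I f w w' \<longleftrightarrow>
     (\<forall>t\<in>I. w t \<in> H1) \<and> continuous_on I (\<lambda>t. half (w t)) \<and>
     (\<forall>t\<in>I. (w has_vector_derivative w' t) (at t within I)) \<and> continuous_on I w' \<and>
     (\<forall>\<phi>\<in>H1. \<forall>t\<in>I. ((\<lambda>s. f s \<bullet> \<phi> - half (w s) \<bullet> half \<phi>) has_integral (w' t \<bullet> \<phi> - w' 0 \<bullet> \<phi>)) {0..t})"
  unfolding wave_solution_def Hsp_1 ..

lemma
  assumes "wave_solution D A I f w w'"
  shows wave_H1: "t \<in> I \<Longrightarrow> w t \<in> H1"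
    and wave_half_cont: "continuous_on I (\<lambda>t. half (w t))"
    and wave_deriv: "t \<in> I \<Longrightarrow> (w has_vector_derivative w' t) (at t within I)"
    and wave_deriv_cont: "continuous_on I w'"
    and wave_weak0: "\<phi> \<in> H1 \<Longrightarrow> t \<in> I \<Longrightarrow>
       ((\<lambda>s. f s \<bullet> \<phi> - half (w s) \<bullet> half \<phi>) has_integral (w' t \<bullet> \<phi> - w' 0 \<bullet> \<phi>)) {0..t}"
  using assms unfolding wave_solution_alt by blast+

lemma wave_cont: "wave_solution D A I f w w' \<Longrightarrow> continuous_on I w"
  by (rule continuous_on_vector_derivative[OF wave_deriv])

lemma wave_solution_subset:
  assumes "wave_solution D A I f w w'" "J \<subseteq> I"
  shows "wave_solution D A J f w w'"
  using assms unfolding wave_solution_alt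
  by (auto intro: continuous_on_subset has_vector_derivative_within_subset)

lemma wave_weak:
  assumes w: "wave_solution D A {0..T} f w w'" and \<phi>: "\<phi> \<in> H1" and st: "0 \<le> s" "s \<le> t" "t \<le> T"
  shows "((\<lambda>\<tau>. f \<tau> \<bullet> \<phi> - half (w \<tau>) \<bullet> half \<phi>) has_integral (w' t - w' s) \<bullet> \<phi>) {s..t}"
proof -
  let ?g = "\<lambda>\<tau>. f \<tau> \<bullet> \<phi> - half (w \<tau>) \<bullet> half \<phi>"
  have t: "(?g has_integral (w' t \<bullet> \<phi> - w' 0 \<bullet> \<phi>)) {0..t}" by (rule wave_weak0[OF w \<phi>]) (use st in auto)
  have s: "(?g has_integral (w' s \<bullet> \<phi> - w' 0 \<bullet> \<phi>)) {0..s}" by (rule wave_weak0[OF w \<phi>]) (use st in auto)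
  have i: "?g integrable_on {0..t}" using t by auto
  have "integral {0..s} ?g + integral {s..t} ?g = integral {0..t} ?g"
    by (rule Henstock_Kurzweil_Integration.integral_combine) (use i st in auto)
  then have "integral {s..t} ?g = (w' t - w' s) \<bullet> \<phi>"
    using integral_unique[OF t] integral_unique[OF s] by (simp add: inner_diff_left)
  moreover have "?g integrable_on {s..t}" by (rule integrable_subinterval_real[OF i]) (use st in auto)
  ultimately show ?thesis by (simp add: has_integral_iff)
qed

lemma wave_solution_diff:
  assumes w: "wave_solution D A I f w w'" and y: "wave_solution D A I g y y'"
    and I: "\<And>t. t \<in> I \<Longrightarrow> {0..t} \<subseteq> I"
  shows "wave_solution D A I (\<lambda>t. f t - g t) (\<lambda>t. w t - y t) (\<lambda>t. w' t - y' t)"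
  unfolding wave_solution_alt
proof (intro conjI ballI)
  show "w t - y t \<in> H1" if "t \<in> I" for t
    using wave_H1[OF w that] wave_H1[OF y that] by (rule subspace_diff[OF subspace_pow_dom])
  have half: "half (w t - y t) = half (w t) - half (y t)" if "t \<in> I" for t
    using wave_H1[OF w that] wave_H1[OF y that] by (rule half_diff)
  then show "continuous_on I (\<lambda>t. half (w t - y t))"
    using continuous_on_diff[OF wave_half_cont[OF w] wave_half_cont[OF y]] by (simp cong: continuous_on_cong)
  show "((\<lambda>t. w t - y t) has_vector_derivative w' t - y' t) (at t within I)" if "t \<in> I" for t
    by (intro has_vector_derivative_diff wave_deriv[OF w] wave_deriv[OF y] that)
  show "continuous_on I (\<lambda>t. w' t - y' t)"
    by (intro continuous_on_diff wave_deriv_cont[OF w] wave_deriv_cont[OF y])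
  fix \<phi> t assume \<phi>: "\<phi> \<in> H1" and t: "t \<in> I"
  have "((\<lambda>s. (f s \<bullet> \<phi> - half (w s) \<bullet> half \<phi>) - (g s \<bullet> \<phi> - half (y s) \<bullet> half \<phi>)) has_integral
      (w' t \<bullet> \<phi> - w' 0 \<bullet> \<phi>) - (y' t \<bullet> \<phi> - y' 0 \<bullet> \<phi>)) {0..t}"
    by (rule has_integral_diff[OF wave_weak0[OF w \<phi> t] wave_weak0[OF y \<phi> t]])
  then have "((\<lambda>s. (f s - g s) \<bullet> \<phi> - half (w s - y s) \<bullet> half \<phi>) has_integral
      (w' t \<bullet> \<phi> - w' 0 \<bullet> \<phi>) - (y' t \<bullet> \<phi> - y' 0 \<bullet> \<phi>)) {0..t}"
    by (rule has_integral_eq[rotated]) (use half I[OF t] in \<open>auto simp: subset_iff inner_diff_left\<close>)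
  then show "((\<lambda>s. (f s - g s) \<bullet> \<phi> - half (w s - y s) \<bullet> half \<phi>) has_integral
          (w' t - y' t) \<bullet> \<phi> - (w' 0 - y' 0) \<bullet> \<phi>) {0..t}"
    by (simp add: inner_diff_left algebra_simps)
qed

lemma wave_integration_by_parts:
  assumes w: "wave_solution D A {0..T} f w w'" and ab: "0 \<le> a" "a \<le> b" "b \<le> T"
    and z: "\<And>t. t \<in> {a..b} \<Longrightarrow> (z has_vector_derivative z' t) (at t within {a..b})"
    and zH: "\<And>t. t \<in> {a..b} \<Longrightarrow> z t \<in> H1" and hz: "continuous_on {a..b} (\<lambda>t. half (z t))"
    and z': "continuous_on {a..b} z'"
    and nf: "(\<lambda>t. norm (f t)) integrable_on {a..b}" and fz: "(\<lambda>t. f t \<bullet> z t) integrable_on {a..b}"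
  shows "((\<lambda>t. f t \<bullet> z t - half (w t) \<bullet> half (z t) + w' t \<bullet> z' t)
      has_integral (w' b \<bullet> z b - w' a \<bullet> z a)) {a..b}"
proof (rule weak_integration_by_parts[OF ab(2) _ z z' _ hz nf fz])
  show "continuous_on {a..b} w'" "continuous_on {a..b} (\<lambda>t. half (w t))"
    using ab by (auto intro: continuous_on_subset[OF wave_deriv_cont[OF w]] continuous_on_subset[OF wave_half_cont[OF w]])
  show "((\<lambda>\<tau>. f \<tau> \<bullet> z t - half (w \<tau>) \<bullet> half (z t)) has_integral (w' t - w' s) \<bullet> z t) {s..t}"
    if "a \<le> s" "s \<le> t" "t \<le> b" for s t
    by (rule wave_weak[OF w zH]) (use that ab in auto)
qed

text \<open>Each equation is tested with the other solution. The elastic and kinetic terms are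
  symmetric in the two solutions and cancel in the difference, which leaves the sources and the end
  points.\<close>

theorem wave_bracket:
  assumes w: "wave_solution D A {0..T} f w w'" and y: "wave_solution D A {0..T} g y y'"
    and T: "0 \<le> T" and f: "continuous_on {0..T} f" and g: "continuous_on {0..T} g"
  shows "((\<lambda>t. f t \<bullet> y t - w t \<bullet> g t) has_integral
      (w' T \<bullet> y T - w T \<bullet> y' T) - (w' 0 \<bullet> y 0 - w 0 \<bullet> y' 0)) {0..T}"
proof -
  have 1: "((\<lambda>t. f t \<bullet> y t - half (w t) \<bullet> half (y t) + w' t \<bullet> y' t)
      has_integral (w' T \<bullet> y T - w' 0 \<bullet> y 0)) {0..T}"
    by (rule wave_integration_by_parts[OF w _ T _ wave_deriv[OF y] wave_H1[OF y] wave_half_cont[OF y] wave_deriv_cont[OF y]])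
       (auto intro!: integrable_continuous_real continuous_intros f wave_cont[OF y])
  have 2: "((\<lambda>t. g t \<bullet> w t - half (y t) \<bullet> half (w t) + y' t \<bullet> w' t)
      has_integral (y' T \<bullet> w T - y' 0 \<bullet> w 0)) {0..T}"
    by (rule wave_integration_by_parts[OF y _ T _ wave_deriv[OF w] wave_H1[OF w] wave_half_cont[OF w] wave_deriv_cont[OF w]])
       (auto intro!: integrable_continuous_real continuous_intros g wave_cont[OF w])
  have "((\<lambda>t. f t \<bullet> y t - w t \<bullet> g t) has_integral
      (w' T \<bullet> y T - w' 0 \<bullet> y 0) - (y' T \<bullet> w T - y' 0 \<bullet> w 0)) {0..T}"
    by (rule has_integral_eq[OF _ has_integral_diff[OF 1 2]]) (simp add: inner_commute)
  then show ?thesis by (rule has_integral_eq_rhs) (simp add: inner_commute)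
qed

section \<open>Energy estimate by duality\<close>

abbreviation state :: "'h \<Rightarrow> 'h \<Rightarrow> 'h \<times> 'h" where "state u v \<equiv> (half u, v)"

lemma energy_state: "energy D A 1 (u, v) = (norm (state u v))\<^sup>2 / 2"
  by (simp add: energy_1 norm_prod_def)

lemma E_H1: "u \<in> E l \<Longrightarrow> u \<in> H1" and half_E: "u \<in> E l \<Longrightarrow> half u = l powr (1/2) *\<^sub>R u"
  using fc_eigenvector[of u l "\<lambda>l. l powr (1/2)"] by (simp_all add: pow_dom_eq_fdom op_pow_eq_fc)

lemma P_half: "u \<in> H1 \<Longrightarrow> l \<in> \<sigma> \<Longrightarrow> P l (half u) = l powr (1/2) *\<^sub>R P l u"
  using P_fc[of u "\<lambda>l. l powr (1/2)" l] by (simp add: pow_dom_eq_fdom op_pow_eq_fc)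

lemma wave_source_integrable:
  assumes w: "wave_solution D A {0..T} f w w'" and \<phi>: "\<phi> \<in> H1" and T: "0 \<le> T"
  shows "(\<lambda>t. f t \<bullet> \<phi>) integrable_on {0..T}"
proof -
  have "(\<lambda>t. (f t \<bullet> \<phi> - half (w t) \<bullet> half \<phi>) + half (w t) \<bullet> half \<phi>) integrable_on {0..T}"
    using wave_weak0[OF w \<phi>, of T] T
    by (intro integrable_add[OF _ integrable_continuous_real] continuous_intros wave_half_cont[OF w]) auto
  then show ?thesis by simp
qed

text \<open>Testing against the single-mode free solution \<open>(x,y)\<close> with frequency \<open>\<nu> = \<surd>l\<close> whose state at
  time \<open>t0\<close> is \<open>(\<alpha>,b)\<close>.\<close>

lemma mode_duality:
  fixes \<alpha> b :: 'h and t0 :: real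
  assumes w: "wave_solution D A {0..T} f w w'" and cd: "0 \<le> c" "c \<le> d" "d \<le> T"
    and nf: "(\<lambda>t. norm (f t)) integrable_on {0..T}"
    and E: "\<alpha> \<in> E l" "b \<in> E l"
  defines "x \<equiv> \<lambda>\<tau>. cos (l powr (1/2) * (\<tau> - t0)) *\<^sub>R \<alpha> + sin (l powr (1/2) * (\<tau> - t0)) *\<^sub>R b"
    and "y \<equiv> \<lambda>\<tau>. - sin (l powr (1/2) * (\<tau> - t0)) *\<^sub>R \<alpha> + cos (l powr (1/2) * (\<tau> - t0)) *\<^sub>R b"
  shows "((\<lambda>\<tau>. f \<tau> \<bullet> y \<tau>) has_integral
      (state (w d) (w' d) \<bullet> (x d, y d) - state (w c) (w' c) \<bullet> (x c, y c))) {c..d}"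
proof -
  define \<nu> where "\<nu> = l powr (1/2)"
  have T: "0 \<le> T" using cd by simp
  have sub: "{c..d} \<subseteq> {0..T}" using cd by auto
  have xE: "x \<tau> \<in> E l" and yE: "y \<tau> \<in> E l" for \<tau>
    unfolding x_def y_def using E by (intro subspace_add[OF subspace_E] subspace_scale[OF subspace_E]; simp)+
  have hx: "half (x \<tau>) = \<nu> *\<^sub>R x \<tau>" and hy: "half (y \<tau>) = \<nu> *\<^sub>R y \<tau>" for \<tau>
    using half_E xE yE by (simp_all add: \<nu>_def)
  have dx: "(x has_vector_derivative \<nu> *\<^sub>R y \<tau>) (at \<tau> within X)" for \<tau> X
    unfolding x_def y_def \<nu>_def
    by (auto intro!: derivative_eq_intros simp: algebra_simps)
  have dy: "(y has_vector_derivative - (\<nu> *\<^sub>R x \<tau>)) (at \<tau> within X)" for \<tau> X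
    unfolding x_def y_def \<nu>_def
    by (auto intro!: derivative_eq_intros simp: algebra_simps)
  have cx: "continuous_on X x" and cy: "continuous_on X y" for X
    by (rule continuous_on_vector_derivative, rule dx, rule continuous_on_vector_derivative, rule dy)
  have fy: "(\<lambda>t. f t \<bullet> y t) integrable_on {c..d}"
  proof -
    \<comment> \<open>A continuous factor is multiplied in below, which calls for absolute
      integrability; the bound by \<open>norm (f t)\<close> provides it.\<close>
    have ai: "(\<lambda>t. f t \<bullet> u) absolutely_integrable_on {c..d}" if "u \<in> E l" for u
    proof (rule absolutely_integrable_integrable_bound[where g = "\<lambda>t. norm (f t) * norm u"])
      show "(\<lambda>t. f t \<bullet> u) integrable_on {c..d}"
        using wave_source_integrable[OF w E_H1[OF that] T] sub by (rule integrable_subinterval_real)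
      show "(\<lambda>t. norm (f t) * norm u) integrable_on {c..d}"
        by (intro integrable_on_mult_left integrable_subinterval_real[OF nf sub])
    qed (use Cauchy_Schwarz_ineq2 in auto)
    have prod: "(\<lambda>t. k t * (f t \<bullet> u)) integrable_on {c..d}" if "u \<in> E l" "continuous_on {c..d} k" for u k
    proof -
      have "bounded (k ` {c..d})"
        by (rule compact_imp_bounded[OF compact_continuous_image[OF that(2)]]) simp
      then have "(\<lambda>t. k t * (f t \<bullet> u)) absolutely_integrable_on {c..d}"
        by (intro absolutely_integrable_bounded_measurable_product_real ai that
             continuous_imp_measurable_on_sets_lebesgue) auto
      then show ?thesis by (rule set_lebesgue_integral_eq_integral(1))
    qed
    have "(\<lambda>t. - sin (\<nu> * (t - t0)) * (f t \<bullet> \<alpha>) + cos (\<nu> * (t - t0)) * (f t \<bullet> b)) integrable_on {c..d}"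
      by (intro integrable_add prod E continuous_intros)
    then show ?thesis by (simp add: y_def \<nu>_def inner_add_right inner_diff_right)
  qed
  \<comment> \<open>The velocity is paired with \<open>y\<close> through the weak equation, the
    position with \<open>x\<close> through the product rule. As \<open>half\<close> acts as
    \<open>\<nu>\<close> on the mode, the terms under the integral cancel except for the
    source.\<close>
  have 1: "((\<lambda>t. f t \<bullet> y t - half (w t) \<bullet> half (y t) + w' t \<bullet> (- (\<nu> *\<^sub>R x t)))
      has_integral (w' d \<bullet> y d - w' c \<bullet> y c)) {c..d}"
    by (rule wave_integration_by_parts[OF w cd dy _ _ _ integrable_subinterval_real[OF nf sub] fy])
       (auto simp: hy E_H1[OF yE] intro!: continuous_intros cx cy)
  have hwx: "half (w t) \<bullet> x t = \<nu> * (w t \<bullet> x t)" if "t \<in> {0..T}" for t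
    using op_pow_sym[OF wave_H1[OF w that] E_H1[OF xE], of t] by (simp add: hx)
  have 2: "((\<lambda>t. \<nu> * (w' t \<bullet> x t + w t \<bullet> (\<nu> *\<^sub>R y t))) has_integral \<nu> * (w d \<bullet> x d - w c \<bullet> x c)) {c..d}"
  proof -
    have "((\<lambda>t. w t \<bullet> x t) has_vector_derivative (w t \<bullet> (\<nu> *\<^sub>R y t) + w' t \<bullet> x t)) (at t within {c..d})"
      if "t \<in> {c..d}" for t
      using has_vector_derivative_within_subset[OF wave_deriv[OF w] sub, of t] that sub
      by (intro bounded_bilinear.has_vector_derivative[OF bounded_bilinear_inner] dx) auto
    from fundamental_theorem_of_calculus[OF cd(2) this]
    show ?thesis by (intro has_integral_mult_right) (simp add: add.commute)
  qed
  have hwy: "half (w t) \<bullet> half (y t) = \<nu> * (w t \<bullet> (\<nu> *\<^sub>R y t))" if "t \<in> {0..T}" for t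
    using op_pow_sym[OF wave_H1[OF w that] E_H1[OF yE], of t] by (simp add: hy)
  have "((\<lambda>t. f t \<bullet> y t) has_integral (w' d \<bullet> y d - w' c \<bullet> y c) + \<nu> * (w d \<bullet> x d - w c \<bullet> x c)) {c..d}"
    by (rule has_integral_eq[OF _ has_integral_add[OF 1 2]])
       (use sub hwy in \<open>auto simp: algebra_simps subset_iff\<close>)
  then show ?thesis
    by (rule has_integral_eq_rhs) (use cd hwx[of c] hwx[of d] in \<open>simp add: right_diff_distrib\<close>)
qed

theorem energy_estimate:
  assumes w: "wave_solution D A {0..T} f w w'" and st: "s \<in> {0..T}" "t \<in> {0..T}"
    and nf: "(\<lambda>t. norm (f t)) integrable_on {0..T}"
  shows "norm (state (w t) (w' t)) \<le> norm (state (w s) (w' s)) + integral {min s t..max s t} (\<lambda>\<tau>. norm (f \<tau>))"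
proof -
  define R where "R = norm (state (w s) (w' s)) + integral {min s t..max s t} (\<lambda>\<tau>. norm (f \<tau>))"
  define \<alpha> where "\<alpha> l = P l (half (w t))" for l
  define b where "b l = P l (w' t)" for l
  define x where "x l \<tau> = cos (l powr (1/2) * (\<tau> - t)) *\<^sub>R \<alpha> l + sin (l powr (1/2) * (\<tau> - t)) *\<^sub>R b l" for l \<tau>
  define y where "y l \<tau> = - sin (l powr (1/2) * (\<tau> - t)) *\<^sub>R \<alpha> l + cos (l powr (1/2) * (\<tau> - t)) *\<^sub>R b l" for l \<tau>
  have sub: "{min s t..max s t} \<subseteq> {0..T}" using st by auto
  have nf': "(\<lambda>t. norm (f t)) integrable_on {min s t..max s t}"
    by (rule integrable_subinterval_real[OF nf sub])
  have R0: "0 \<le> integral {min s t..max s t} (\<lambda>\<tau>. norm (f \<tau>))"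
    by (rule integral_nonneg[OF nf']) simp
  have fin: "(\<Sum>l\<in>F. (norm (\<alpha> l))\<^sup>2 + (norm (b l))\<^sup>2) \<le> R\<^sup>2" if F: "finite F" "F \<subseteq> \<sigma>" for F
  proof -
    \<comment> \<open>The squared norm of the projected state at time \<open>t\<close>, and at every
      time that of the test solution \<open>(X, Y)\<close>; this is why
      \<open>N \<le> R * sqrt N\<close> will follow.\<close>
    define N where "N = (\<Sum>l\<in>F. (norm (\<alpha> l))\<^sup>2 + (norm (b l))\<^sup>2)"
    have N0: "0 \<le> N" unfolding N_def by (intro sum_nonneg) auto
    define X where "X \<tau> = (\<Sum>l\<in>F. x l \<tau>)" for \<tau>
    define Y where "Y \<tau> = (\<Sum>l\<in>F. y l \<tau>)" for \<tau>
    have E: "\<alpha> l \<in> E l" "b l \<in> E l" for l by (simp_all add: \<alpha>_def b_def P_in)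
    have xE: "x l \<tau> \<in> E l" and yE: "y l \<tau> \<in> E l" for l \<tau>
      unfolding x_def y_def using E by (intro subspace_add[OF subspace_E] subspace_scale[OF subspace_E]; simp)+
    have rot: "(norm (x l \<tau>))\<^sup>2 + (norm (y l \<tau>))\<^sup>2 = (norm (\<alpha> l))\<^sup>2 + (norm (b l))\<^sup>2" for l \<tau>
    proof -
      define C S' where "C = cos (l powr (1/2) * (\<tau> - t))" and "S' = sin (l powr (1/2) * (\<tau> - t))"
      have "(norm (x l \<tau>))\<^sup>2 + (norm (y l \<tau>))\<^sup>2 = (S'\<^sup>2 + C\<^sup>2) * ((norm (\<alpha> l))\<^sup>2 + (norm (b l))\<^sup>2)"
        unfolding x_def y_def power2_norm_eq_inner C_def[symmetric] S'_def[symmetric]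
        by (simp add: inner_add_left inner_add_right inner_diff_left inner_diff_right inner_commute
            algebra_simps power2_eq_square)
      then show ?thesis by (simp add: C_def S'_def)
    qed
    have XY: "(norm (X \<tau>, Y \<tau>))\<^sup>2 = N" for \<tau>
    proof -
      have "(norm (X \<tau>))\<^sup>2 = (\<Sum>l\<in>F. (norm (x l \<tau>))\<^sup>2)" "(norm (Y \<tau>))\<^sup>2 = (\<Sum>l\<in>F. (norm (y l \<tau>))\<^sup>2)"
        unfolding X_def Y_def by (rule norm_sum_orthogonal; use F xE yE E_orth in blast)+
      then show ?thesis
        using N0[unfolded N_def] by (simp add: norm_prod_def N_def sum.distrib[symmetric] rot)
    qed
    have XYn: "norm (X \<tau>, Y \<tau>) = sqrt N" for \<tau> by (metis XY norm_ge_zero real_sqrt_unique)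
    have Yn: "norm (Y \<tau>) \<le> sqrt N" for \<tau> using norm_snd_le[where y = "Y \<tau>" and x = "X \<tau>"] XYn[of \<tau>] by simp
    have I: "((\<lambda>\<tau>. f \<tau> \<bullet> Y \<tau>) has_integral
       (state (w (max s t)) (w' (max s t)) \<bullet> (X (max s t), Y (max s t))
        - state (w (min s t)) (w' (min s t)) \<bullet> (X (min s t), Y (min s t)))) {min s t..max s t}"
    proof -
      have "((\<lambda>\<tau>. \<Sum>l\<in>F. f \<tau> \<bullet> y l \<tau>) has_integral (\<Sum>l\<in>F.
         (state (w (max s t)) (w' (max s t)) \<bullet> (x l (max s t), y l (max s t))
        - state (w (min s t)) (w' (min s t)) \<bullet> (x l (min s t), y l (min s t))))) {min s t..max s t}"
      proof (rule has_integral_sum[OF F(1)])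
        fix l assume "l \<in> F"
        show "((\<lambda>\<tau>. f \<tau> \<bullet> y l \<tau>) has_integral
         (state (w (max s t)) (w' (max s t)) \<bullet> (x l (max s t), y l (max s t))
        - state (w (min s t)) (w' (min s t)) \<bullet> (x l (min s t), y l (min s t)))) {min s t..max s t}"
          unfolding x_def y_def by (rule mode_duality[OF w _ _ _ nf E]) (use st in auto)
      qed
      then show ?thesis
        by (simp add: X_def Y_def inner_sum_right sum_subtractf sum.distrib)
    qed
    have I2: "\<bar>integral {min s t..max s t} (\<lambda>\<tau>. f \<tau> \<bullet> Y \<tau>)\<bar>
        \<le> integral {min s t..max s t} (\<lambda>\<tau>. norm (f \<tau>)) * sqrt N"
    proof -
      have "norm (integral {min s t..max s t} (\<lambda>\<tau>. f \<tau> \<bullet> Y \<tau>))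
          \<le> integral {min s t..max s t} (\<lambda>\<tau>. norm (f \<tau>) * sqrt N)"
      proof (rule integral_norm_bound_integral)
        show "(\<lambda>\<tau>. f \<tau> \<bullet> Y \<tau>) integrable_on {min s t..max s t}" using I by auto
        show "(\<lambda>\<tau>. norm (f \<tau>) * sqrt N) integrable_on {min s t..max s t}"
          by (intro integrable_on_mult_left nf')
        fix \<tau>
        have "norm (f \<tau> \<bullet> Y \<tau>) \<le> norm (f \<tau>) * norm (Y \<tau>)" by (simp add: Cauchy_Schwarz_ineq2)
        also have "\<dots> \<le> norm (f \<tau>) * sqrt N" by (intro mult_left_mono Yn) simp
        finally show "norm (f \<tau> \<bullet> Y \<tau>) \<le> norm (f \<tau>) * sqrt N" .
      qed
      then show ?thesis by simp
    qed
    have t0: "state (w t) (w' t) \<bullet> (X t, Y t) = N"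
    proof -
      have "half (w t) \<bullet> \<alpha> l = (norm (\<alpha> l))\<^sup>2" "w' t \<bullet> b l = (norm (b l))\<^sup>2" for l
        by (simp_all add: \<alpha>_def b_def power2_norm_eq_inner P_sym)
      then show ?thesis by (simp add: X_def Y_def x_def y_def N_def inner_sum_right sum.distrib)
    qed
    have s0: "\<bar>state (w s) (w' s) \<bullet> (X s, Y s)\<bar> \<le> norm (state (w s) (w' s)) * sqrt N"
      using Cauchy_Schwarz_ineq2[of "state (w s) (w' s)" "(X s, Y s)"] XYn by simp
    have "\<bar>N - state (w s) (w' s) \<bullet> (X s, Y s)\<bar> \<le> integral {min s t..max s t} (\<lambda>\<tau>. norm (f \<tau>)) * sqrt N"
      using I2 integral_unique[OF I] t0 by (cases "s \<le> t") (simp_all add: abs_minus_commute)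
    then have "N \<le> R * sqrt N" using s0 unfolding R_def distrib_right by linarith
    then have m: "sqrt N * sqrt N \<le> R * sqrt N" using N0 by simp
    have "sqrt N \<le> R"
    proof (cases "N = 0")
      case True then show ?thesis using R0 by (simp add: R_def)
    next
      case False
      then have "0 < sqrt N" using N0 by simp
      then show ?thesis using m by (rule mult_right_le_imp_le[rotated])
    qed
    then have "(sqrt N)\<^sup>2 \<le> R\<^sup>2" using N0 by (intro power_mono) auto
    then show ?thesis using N0 by (simp add: N_def)
  qed
  have "((\<lambda>l. (norm (P l u))\<^sup>2) has_sum (norm u)\<^sup>2) \<sigma>" for u
    using norm_fc[OF fc_one(2), of u] by (simp add: fc_one)
  then have "((\<lambda>l. (norm (\<alpha> l))\<^sup>2 + (norm (b l))\<^sup>2) has_sum (norm (half (w t)))\<^sup>2 + (norm (w' t))\<^sup>2) \<sigma>"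
    unfolding \<alpha>_def b_def by (intro has_sum_add)
  then have "(norm (half (w t)))\<^sup>2 + (norm (w' t))\<^sup>2 \<le> R\<^sup>2"
    by (rule has_sum_le_finite_sums) (rule fin)
  then have "(norm (state (w t) (w' t)))\<^sup>2 \<le> R\<^sup>2" by (simp add: norm_prod_def)
  then show ?thesis unfolding R_def[symmetric]
    by (rule power2_le_imp_le) (use R0 in \<open>simp add: R_def\<close>)
qed

section \<open>Free solutions and primitives in time\<close>

lemma bounded_linear_eq_on_modes:
  fixes g h :: "'h \<Rightarrow> real"
  assumes g: "bounded_linear g" and h: "bounded_linear h"
    and eq: "\<And>l v. l \<in> \<sigma> \<Longrightarrow> v \<in> E l \<Longrightarrow> g v = h v"
  shows "g u = h u"
proof -
  have 1: "((\<lambda>l. g (P l u)) has_sum g u) \<sigma>" by (rule has_sum_bounded_linear[OF g spectral_decomposition])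
  have 2: "((\<lambda>l. h (P l u)) has_sum h u) \<sigma>" by (rule has_sum_bounded_linear[OF h spectral_decomposition])
  have "((\<lambda>l. g (P l u)) has_sum h u) \<sigma> \<longleftrightarrow> ((\<lambda>l. h (P l u)) has_sum h u) \<sigma>"
    by (rule has_sum_cong) (simp add: eq P_in)
  then show ?thesis using 1 2 has_sum_unique by blast
qed

text \<open>On an eigenspace the pair of \<open>half z\<close> and the velocity rotates with
  frequency the square root of the eigenvalue. The functional calculus assembles these rotations
  into \<open>x\<close> and \<open>y\<close>, and \<open>S\<close> recovers the position from
  \<open>x\<close>.\<close>

theorem free_solution_exists:
  assumes u: "u0 \<in> H1"
  shows "\<exists>z z'. wave_solution D A {0..} (\<lambda>t. 0) z z' \<and> z 0 = u0 \<and> z' 0 = u1"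
proof -
  define a where "a = half u0"
  define C where "C t = fc (\<lambda>l. cos (l powr (1/2) * t))" for t
  define N where "N t = fc (\<lambda>l. sin (l powr (1/2) * t))" for t
  define x where "x t = C t a + N t u1" for t
  define y where "y t = C t u1 - N t a" for t
  define z where "z t = S (x t)" for t
  have cC: "continuous_on UNIV (\<lambda>t. C t v)" and cN: "continuous_on UNIV (\<lambda>t. N t v)" for v
    unfolding continuous_on_def C_def N_def
    by (intro ballI fc_tendsto[where c = 1] tendsto_intros; simp)+
  have cx: "continuous_on I x" and cy: "continuous_on I y" for I
    unfolding x_def y_def
    by (intro continuous_intros continuous_on_subset[OF cC] continuous_on_subset[OF cN] subset_UNIV)+
  have dom: "v \<in> fdom (\<lambda>l. cos (l powr (1/2) * t))" "v \<in> fdom (\<lambda>l. sin (l powr (1/2) * t))" for v t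
    by (rule fc_bounded(1)[where c = 1]; simp)+
  have ev: "C t v = cos (l powr (1/2) * t) *\<^sub>R v" "N t v = sin (l powr (1/2) * t) *\<^sub>R v" if "v \<in> E l" for t v l
    using fc_eigenvector[OF that] by (simp_all add: C_def N_def)
  have symC: "C t v \<bullet> r = v \<bullet> C t r" and symN: "N t v \<bullet> r = v \<bullet> N t r" for t v r
    unfolding C_def N_def by (intro fc_sym dom)+
  have xv: "x t \<bullet> v = cos (l powr (1/2) * t) * (a \<bullet> v) + sin (l powr (1/2) * t) * (u1 \<bullet> v)"
    and yv: "y t \<bullet> v = cos (l powr (1/2) * t) * (u1 \<bullet> v) - sin (l powr (1/2) * t) * (a \<bullet> v)"
    if "v \<in> E l" for t v l
    by (simp_all add: x_def y_def inner_add_left inner_diff_left symC symN ev[OF that])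
  have C0: "C 0 v = v" and N0: "N 0 v = 0" for v
    using fc_one(1)[of v] fc_eigenvector by (simp_all add: C_def N_def fc_def)
  have hz: "half (z t) = x t" and zH: "z t \<in> H1" for t by (simp_all add: z_def half_S)
  have Sv: "S v = l powr (- (1/2)) *\<^sub>R v" if "v \<in> E l" for v l
    using fc_eigenvector[OF that, of "\<lambda>l. l powr (- (1/2))"] by (simp add: op_pow_eq_fc)
  \<comment> \<open>Both sides are bounded in \<open>\<phi>\<close>, so the identity may be checked
    on a single mode, where the integrand is a combination of sine and cosine.\<close>
  have z_int: "((\<lambda>\<tau>. y \<tau> \<bullet> \<phi>) has_integral (z t - z 0) \<bullet> \<phi>) {0..t}" if t: "t \<ge> 0" for t \<phi>
  proof -
    have "integral {0..t} (\<lambda>\<tau>. y \<tau> \<bullet> \<phi>) = (z t - z 0) \<bullet> \<phi>"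
    proof (rule bounded_linear_eq_on_modes[OF bounded_linear_integral_inner[OF cy t] bounded_linear_inner_right])
      fix l v assume l: "l \<in> \<sigma>" and v: "v \<in> E l"
      have lp: "l powr (- (1/2)) * l powr (1/2) = 1"
        using \<sigma>_pos[OF l] by (simp flip: powr_add)
      have zv: "z \<tau> \<bullet> v = l powr (- (1/2)) * (cos (l powr (1/2) * \<tau>) * (a \<bullet> v) + sin (l powr (1/2) * \<tau>) * (u1 \<bullet> v))" for \<tau>
        by (simp add: z_def S_sym Sv[OF v] xv[OF v])
      have "((\<lambda>\<tau>. z \<tau> \<bullet> v) has_real_derivative
          (l powr (- (1/2)) * l powr (1/2)) * (y \<tau> \<bullet> v)) (at \<tau> within {0..t})" for \<tau>
        unfolding zv yv[OF v] by (auto intro!: derivative_eq_intros simp: algebra_simps)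
      then have "((\<lambda>\<tau>. z \<tau> \<bullet> v) has_vector_derivative y \<tau> \<bullet> v) (at \<tau> within {0..t})" for \<tau>
        unfolding lp by (simp add: has_real_derivative_iff_has_vector_derivative)
      from fundamental_theorem_of_calculus[OF t this]
      show "integral {0..t} (\<lambda>\<tau>. y \<tau> \<bullet> v) = (z t - z 0) \<bullet> v"
        by (simp add: inner_diff_left integral_unique)
    qed
    moreover have "(\<lambda>\<tau>. y \<tau> \<bullet> \<phi>) integrable_on {0..t}"
      by (intro integrable_continuous_real continuous_intros cy)
    ultimately show ?thesis by (simp add: has_integral_iff)
  qed
  \<comment> \<open>Writing the test vector as \<open>S \<psi>\<close> makes \<open>half\<close> of
    it equal to \<open>\<psi>\<close>; both sides are bounded in \<open>\<psi>\<close>, and the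
    reduction to modes applies again.\<close>
  have y_int: "((\<lambda>\<tau>. - (x \<tau> \<bullet> \<psi>)) has_integral (y t - y 0) \<bullet> S \<psi>) {0..t}" if t: "t \<ge> 0" for t \<psi>
  proof -
    have "bounded_linear (\<lambda>\<psi>. (y t - y 0) \<bullet> S \<psi>)"
      by (rule bounded_linear_compose[OF bounded_linear_inner_right bounded_linear_S])
    moreover have "bounded_linear (\<lambda>\<psi>. - integral {0..t} (\<lambda>\<tau>. x \<tau> \<bullet> \<psi>))"
      by (rule bounded_linear_minus[OF bounded_linear_integral_inner[OF cx t]])
    ultimately have "(y t - y 0) \<bullet> S \<psi> = - integral {0..t} (\<lambda>\<tau>. x \<tau> \<bullet> \<psi>)"
    proof (rule bounded_linear_eq_on_modes)
      fix l v assume l: "l \<in> \<sigma>" and v: "v \<in> E l"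
      have lp: "l powr (- (1/2)) * l powr (1/2) = 1"
        using \<sigma>_pos[OF l] by (simp flip: powr_add)
      have "((\<lambda>\<tau>. l powr (- (1/2)) * (y \<tau> \<bullet> v)) has_real_derivative
          - ((l powr (- (1/2)) * l powr (1/2)) * (x \<tau> \<bullet> v))) (at \<tau> within {0..t})" for \<tau>
        unfolding xv[OF v] yv[OF v] by (auto intro!: derivative_eq_intros simp: algebra_simps)
      then have "((\<lambda>\<tau>. l powr (- (1/2)) * (y \<tau> \<bullet> v)) has_vector_derivative - (x \<tau> \<bullet> v)) (at \<tau> within {0..t})" for \<tau>
        unfolding lp by (simp add: has_real_derivative_iff_has_vector_derivative)
      from fundamental_theorem_of_calculus[OF t this]
      have "((\<lambda>\<tau>. - (x \<tau> \<bullet> v)) has_integral (y t - y 0) \<bullet> S v) {0..t}"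
        by (simp add: inner_diff_left Sv[OF v] right_diff_distrib)
      from integral_unique[OF this]
      show "(y t - y 0) \<bullet> S v = - integral {0..t} (\<lambda>\<tau>. x \<tau> \<bullet> v)" by simp
    qed
    moreover have "(\<lambda>\<tau>. - (x \<tau> \<bullet> \<psi>)) integrable_on {0..t}"
      by (intro integrable_continuous_real continuous_intros cx)
    ultimately show ?thesis by (simp add: has_integral_iff)
  qed
  have "wave_solution D A {0..} (\<lambda>t. 0) z y"
    unfolding wave_solution_alt
  proof (intro conjI ballI)
    show "((\<lambda>s. 0 \<bullet> \<phi> - half (z s) \<bullet> half \<phi>) has_integral y t \<bullet> \<phi> - y 0 \<bullet> \<phi>) {0..t}"
      if "\<phi> \<in> H1" "t \<in> {0..}" for \<phi> t
      using y_int[of t "half \<phi>"] that by (simp add: hz S_half inner_diff_left)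
  qed (use zH cx cy hz z_int in \<open>auto intro: has_vector_derivative_weakI[OF cy]\<close>)
  moreover have "z 0 = u0" "y 0 = u1" by (simp_all add: z_def x_def y_def C0 N0 a_def S_half[OF u])
  ultimately show ?thesis by blast
qed

text \<open>\<open>- A\<^sup>-\<^sup>1 (w' - g)\<close> is a primitive of \<open>w\<close>, by the equation, and \<open>e\<^sub>k\<close> of the former corresponds
  to \<open>e\<^sub>k\<^sub>-\<^sub>1\<close> of the latter.\<close>

theorem antiderivative_solution:
  assumes w: "wave_solution D A {0..} f w w'" and f: "continuous_on {0..} f"
    and g: "\<And>t. t \<ge> 0 \<Longrightarrow> (g has_vector_derivative f t) (at t within {0..})"
  shows "wave_solution D A {0..} g (\<lambda>t. S (S (g t - w' t))) w"
proof -
  define v where "v t = S (S (g t - w' t))" for t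
  have SS: "bounded_linear (\<lambda>u. S (S u))" by (rule bounded_linear_compose[OF bounded_linear_S bounded_linear_S])
  have cg: "continuous_on {0..} g" by (rule continuous_on_vector_derivative[OF g]) simp
  have cw: "continuous_on {0..} w" by (rule wave_cont[OF w])
  have cw': "continuous_on {0..} w'" by (rule wave_deriv_cont[OF w])
  have hv: "half (v t) = S (g t - w' t)" and vH: "v t \<in> H1" for t by (simp_all add: v_def half_S)
  \<comment> \<open>Testing the equation with \<open>S (S \<phi>)\<close> turns the elastic term
    into \<open>w s \<bullet> \<phi>\<close>, so this function is differentiable although
    \<open>w'\<close> need not be.\<close>
  have "((\<lambda>t. S (S (w' t))) has_vector_derivative S (S (f t)) - w t) (at t within {0..})" if "t \<ge> 0" for t
  proof (rule has_vector_derivative_weakI[OF _ _ that])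
    show "continuous_on {0..} (\<lambda>t. S (S (f t)) - w t)"
      by (intro continuous_intros cw bounded_linear.continuous_on[OF bounded_linear_S] f)
    show "((\<lambda>\<tau>. (S (S (f \<tau>)) - w \<tau>) \<bullet> \<phi>) has_integral (S (S (w' t)) - S (S (w' 0))) \<bullet> \<phi>) {0..t}"
      if "t \<ge> 0" for t \<phi>
    proof -
      have "((\<lambda>s. f s \<bullet> S (S \<phi>) - half (w s) \<bullet> half (S (S \<phi>))) has_integral w' t \<bullet> S (S \<phi>) - w' 0 \<bullet> S (S \<phi>)) {0..t}"
        by (rule wave_weak0[OF w half_S(1)]) (use that in simp)
      moreover have "half (w s) \<bullet> half (S (S \<phi>)) = w s \<bullet> \<phi>" if "s \<in> {0..t}" for s
        using wave_H1[OF w, of s] that by (simp add: half_S S_sym[symmetric] S_half)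
      ultimately have "((\<lambda>s. (S (S (f s)) - w s) \<bullet> \<phi>) has_integral w' t \<bullet> S (S \<phi>) - w' 0 \<bullet> S (S \<phi>)) {0..t}"
        by (elim has_integral_eq[rotated]) (simp add: inner_diff_left S_sym)
      then show ?thesis by (simp add: inner_diff_left S_sym)
    qed
  qed
  then have dv: "(v has_vector_derivative w t) (at t within {0..})" if "t \<ge> 0" for t
  proof -
    have "((\<lambda>t. S (S (g t)) - S (S (w' t))) has_vector_derivative S (S (f t)) - (S (S (f t)) - w t)) (at t within {0..})"
      using that \<open>\<And>t. t \<ge> 0 \<Longrightarrow> ((\<lambda>t. S (S (w' t))) has_vector_derivative S (S (f t)) - w t) (at t within {0..})\<close>
      by (intro has_vector_derivative_diff bounded_linear.has_vector_derivative[OF SS] g) auto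
    then show ?thesis
      by (simp add: v_def[abs_def] linear_diff[OF bounded_linear.linear[OF bounded_linear_S]])
  qed
  have "wave_solution D A {0..} g v w"
    unfolding wave_solution_alt
  proof (intro conjI ballI)
    show "continuous_on {0..} (\<lambda>t. half (v t))"
      unfolding hv by (intro bounded_linear.continuous_on[OF bounded_linear_S] continuous_intros cg cw')
    show "((\<lambda>s. g s \<bullet> \<phi> - half (v s) \<bullet> half \<phi>) has_integral w t \<bullet> \<phi> - w 0 \<bullet> \<phi>) {0..t}"
      if \<phi>: "\<phi> \<in> H1" and t: "t \<in> {0..}" for \<phi> t
    proof -
      have "((\<lambda>t. w t \<bullet> \<phi>) has_vector_derivative w' s \<bullet> \<phi>) (at s within {0..t})" if "s \<in> {0..t}" for s
        using has_vector_derivative_within_subset[OF wave_deriv[OF w], of s "{0..t}"] that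
        by (intro bounded_linear.has_vector_derivative[OF bounded_linear_inner_left]) auto
      from fundamental_theorem_of_calculus[OF _ this] t
      have "((\<lambda>s. w' s \<bullet> \<phi>) has_integral w t \<bullet> \<phi> - w 0 \<bullet> \<phi>) {0..t}" by simp
      moreover have "g s \<bullet> \<phi> - half (v s) \<bullet> half \<phi> = w' s \<bullet> \<phi>" for s
        by (simp add: hv S_sym S_half[OF \<phi>] inner_diff_left)
      ultimately show ?thesis by simp
    qed
  qed (use vH dv cw in auto)
  then show ?thesis by (simp add: v_def[abs_def])
qed

section \<open>Time shifts and spectral cutoffs\<close>

lemma wave_solution_translate:
  assumes w: "wave_solution D A {0..T} f w w'" and a: "0 \<le> a" "a + T' \<le> T"
  shows "wave_solution D A {0..T'} (\<lambda>t. f (a + t)) (\<lambda>t. w (a + t)) (\<lambda>t. w' (a + t))"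
  unfolding wave_solution_alt
proof (intro conjI ballI)
  have im: "(\<lambda>t. a + t) ` {0..T'} \<subseteq> {0..T}" using a by auto
  show "w (a + t) \<in> H1" if "t \<in> {0..T'}" for t using wave_H1[OF w] im that by auto
  show "continuous_on {0..T'} (\<lambda>t. half (w (a + t)))"
    by (rule continuous_on_compose2[OF wave_half_cont[OF w] _ im]) (intro continuous_intros)
  show "continuous_on {0..T'} (\<lambda>t. w' (a + t))"
    by (rule continuous_on_compose2[OF wave_deriv_cont[OF w] _ im]) (intro continuous_intros)
  show "((\<lambda>t. w (a + t)) has_vector_derivative w' (a + t)) (at t within {0..T'})" if "t \<in> {0..T'}" for t
  proof -
    have "((w \<circ> (\<lambda>t. a + t)) has_vector_derivative 1 *\<^sub>R w' (a + t)) (at t within {0..T'})"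
    proof (rule vector_diff_chain_within)
      show "((\<lambda>t. a + t) has_vector_derivative 1) (at t within {0..T'})"
        by (auto intro!: derivative_eq_intros)
      show "(w has_vector_derivative w' (a + t)) (at (a + t) within (\<lambda>t. a + t) ` {0..T'})"
        using im that by (intro has_vector_derivative_within_subset[OF wave_deriv[OF w] im]) auto
    qed
    then show ?thesis by (simp add: o_def)
  qed
  show "((\<lambda>s. f (a + s) \<bullet> \<phi> - half (w (a + s)) \<bullet> half \<phi>) has_integral w' (a + t) \<bullet> \<phi> - w' (a + 0) \<bullet> \<phi>) {0..t}"
    if "\<phi> \<in> H1" "t \<in> {0..T'}" for \<phi> t
    using wave_weak[OF w that(1), of a "a + t"] that(2) a
      has_integral_shift_Icc_real[of "\<lambda>\<tau>. f \<tau> \<bullet> \<phi> - half (w \<tau>) \<bullet> half \<phi>" a _ 0 t]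
    by (simp add: o_def inner_diff_left add.commute)
qed

text \<open>Spectral cutoff. It maps the whole space into every power domain and commutes with the
  equation, so it makes solutions of energy regularity regular and turns arbitrary vectors into test
  vectors.\<close>

definition Q :: "nat \<Rightarrow> 'h \<Rightarrow> 'h" where "Q N = fc (\<lambda>l. if l \<le> real N then 1 else 0)"

lemma bounded_linear_Q: "bounded_linear (Q N)" and norm_Q_le: "norm (Q N u) \<le> norm u"
  using bounded_linear_fc[of "\<lambda>l. if l \<le> real N then 1 else 0" 1]
    fc_bounded(2)[of "\<lambda>l. if l \<le> real N then 1 else 0" 1 u] by (simp_all add: Q_def)

lemma Q_dom: "u \<in> fdom (\<lambda>l. if l \<le> real N then 1 else 0)"
  by (rule fc_bounded(1)[where c = 1]) simp

lemma Q_sym: "Q N u \<bullet> v = u \<bullet> Q N v"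
  unfolding Q_def by (intro fc_sym Q_dom)

lemma Q_tendsto: "(\<lambda>N. Q N u) \<longlonglongrightarrow> u"
proof -
  have "(\<lambda>N. fc (\<lambda>l. if l \<le> real N then 1 else 0) u) \<longlonglongrightarrow> fc (\<lambda>l. 1) u"
  proof (rule fc_tendsto[where c = 1])
    fix l :: real
    have "\<forall>\<^sub>F N in sequentially. (if l \<le> real N then 1 else 0) = (1 :: real)"
      using eventually_ge_at_top[of "nat \<lceil>l\<rceil>"] by eventually_elim (simp add: nat_le_iff ceiling_le_iff)
    then show "(\<lambda>N. if l \<le> real N then 1 else 0) \<longlonglongrightarrow> (1 :: real)"
      by (rule tendsto_eventually)
  qed auto
  then show ?thesis by (simp add: Q_def fc_one)
qed

lemma Q_pow_dom: "Q N u \<in> pow_dom D A s"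
  and op_pow_Q: "op_pow D A s (Q N u) = fc (\<lambda>l. if l \<le> real N then l powr s else 0) u"
  and op_pow_Q_bounded: "bounded_linear (\<lambda>u. op_pow D A s (Q N u))"
proof -
  \<comment> \<open>The part of the spectrum in question lies between \<open>\<omega>\<close> and
    \<open>N\<close>. Which end dominates depends on the sign of \<open>s\<close>; the sum covers
    both.\<close>
  have "l powr s \<le> \<omega> powr s + real N powr s" if "l \<in> \<sigma>" "l \<le> real N" for l
  proof (cases "s \<le> 0")
    case True
    then have "l powr s \<le> \<omega> powr s" using powr_mono2'[of s \<omega> l] \<sigma>_ge[OF that(1)] \<omega>_pos by auto
    then show ?thesis using powr_ge_zero[of "real N" s] by linarith
  next
    case False
    then have "l powr s \<le> real N powr s" using powr_mono2[of s l "real N"] \<sigma>_pos[OF that(1)] that by auto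
    then show ?thesis using powr_ge_zero[of \<omega> s] by linarith
  qed
  then have b: "\<bar>if l \<le> real N then l powr s else 0\<bar> \<le> \<omega> powr s + real N powr s" if "l \<in> \<sigma>" for l
    using that by auto
  have e: "(\<lambda>l. l powr s * (if l \<le> real N then 1 else 0)) = (\<lambda>l. if l \<le> real N then l powr s else 0)"
    by auto
  have d: "u \<in> fdom (\<lambda>l. if l \<le> real N then l powr s else 0)" for u by (rule fc_bounded(1)) (rule b)
  have p: "Q N u \<in> pow_dom D A s" for u
    using fc_fc(1)[OF Q_dom[of u N], of "\<lambda>l. l powr s"] d[of u] unfolding e by (simp add: pow_dom_eq_fdom Q_def)
  have q: "op_pow D A s (Q N u) = fc (\<lambda>l. if l \<le> real N then l powr s else 0) u" for u
    using fc_fc(2)[OF Q_dom[of u N], of "\<lambda>l. l powr s"] p[of u] unfolding e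
    by (simp add: pow_dom_eq_fdom op_pow_eq_fc Q_def)
  show "Q N u \<in> pow_dom D A s"
    "op_pow D A s (Q N u) = fc (\<lambda>l. if l \<le> real N then l powr s else 0) u"
    "bounded_linear (\<lambda>u. op_pow D A s (Q N u))"
    using p q bounded_linear_fc[OF b] by simp_all
qed

lemma half_Q: "u \<in> H1 \<Longrightarrow> half (Q N u) = Q N (half u)"
  unfolding op_pow_Q unfolding Q_def
  by (rule fcI(2)) (simp add: P_fc[OF Q_dom] P_half)

lemma wave_solution_Q:
  assumes w: "wave_solution D A I f w w'" and I: "\<And>t. t \<in> I \<Longrightarrow> {0..t} \<subseteq> I"
  shows "wave_solution D A I (\<lambda>t. Q N (f t)) (\<lambda>t. Q N (w t)) (\<lambda>t. Q N (w' t))"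
  unfolding wave_solution_alt
proof (intro conjI ballI)
  show "continuous_on I (\<lambda>t. half (Q N (w t)))"
    by (rule bounded_linear.continuous_on[OF op_pow_Q_bounded wave_cont[OF w]])
  show "((\<lambda>t. Q N (w t)) has_vector_derivative Q N (w' t)) (at t within I)" if "t \<in> I" for t
    by (rule bounded_linear.has_vector_derivative[OF bounded_linear_Q wave_deriv[OF w that]])
  show "continuous_on I (\<lambda>t. Q N (w' t))"
    by (rule bounded_linear.continuous_on[OF bounded_linear_Q wave_deriv_cont[OF w]])
  fix \<phi> t assume \<phi>: "\<phi> \<in> H1" and t: "t \<in> I"
  have "((\<lambda>s. f s \<bullet> Q N \<phi> - half (w s) \<bullet> half (Q N \<phi>)) has_integral w' t \<bullet> Q N \<phi> - w' 0 \<bullet> Q N \<phi>) {0..t}"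
    by (rule wave_weak0[OF w Q_pow_dom t])
  then have "((\<lambda>s. Q N (f s) \<bullet> \<phi> - half (Q N (w s)) \<bullet> half \<phi>) has_integral w' t \<bullet> Q N \<phi> - w' 0 \<bullet> Q N \<phi>) {0..t}"
    by (rule has_integral_eq[rotated])
       (use I[OF t] wave_H1[OF w] in \<open>auto simp: half_Q \<phi> Q_sym subset_iff\<close>)
  then show "((\<lambda>s. Q N (f s) \<bullet> \<phi> - half (Q N (w s)) \<bullet> half \<phi>) has_integral Q N (w' t) \<bullet> \<phi> - Q N (w' 0) \<bullet> \<phi>) {0..t}"
    by (simp add: Q_sym)
qed (rule Q_pow_dom)

end

section \<open>Square integrable functions\<close>

lemma negligible_if_AE:
  fixes S :: "real set"
  assumes "AE x in lebesgue_on S. Pr x" and S: "S \<in> sets lebesgue"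
  obtains N where "negligible N" "\<And>x. x \<in> S \<Longrightarrow> x \<notin> N \<Longrightarrow> Pr x"
proof -
  have "AE x in lebesgue. x \<in> S \<longrightarrow> Pr x"
    using assms by (subst (asm) AE_restrict_space_iff) auto
  then obtain N where "N \<in> null_sets lebesgue" "{x \<in> space lebesgue. \<not> (x \<in> S \<longrightarrow> Pr x)} \<subseteq> N"
    unfolding eventually_ae_filter by blast
  then show thesis using that[of N] by (auto simp: negligible_iff_null_sets)
qed

text \<open>Lebesgue differentiation: outside a null set, \<open>h\<close> is the limit of
  difference quotients of its primitive.\<close>

lemma zero_if_primitive_zero:
  fixes h :: "real \<Rightarrow> real"
  assumes h: "h integrable_on {0..T}" and zero: "\<And>t. t \<in> {0..T} \<Longrightarrow> integral {0..t} h = 0"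
  obtains N where "negligible N" "\<And>t. t \<in> {0..T} \<Longrightarrow> t \<notin> N \<Longrightarrow> h t = 0"
proof -
  define f where "f t = (if t \<in> {0..T} then h t else 0)" for t
  have fU: "f integrable_on UNIV"
    unfolding f_def using h integrable_restrict_UNIV[of "{0..T}" h] by blast
  have "f integrable_on cbox a b" for a b
    using integrable_on_subcbox[OF fU, of a b] by auto
  from integrable_ccontinuous_explicit[OF this] obtain N where N: "negligible N"
    and lim: "\<And>x e. x \<notin> N \<Longrightarrow> 0 < e \<Longrightarrow> \<exists>d>0. \<forall>k. 0 < k \<and> k < d \<longrightarrow>
        norm (integral (cbox x (x + k *\<^sub>R One)) f /\<^sub>R k ^ DIM(real) - f x) < e" by metis
  \<comment> \<open>The difference quotients go to the right and would leave the interval at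
    \<open>T\<close>, so this point joins the null set.\<close>
  have "h t = 0" if t: "t \<in> {0..T}" "t \<notin> insert T N" for t
  proof (rule ccontr)
    assume "h t \<noteq> 0"
    then have "0 < \<bar>h t\<bar>" by simp
    then obtain d where d: "d > 0" and D: "\<And>k. 0 < k \<Longrightarrow> k < d \<Longrightarrow>
        norm (integral (cbox t (t + k *\<^sub>R One)) f /\<^sub>R k ^ DIM(real) - f t) < \<bar>h t\<bar>"
      using lim[of t "\<bar>h t\<bar>"] t by blast
    define k where "k = min (d / 2) (T - t)"
    have k: "0 < k" "k < d" "t + k \<le> T" using d t by (auto simp: k_def)
    have tk: "integral {t..t + k} h = 0"
    proof -
      have "integral {0..t} h + integral {t..t + k} h = integral {0..t + k} h"
        by (rule Henstock_Kurzweil_Integration.integral_combine)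
           (use t k integrable_subinterval_real[OF h, of 0 "t + k"] in auto)
      then show ?thesis using zero[of t] zero[of "t + k"] t k by simp
    qed
    have "integral {t..t + k} f = integral {t..t + k} h"
      by (rule integral_cong) (use t k in \<open>auto simp: f_def\<close>)
    then have "norm (0 - f t) < \<bar>h t\<bar>" using D[OF k(1,2)] tk by simp
    then show False using t by (simp add: f_def)
  qed
  moreover have "negligible (insert T N)" using N by (simp add: negligible_insert)
  ultimately show thesis using that by blast
qed

text \<open>Subtraction is continuous, and an open subset of the product is a countable union of
  boxes with centres in \<open>X\<close> and radii \<open>1 / Suc n\<close>. The preimage of a box
  is an intersection of two measurable sets.\<close>

lemma borel_measurable_diff_separable:
  fixes f g :: "'a \<Rightarrow> 'b::real_normed_vector"
  assumes X: "countable X" "closure X = (UNIV :: 'b set)"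
    and f: "f \<in> borel_measurable M" and g: "g \<in> borel_measurable M"
  shows "(\<lambda>x. f x - g x) \<in> borel_measurable M"
proof (rule borel_measurableI)
  fix U :: "'b set" assume U: "open U"
  define W :: "('b \<times> 'b) set" where "W = {(u, v). u - v \<in> U}"
  have "open ((\<lambda>p :: 'b \<times> 'b. fst p - snd p) -` U)"
    by (rule open_vimage[OF U]) (intro continuous_intros)
  moreover have "W = (\<lambda>p. fst p - snd p) -` U" by (auto simp: W_def)
  ultimately have W: "open W" by simp
  define J :: "('b \<times> 'b \<times> nat) set" where "J = {(a, b, n) \<in> X \<times> X \<times> UNIV. ball a (1 / real (Suc n)) \<times> ball b (1 / real (Suc n)) \<subseteq> W}"
  have cJ: "countable J"
    by (rule countable_subset[of _ "X \<times> X \<times> UNIV"]) (use X in \<open>auto simp: J_def\<close>)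
  have "(\<lambda>x. f x - g x) -` U \<inter> space M
      = (\<Union>(a, b, n)\<in>J. (f -` ball a (1 / real (Suc n)) \<inter> space M) \<inter> (g -` ball b (1 / real (Suc n)) \<inter> space M))"
    (is "?L = ?R")
  proof
    show "?R \<subseteq> ?L" by (force simp: J_def W_def)
    show "?L \<subseteq> ?R"
    proof
      fix x assume x: "x \<in> ?L"
      then have "(f x, g x) \<in> W" by (simp add: W_def)
      then obtain e where e: "e > 0" and sub: "ball (f x, g x) e \<subseteq> W" using W open_contains_ball by blast
      \<comment> \<open>Points of the box differ from \<open>f x\<close> and \<open>g x\<close> by
        less than two radii each, so a radius below \<open>e / 4\<close> keeps the box in the
        ball.\<close>
      obtain n where n: "1 / real (Suc n) < e / 4" using e nat_approx_posE[of "e / 4"] by auto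
      define r where "r = 1 / real (Suc n)"
      have r: "r > 0" "r < e / 4" using n by (auto simp: r_def)
      obtain a where a: "a \<in> X" "dist a (f x) < r"
        using X(2) r closure_approachable[of "f x" X] by auto
      obtain b where b: "b \<in> X" "dist b (g x) < r"
        using X(2) r closure_approachable[of "g x" X] by auto
      have "ball a r \<times> ball b r \<subseteq> W"
      proof (rule subset_trans[OF _ sub], clarify)
        fix u v assume uv: "u \<in> ball a r" "v \<in> ball b r"
        have "dist (f x, g x) (u, v) \<le> dist (f x) u + dist (g x) v"
          unfolding dist_prod_def by (simp add: sqrt_sum_squares_le_sum)
        also have "\<dots> \<le> (dist a (f x) + dist a u) + (dist b (g x) + dist b v)"
          by (intro add_mono dist_triangle3)
        also have "\<dots> < e" using a b uv r by (simp add: dist_commute)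
        finally show "(u, v) \<in> ball (f x, g x) e" by simp
      qed
      then have "(a, b, n) \<in> J" using a b by (simp add: J_def r_def)
      moreover have "f x \<in> ball a r" "g x \<in> ball b r" using a b by simp_all
      ultimately show "x \<in> ?R" using x unfolding r_def by blast
    qed
  qed
  also have "\<dots> \<in> sets M"
    by (rule sets.countable_UN'[OF cJ]) (auto intro!: sets.Int measurable_sets[OF f] measurable_sets[OF g])
  finally show "(\<lambda>x. f x - g x) -` U \<inter> space M \<in> sets M" .
qed

section \<open>Quadratic estimates and completeness of the space of square integrable
  functions\<close>

lemma norm_square_add_le:
  fixes x y :: "'a::real_normed_vector"
  shows "(norm (x + y))\<^sup>2 \<le> 2 * (norm x)\<^sup>2 + 2 * (norm y)\<^sup>2"
proof -
  have "(norm (x + y))\<^sup>2 \<le> (norm x + norm y)\<^sup>2" by (intro power_mono norm_triangle_ineq) simp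
  also have "\<dots> \<le> 2 * (norm x)\<^sup>2 + 2 * (norm y)\<^sup>2"
    using zero_le_power2[of "norm x - norm y"] by (simp add: power2_eq_square algebra_simps)
  finally show ?thesis .
qed

lemma norm_square_diff_le:
  fixes x y :: "'a::real_normed_vector"
  shows "(norm x)\<^sup>2 \<le> 2 * (norm (x - y))\<^sup>2 + 2 * (norm y)\<^sup>2"
  using norm_square_add_le[of "x - y" y] by simp

lemma integral_norm_square_diff_le:
  fixes f g :: "real \<Rightarrow> 'a::real_normed_vector"
  assumes "(\<lambda>t. (norm (f t))\<^sup>2) integrable_on I" "(\<lambda>t. (norm (g t))\<^sup>2) integrable_on I"
    "(\<lambda>t. (norm (f t - g t))\<^sup>2) integrable_on I"
  shows "integral I (\<lambda>t. (norm (f t))\<^sup>2)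
     \<le> 2 * integral I (\<lambda>t. (norm (f t - g t))\<^sup>2) + 2 * integral I (\<lambda>t. (norm (g t))\<^sup>2)"
proof -
  have "integral I (\<lambda>t. (norm (f t))\<^sup>2)
     \<le> integral I (\<lambda>t. 2 * (norm (f t - g t))\<^sup>2 + 2 * (norm (g t))\<^sup>2)"
    by (intro integral_le integrable_add integrable_on_mult_right assms norm_square_diff_le)
  also have "\<dots> = 2 * integral I (\<lambda>t. (norm (f t - g t))\<^sup>2) + 2 * integral I (\<lambda>t. (norm (g t))\<^sup>2)"
    by (subst integral_add) (auto intro!: integrable_on_mult_right assms)
  finally show ?thesis .
qed

text \<open>The integral of the square of \<open>h\<close> minus its mean is nonnegative; expanding
  it gives the constant \<open>b - a\<close>.\<close>

lemma integral_square_le: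
  fixes h :: "real \<Rightarrow> real"
  assumes ab: "a \<le> b" and h: "h integrable_on {a..b}" and h2: "(\<lambda>t. (h t)\<^sup>2) integrable_on {a..b}"
  shows "(integral {a..b} h)\<^sup>2 \<le> (b - a) * integral {a..b} (\<lambda>t. (h t)\<^sup>2)"
proof (cases "a = b")
  case False
  then have pos: "b - a > 0" using ab by simp
  define c where "c = integral {a..b} h / (b - a)"
  have "((\<lambda>t. (h t)\<^sup>2 - 2 * c * h t + c\<^sup>2) has_integral
      integral {a..b} (\<lambda>t. (h t)\<^sup>2) - 2 * c * integral {a..b} h + (b - a) * c\<^sup>2) {a..b}"
    using has_integral_const_real[of "c\<^sup>2" a b] ab
    by (intro has_integral_add has_integral_diff has_integral_mult_right integrable_integral h h2) simp
  moreover have "0 \<le> (h t)\<^sup>2 - 2 * c * h t + c\<^sup>2" for t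
    using zero_le_power2[of "h t - c"] by (simp add: power2_eq_square algebra_simps)
  ultimately have "0 \<le> integral {a..b} (\<lambda>t. (h t)\<^sup>2) - 2 * c * integral {a..b} h + (b - a) * c\<^sup>2"
    by (rule has_integral_nonneg)
  also have "\<dots> = integral {a..b} (\<lambda>t. (h t)\<^sup>2) - (integral {a..b} h)\<^sup>2 / (b - a)"
  proof -
    have c: "integral {a..b} h = c * (b - a)" using pos by (simp add: c_def)
    show ?thesis unfolding c using pos by (simp add: power2_eq_square)
  qed
  finally show ?thesis using pos by (simp add: field_simps)
qed simp

lemma L2_on_continuous:
  fixes f :: "real \<Rightarrow> 'a::real_normed_vector"
  assumes "continuous_on {0..T} f"
  shows "L2_on T f"
  unfolding L2_on_def
  by (intro conjI continuous_imp_measurable_on_sets_lebesgue integrable_continuous_real continuous_intros assms) auto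

lemma norm_measurable:
  fixes f :: "real \<Rightarrow> 'a::real_normed_vector"
  shows "f \<in> borel_measurable M \<Longrightarrow> (\<lambda>t. norm (f t)) \<in> borel_measurable M"
  by measurable

lemma norm_integrable_if_square:
  fixes f :: "real \<Rightarrow> 'a::real_normed_vector"
  assumes "f \<in> borel_measurable (lebesgue_on {a..b})" "(\<lambda>t. (norm (f t))\<^sup>2) integrable_on {a..b}"
  shows "(\<lambda>t. norm (f t)) integrable_on {a..b}"
proof (rule measurable_bounded_by_integrable_imp_integrable[where g = "\<lambda>t. 1 + (norm (f t))\<^sup>2"])
  show "(\<lambda>t. 1 + (norm (f t))\<^sup>2) integrable_on {a..b}"
    by (intro integrable_add assms) auto
  show "norm (norm (f t)) \<le> 1 + (norm (f t))\<^sup>2" for t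
    using zero_le_power2[of "norm (f t) - 1"] norm_ge_zero[of "f t"]
    by (simp add: power2_eq_square algebra_simps del: norm_ge_zero)
qed (use assms norm_measurable in auto)

lemma L2_on_norm_integrable: "L2_on T f \<Longrightarrow> (\<lambda>t. norm (f t)) integrable_on {0..T}"
  by (rule norm_integrable_if_square) (auto simp: L2_on_def)

text \<open>The majorant \<open>\<Phi> = (\<Sum>j. 2\<^sup>j |g\<^sub>j\<^sub>+\<^sub>1 - g\<^sub>j|\<^sup>2)\<close> is integrable, and
  \<open>|g\<^sub>n - g\<^sub>k|\<^sup>2 \<le> 2\<^sup>1\<^sup>-\<^sup>k \<Phi>\<close> for \<open>n \<ge> k\<close> by Cauchy--Schwarz.\<close>

theorem L2_limit_exists:
  fixes g :: "nat \<Rightarrow> real \<Rightarrow> 'a::{real_normed_vector,complete_space}"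
  assumes T: "0 \<le> T" and cont: "\<And>k. continuous_on {0..T} (g k)"
    and fast: "\<And>k. integral {0..T} (\<lambda>t. (norm (g (Suc k) t - g k t))\<^sup>2) \<le> (1/4) ^ k"
  shows "\<exists>h. L2_on T h \<and> L2_tendsto T g h"
proof -
  define M where "M = lebesgue_on {0..T}"
  define d where "d j t = (norm (g (Suc j) t - g j t))\<^sup>2" for j t
  \<comment> \<open>The weight gives up half of the exponent in \<open>(1/4) ^ j\<close>: the
    weighted integrals still sum, and the reciprocal weights are available for the pointwise
    estimate.\<close>
  define p where "p j t = 2 ^ j * d j t" for j t
  have p0: "0 \<le> p j t" for j t by (simp add: p_def d_def)
  have pc: "continuous_on {0..T} (p j)" for j
    unfolding p_def d_def by (intro continuous_intros cont)
  have pM: "integrable M (p j)" for j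
    unfolding M_def by (rule continuous_imp_integrable_real[OF pc])
  have pI: "integral\<^sup>L M (p j) \<le> (1/2) ^ j" for j
  proof -
    have "integral\<^sup>L M (p j) = integral {0..T} (p j)"
      unfolding M_def by (rule lebesgue_integral_eq_integral) (use pM in \<open>auto simp: M_def\<close>)
    also have "\<dots> = 2 ^ j * integral {0..T} (d j)" unfolding p_def by simp
    also have "\<dots> \<le> 2 ^ j * (1/4) ^ j" using fast[of j] by (simp add: d_def[abs_def])
    also have "\<dots> = (1/2) ^ j" by (simp flip: power_mult_distrib)
    finally show ?thesis .
  qed
  have pI0: "0 \<le> integral\<^sup>L M (p j)" for j by (rule integral_nonneg_AE) (simp add: p0)
  have "(\<integral>\<^sup>+t. (\<Sum>j. ennreal (p j t)) \<partial>M) = (\<Sum>j. \<integral>\<^sup>+t. ennreal (p j t) \<partial>M)"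
    using borel_measurable_integrable[OF pM] by (intro nn_integral_suminf) auto
  also have "\<dots> = (\<Sum>j. ennreal (integral\<^sup>L M (p j)))"
    by (simp add: nn_integral_eq_integral[OF pM] p0)
  also have "\<dots> \<le> (\<Sum>j. ennreal ((1/2) ^ j))" by (intro suminf_le ennreal_leI pI) auto
  also have "\<dots> = ennreal (\<Sum>j. (1/2) ^ j)"
    by (intro suminf_ennreal2) (auto intro: summable_geometric)
  also have "\<dots> < \<infinity>" by simp
  finally have "AE t in M. (\<Sum>j. ennreal (p j t)) \<noteq> \<infinity>"
    using borel_measurable_integrable[OF pM] by (intro nn_integral_PInf_AE) auto
  then have AEs: "AE t in M. summable (\<lambda>j. p j t)"
    by eventually_elim (use p0 in \<open>auto intro: summable_suminf_not_top\<close>)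
  then obtain N where N: "negligible N" and sm: "\<And>t. t \<in> {0..T} \<Longrightarrow> t \<notin> N \<Longrightarrow> summable (\<lambda>j. p j t)"
    unfolding M_def by (rule negligible_if_AE) auto
  have "integrable M (\<lambda>t. \<Sum>j. p j t)"
  proof (rule integrable_suminf[OF pM])
    show "AE t in M. summable (\<lambda>j. norm (p j t))" using AEs by eventually_elim (simp add: p0)
    show "summable (\<lambda>j. \<integral>t. norm (p j t) \<partial>M)"
      by (rule summable_comparison_test'[of "\<lambda>j. (1/2) ^ j" 0]) (auto simp: p0 pI pI0 intro: summable_geometric)
  qed
  then have \<Phi>0: "(\<lambda>t. \<Sum>j. p j t) integrable_on {0..T}"
    unfolding M_def by (rule integrable_on_lebesgue_on) simp
  define \<Phi> where "\<Phi> t = (if t \<in> N then 0 else \<Sum>j. p j t)" for t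
  have \<Phi>: "\<Phi> integrable_on {0..T}" by (rule integrable_spike[OF \<Phi>0 N]) (simp add: \<Phi>_def)
  \<comment> \<open>With the value 0 on the exceptional null set, the sequence converges at every
    point of the interval, so its limit is measurable.\<close>
  define g' where "g' k t = (if t \<in> N then 0 else g k t)" for k t
  have geo: "(\<Sum>j=k..<n. (1/2 :: real) ^ j) \<le> 2 * (1/2) ^ k" for k n
  proof -
    \<comment> \<open>The added term is the remaining tail of the geometric series; it makes the
      bound inductive.\<close>
    have "(\<Sum>j=k..<n. (1/2 :: real) ^ j) + 2 * (1/2) ^ n \<le> 2 * (1/2) ^ k" if "k \<le> n"
      using that by (induction n rule: dec_induct) auto
    then show ?thesis
      by (cases "k \<le> n") (auto intro: order_trans[of _ "(\<Sum>j=k..<n. (1/2 :: real) ^ j) + 2 * (1/2) ^ n"])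
  qed
  have close: "(norm (g' n t - g' k t))\<^sup>2 \<le> 2 * (1/2) ^ k * \<Phi> t" if t: "t \<in> {0..T}" and kn: "k \<le> n" for t k n
  proof (cases "t \<in> N")
    case False
    have "g n t - g k t = (\<Sum>j=k..<n. g (Suc j) t - g j t)" using sum_Suc_diff'[OF kn, of "\<lambda>j. g j t"] by simp
    then have "norm (g n t - g k t) \<le> (\<Sum>j=k..<n. sqrt ((1/2) ^ j) * sqrt (p j t))"
    proof -
      have "sqrt ((1/2) ^ j) * sqrt (p j t) = norm (g (Suc j) t - g j t)" for j
      proof -
        have "sqrt ((1/2) ^ j) * sqrt (p j t) = sqrt (((1/2) ^ j * 2 ^ j) * d j t)"
          by (simp add: p_def real_sqrt_mult)
        also have "(1/2 :: real) ^ j * 2 ^ j = 1" by (simp flip: power_mult_distrib)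
        finally show ?thesis by (simp add: d_def)
      qed
      then show ?thesis using \<open>g n t - g k t = _\<close> by (simp add: norm_sum)
    qed
    then have "(norm (g n t - g k t))\<^sup>2 \<le> (\<Sum>j=k..<n. sqrt ((1/2) ^ j) * sqrt (p j t))\<^sup>2"
      by (intro power_mono) auto
    also have "\<dots> \<le> (\<Sum>j=k..<n. (sqrt ((1/2) ^ j))\<^sup>2) * (\<Sum>j=k..<n. (sqrt (p j t))\<^sup>2)"
      by (rule Cauchy_Schwarz_ineq_sum)
    also have "\<dots> = (\<Sum>j=k..<n. (1/2) ^ j) * (\<Sum>j=k..<n. p j t)" by (simp add: p0)
    also have "\<dots> \<le> (2 * (1/2) ^ k) * (\<Sum>j. p j t)"
    proof (rule mult_mono[OF geo])
      show "(\<Sum>j=k..<n. p j t) \<le> (\<Sum>j. p j t)"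
        by (rule sum_le_suminf[OF sm[OF t False]]) (auto simp: p0)
    qed (auto intro: sum_nonneg p0)
    finally show ?thesis using False by (simp add: g'_def \<Phi>_def)
  qed (simp add: g'_def \<Phi>_def)
  have conv: "convergent (\<lambda>n. g' n t)" if t: "t \<in> {0..T}" for t
  proof -
    have "Cauchy (\<lambda>n. g' n t)"
    proof (rule metric_CauchyI)
      fix e :: real assume e: "e > 0"
      have "(\<lambda>k. 2 * (1/2) ^ k * \<Phi> t) \<longlonglongrightarrow> 2 * 0 * \<Phi> t"
        by (intro tendsto_intros LIMSEQ_realpow_zero) auto
      then have "\<forall>\<^sub>F k in sequentially. 2 * (1/2) ^ k * \<Phi> t < (e/2)\<^sup>2"
        using e by (intro order_tendstoD(2)) auto
      then obtain k where k: "2 * (1/2) ^ k * \<Phi> t < (e/2)\<^sup>2" by (auto simp: eventually_sequentially)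
      have "norm (g' n t - g' k t) < e / 2" if "k \<le> n" for n
        by (rule power2_less_imp_less) (use close[OF t that] k e in auto)
      then have "dist (g' m t) (g' n t) < e" if "k \<le> m" "k \<le> n" for m n
        using that by (metis dist_norm dist_triangle_half_l norm_minus_commute)
      then show "\<exists>M. \<forall>m\<ge>M. \<forall>n\<ge>M. dist (g' m t) (g' n t) < e" by blast
    qed
    then show ?thesis by (simp add: Cauchy_convergent_iff)
  qed
  define h where "h t = (if t \<in> {0..T} then lim (\<lambda>n. g' n t) else 0)" for t
  have h: "(\<lambda>n. g' n t) \<longlonglongrightarrow> h t" if "t \<in> {0..T}" for t
    using conv[OF that] that by (simp add: h_def convergent_LIMSEQ_iff)
  have gM: "g k \<in> borel_measurable M" for k
    unfolding M_def by (rule continuous_imp_measurable_on_sets_lebesgue[OF cont]) simp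
  have NM: "N \<inter> {0..T} \<in> sets M"
  proof -
    have "N \<in> sets lebesgue" using N by (auto simp: negligible_iff_null_sets)
    then show ?thesis unfolding M_def by (auto simp: sets_restrict_space)
  qed
  have g'M: "g' k \<in> borel_measurable M" for k
  proof -
    have "(\<lambda>t. if t \<in> N \<inter> {0..T} then 0 else g k t) \<in> borel_measurable M"
      using NM gM by (intro measurable_If_set) (auto simp: M_def space_restrict_space Int_absorb2)
    then show ?thesis
      by (rule measurable_cong[THEN iffD1, rotated]) (auto simp: M_def g'_def space_restrict_space)
  qed
  have hM: "h \<in> borel_measurable M"
    by (rule borel_measurable_LIMSEQ_metric[of g', OF g'M]) (use h in \<open>auto simp: M_def space_restrict_space\<close>)
  have spike: "(\<lambda>t. F (g' k t) t) integrable_on {0..T}" "integral {0..T} (\<lambda>t. F (g' k t) t) = integral {0..T} (\<lambda>t. F (g k t) t)"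
    if "(\<lambda>t. F (g k t) t) integrable_on {0..T}" for F :: "'a \<Rightarrow> real \<Rightarrow> real" and k
    by (rule integrable_spike[OF that N], simp add: g'_def) (rule integral_spike[OF N], simp add: g'_def)
  have i2: "(\<lambda>t. (norm (g' n t))\<^sup>2) integrable_on {0..T}" for n
    by (rule spike(1)) (intro integrable_continuous_real continuous_intros cont)
  have id: "(\<lambda>t. (norm (g' n t - g' k t))\<^sup>2) integrable_on {0..T}" for n k
    by (rule integrable_spike[OF _ N, of "\<lambda>t. (norm (g n t - g k t))\<^sup>2"])
       (auto simp: g'_def intro!: integrable_continuous_real continuous_intros cont)
  have hk: "(\<lambda>t. (norm (h t - g' k t))\<^sup>2) integrable_on {0..T}"
    and hk_le: "integral {0..T} (\<lambda>t. (norm (h t - g' k t))\<^sup>2) \<le> 2 * (1/2) ^ k * integral {0..T} \<Phi>" for k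
  proof -
    have bnd: "(norm (h t - g' k t))\<^sup>2 \<le> 2 * (1/2) ^ k * \<Phi> t" if t: "t \<in> {0..T}" for t
    proof (rule LIMSEQ_le_const2)
      show "(\<lambda>n. (norm (g' n t - g' k t))\<^sup>2) \<longlonglongrightarrow> (norm (h t - g' k t))\<^sup>2"
        by (intro tendsto_intros h t)
      show "\<exists>N. \<forall>n\<ge>N. (norm (g' n t - g' k t))\<^sup>2 \<le> 2 * (1/2) ^ k * \<Phi> t"
        using close[OF t] by blast
    qed
    show hk: "(\<lambda>t. (norm (h t - g' k t))\<^sup>2) integrable_on {0..T}"
    proof (rule dominated_convergence(1))
      show "(\<lambda>t. (norm (g' (n + k) t - g' k t))\<^sup>2) integrable_on {0..T}" for n by (rule id)
      show "(\<lambda>t. 2 * (1/2) ^ k * \<Phi> t) integrable_on {0..T}" by (intro integrable_on_mult_right \<Phi>)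
      show "norm ((norm (g' (n + k) t - g' k t))\<^sup>2) \<le> 2 * (1/2) ^ k * \<Phi> t" if "t \<in> {0..T}" for n t
        using close[OF that, of k "n + k"] by simp
      show "(\<lambda>n. (norm (g' (n + k) t - g' k t))\<^sup>2) \<longlonglongrightarrow> (norm (h t - g' k t))\<^sup>2" if "t \<in> {0..T}" for t
        by (intro tendsto_intros LIMSEQ_ignore_initial_segment[OF h[OF that]])
    qed
    have "integral {0..T} (\<lambda>t. (norm (h t - g' k t))\<^sup>2) \<le> integral {0..T} (\<lambda>t. 2 * (1/2) ^ k * \<Phi> t)"
      by (intro integral_le hk integrable_on_mult_right \<Phi> bnd)
    then show "integral {0..T} (\<lambda>t. (norm (h t - g' k t))\<^sup>2) \<le> 2 * (1/2) ^ k * integral {0..T} \<Phi>" by simp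
  qed
  have "(\<lambda>t. (norm (h t))\<^sup>2) integrable_on {0..T}"
  proof (rule measurable_bounded_by_integrable_imp_integrable)
    show "(\<lambda>t. (norm (h t))\<^sup>2) \<in> borel_measurable (lebesgue_on {0..T})"
      using norm_measurable[OF hM] by (simp add: M_def)
    show "(\<lambda>t. 2 * (norm (h t - g' 0 t))\<^sup>2 + 2 * (norm (g' 0 t))\<^sup>2) integrable_on {0..T}"
      by (intro integrable_add integrable_on_mult_right hk i2)
    show "norm ((norm (h t))\<^sup>2) \<le> 2 * (norm (h t - g' 0 t))\<^sup>2 + 2 * (norm (g' 0 t))\<^sup>2" for t
      using norm_square_diff_le[of "h t" "g' 0 t"] by simp
  qed simp
  then have "L2_on T h" using hM by (simp add: L2_on_def M_def)
  moreover have "L2_tendsto T g h"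
    unfolding L2_tendsto_def
  proof (intro conjI allI)
    have e1: "(norm (g k t - h t))\<^sup>2 = (norm (h t - g' k t))\<^sup>2" if "t \<in> {0..T} - N" for k t
      using that by (simp add: g'_def norm_minus_commute)
    show "(\<lambda>t. (norm (g k t - h t))\<^sup>2) integrable_on {0..T}" for k
      by (rule integrable_spike[OF hk N e1])
    have e2: "integral {0..T} (\<lambda>t. (norm (g k t - h t))\<^sup>2) = integral {0..T} (\<lambda>t. (norm (h t - g' k t))\<^sup>2)" for k
      by (rule integral_spike[OF N e1[symmetric]])
    show "(\<lambda>k. integral {0..T} (\<lambda>t. (norm (g k t - h t))\<^sup>2)) \<longlonglongrightarrow> 0"
      unfolding e2
    proof (rule tendsto_sandwich[of "\<lambda>_. 0"])
      have "(\<lambda>k. 2 * (1/2) ^ k * integral {0..T} \<Phi>) \<longlonglongrightarrow> 2 * 0 * integral {0..T} \<Phi>"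
        by (intro tendsto_intros LIMSEQ_realpow_zero) auto
      then show "(\<lambda>k. 2 * (1/2) ^ k * integral {0..T} \<Phi>) \<longlonglongrightarrow> 0" by simp
    qed (auto intro!: always_eventually integral_nonneg hk simp: hk_le)
  qed
  ultimately show ?thesis by blast
qed

lemma measurable_translate:
  fixes f :: "real \<Rightarrow> 'a::topological_space"
  assumes f: "f \<in> borel_measurable (lebesgue_on {0..T})" and a: "0 \<le> a" "a + T' \<le> T"
  shows "(\<lambda>t. f (a + t)) \<in> borel_measurable (lebesgue_on {0..T'})"
proof -
  have "(\<lambda>t. a + t) \<in> lebesgue \<rightarrow>\<^sub>M lebesgue"
    using lebesgue_affine_measurable[of "\<lambda>_. 1" a] by simp
  then have "(\<lambda>t. a + t) \<in> lebesgue_on {0..T'} \<rightarrow>\<^sub>M lebesgue_on {0..T}"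
    by (rule measurable_restrict_space3) (use a in auto)
  from measurable_compose[OF this f] show ?thesis by simp
qed

lemma
  fixes h :: "real \<Rightarrow> real"
  shows integrable_translate: "(\<lambda>t. h (a + t)) integrable_on {0..c} \<longleftrightarrow> h integrable_on {a..a + c}"
    and integral_translate: "integral {0..c} (\<lambda>t. h (a + t)) = integral {a..a + c} h"
proof -
  have *: "((\<lambda>t. h (a + t)) has_integral I) {0..c} \<longleftrightarrow> (h has_integral I) {a..a + c}" for I
    using has_integral_shift_Icc_real[of h a I 0 c] by (simp add: o_def add.commute)
  then show i: "(\<lambda>t. h (a + t)) integrable_on {0..c} \<longleftrightarrow> h integrable_on {a..a + c}"
    by (simp add: integrable_on_def)
  show "integral {0..c} (\<lambda>t. h (a + t)) = integral {a..a + c} h"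
  proof (cases "h integrable_on {a..a + c}")
    case True
    then show ?thesis using * integral_unique by blast
  next
    case False
    then show ?thesis using i by (simp add: not_integrable_integral)
  qed
qed

lemma integral_square_mono_set:
  fixes h :: "real \<Rightarrow> real"
  assumes "h integrable_on {0..T}" "\<And>t. 0 \<le> h t" "0 \<le> a" "b \<le> T"
  shows "integral {a..b} h \<le> integral {0..T} h"
  by (rule integral_subset_le) (use assms integrable_subinterval_real[OF assms(1), of a b] in auto)

lemma integral_le_AE_negligible:
  fixes f g :: "real \<Rightarrow> real"
  assumes f: "f integrable_on S" and g: "g integrable_on S" and N: "negligible N"
    and le: "\<And>t. t \<in> S - N \<Longrightarrow> f t \<le> g t"
  shows "integral S f \<le> integral S g"
proof -
  define f' where "f' t = (if t \<in> N then g t else f t)" for t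
  have "f' integrable_on S" by (rule integrable_spike[OF f N]) (simp add: f'_def)
  then have "integral S f' \<le> integral S g" using le by (intro integral_le g) (auto simp: f'_def)
  moreover have "integral S f' = integral S f" by (rule integral_spike[OF N]) (simp add: f'_def)
  ultimately show ?thesis by simp
qed

section \<open>Observations\<close>

context wave_operator
begin

text \<open>The resolvent maps onto the dense set \<open>D\<close>, and its range consists of
  multiples of limits from a countable set, whose rational multiples are therefore dense.\<close>

lemma countable_dense:
  obtains X :: "'h set" where "countable X" "closure X = UNIV"
proof -
  obtain \<mu> R where cR: "compact_op R" and RA: "\<And>u. u \<in> D \<Longrightarrow> R (A u - \<mu> *\<^sub>R u) = u"
    using resolvent_obtain by metis
  obtain Q where Q: "countable Q" "\<And>x. \<exists>c. R x \<in> (\<lambda>q. c *\<^sub>R q) ` closure Q"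
    using compact_op_countable_dense[OF cR] by blast
  define X where "X = (\<lambda>p. fst p *\<^sub>R snd p) ` (\<rat> \<times> Q)"
  have "countable X" unfolding X_def using Q(1) countable_rat by blast
  moreover have "closure X = UNIV"
  proof -
    have im: "(\<lambda>p. fst p *\<^sub>R snd p) ` closure (\<rat> \<times> Q) \<subseteq> closure X"
      by (rule image_closure_subset) (auto simp: X_def intro!: continuous_intros closure_subset[THEN subsetD])
    have "D \<subseteq> closure X"
    proof
      fix u assume "u \<in> D"
      then obtain c q where "u = c *\<^sub>R q" "q \<in> closure Q" using Q(2)[of "A u - \<mu> *\<^sub>R u"] RA by auto
      moreover have "(c, q) \<in> closure (\<rat> \<times> Q)"
        using \<open>q \<in> closure Q\<close> by (simp add: closure_Times Rats_closure_real)
      ultimately show "u \<in> closure X" using im by force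
    qed
    then have "closure D \<subseteq> closure X" by (rule closure_minimal) simp
    then show ?thesis using dense_D by blast
  qed
  ultimately show thesis using that by blast
qed

lemma L2_on_diff:
  fixes f g :: "real \<Rightarrow> 'h"
  assumes f: "L2_on T f" and g: "L2_on T g"
  shows "L2_on T (\<lambda>t. f t - g t)"
proof -
  obtain X :: "'h set" where X: "countable X" "closure X = UNIV" by (rule countable_dense)
  have m: "(\<lambda>t. f t - g t) \<in> borel_measurable (lebesgue_on {0..T})"
    by (rule borel_measurable_diff_separable[OF X]) (use f g in \<open>auto simp: L2_on_def\<close>)
  have "(\<lambda>t. (norm (f t - g t))\<^sup>2) integrable_on {0..T}"
  proof (rule measurable_bounded_by_integrable_imp_integrable)
    show "(\<lambda>t. (norm (f t - g t))\<^sup>2) \<in> borel_measurable (lebesgue_on {0..T})"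
      using norm_measurable[OF m] by simp
    show "(\<lambda>t. 2 * (norm (f t))\<^sup>2 + 2 * (norm (g t))\<^sup>2) integrable_on {0..T}"
      by (intro integrable_add integrable_on_mult_right) (use f g in \<open>auto simp: L2_on_def\<close>)
    show "norm ((norm (f t - g t))\<^sup>2) \<le> 2 * (norm (f t))\<^sup>2 + 2 * (norm (g t))\<^sup>2" for t
      using norm_square_add_le[of "f t" "- g t"] by simp
  qed simp
  then show ?thesis using m by (simp add: L2_on_def)
qed

text \<open>The equation determines the primitive of \<open>(f t - g t) \<bullet> \<phi>\<close>,
  hence the integrand up to a null set depending on \<open>\<phi>\<close>. Cutoffs of countably many
  dense vectors suffice as test vectors and leave one null set. This is needed since
  \<open>is_observation\<close> admits any source for which the equation holds.\<close>

lemma source_unique: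
  assumes f: "wave_solution D A {0..T} f w w'" and g: "wave_solution D A {0..T} g w w'"
  obtains N where "negligible N" "\<And>t. t \<in> {0..T} \<Longrightarrow> t \<notin> N \<Longrightarrow> f t = g t"
proof (cases "0 \<le> T")
  case T: True
  obtain X :: "'h set" where X: "countable X" "closure X = UNIV" by (rule countable_dense)
  have "\<exists>N. negligible N \<and> (\<forall>t\<in>{0..T} - N. (f t - g t) \<bullet> Q k x = 0)" for k x
  proof -
    have i: "(\<lambda>t. (f t - g t) \<bullet> Q k x) integrable_on {0..T}"
      unfolding inner_diff_left
      by (intro integrable_diff wave_source_integrable[OF f] wave_source_integrable[OF g] Q_pow_dom T)
    have z: "integral {0..t} (\<lambda>t. (f t - g t) \<bullet> Q k x) = 0" if t: "t \<in> {0..T}" for t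
    proof -
      have "((\<lambda>s. (f s \<bullet> Q k x - half (w s) \<bullet> half (Q k x)) - (g s \<bullet> Q k x - half (w s) \<bullet> half (Q k x)))
          has_integral (w' t \<bullet> Q k x - w' 0 \<bullet> Q k x) - (w' t \<bullet> Q k x - w' 0 \<bullet> Q k x)) {0..t}"
        by (intro has_integral_diff wave_weak0[OF f Q_pow_dom t] wave_weak0[OF g Q_pow_dom t])
      then show ?thesis by (simp add: inner_diff_left integral_unique)
    qed
    obtain N where "negligible N" "\<And>t. t \<in> {0..T} \<Longrightarrow> t \<notin> N \<Longrightarrow> (f t - g t) \<bullet> Q k x = 0"
      using zero_if_primitive_zero[OF i z] by blast
    then show ?thesis by blast
  qed
  then obtain N where N: "\<And>k x. negligible (N k x)"
    and Nz: "\<And>k x t. t \<in> {0..T} \<Longrightarrow> t \<notin> N k x \<Longrightarrow> (f t - g t) \<bullet> Q k x = 0" by (metis DiffI)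
  define Z where "Z = (\<Union>(k, x)\<in>UNIV \<times> X. N k x)"
  have "negligible Z" unfolding Z_def
    by (rule negligible_countable_Union) (use X N in auto)
  moreover have "f t = g t" if t: "t \<in> {0..T}" "t \<notin> Z" for t
  proof -
    have "(f t - g t) \<bullet> x = 0" if "x \<in> X" for x
    proof -
      have "(f t - g t) \<bullet> Q k x = 0" for k using Nz[of t k x] t that by (auto simp: Z_def)
      moreover have "(\<lambda>k. (f t - g t) \<bullet> Q k x) \<longlonglongrightarrow> (f t - g t) \<bullet> x"
        by (intro tendsto_intros Q_tendsto)
      ultimately show ?thesis by (simp add: LIMSEQ_const_iff)
    qed
    then have "X \<subseteq> {x. (f t - g t) \<bullet> x = 0}" by blast
    then have "closure X \<subseteq> {x. (f t - g t) \<bullet> x = 0}"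
      by (rule closure_minimal) (intro closed_Collect_eq continuous_intros)
    then have "(f t - g t) \<bullet> (f t - g t) = 0" unfolding X(2) by blast
    then show ?thesis by simp
  qed
  ultimately show thesis using that by blast
qed (use that[of "{}"] in auto)

section \<open>Regular solutions and approximation by cutoffs\<close>

lemma
  assumes "regular_solution D A T f w w'"
  shows regular_L2: "L2_on T f" and regular_wave: "wave_solution D A {0..T} f w w'"
    and regular_H2: "t \<in> {0..T} \<Longrightarrow> w t \<in> H2" and regular_cont: "continuous_on {0..T} (\<lambda>t. op_pow D A 1 (w t))"
  using assms unfolding regular_solution_def Hsp_2 by blast+

lemma op_pow_1_diff: "u \<in> H2 \<Longrightarrow> v \<in> H2 \<Longrightarrow> op_pow D A 1 (u - v) = op_pow D A 1 u - op_pow D A 1 v"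
  by (simp add: pow_dom_eq_fdom op_pow_eq_fc fdom_diff)

lemma regular_solution_diff:
  assumes w: "regular_solution D A T f w w'" and y: "regular_solution D A T g y y'"
  shows "regular_solution D A T (\<lambda>t. f t - g t) (\<lambda>t. w t - y t) (\<lambda>t. w' t - y' t)"
  unfolding regular_solution_def Hsp_2
proof (intro conjI ballI L2_on_diff regular_L2[OF w] regular_L2[OF y])
  show "wave_solution D A {0..T} (\<lambda>t. f t - g t) (\<lambda>t. w t - y t) (\<lambda>t. w' t - y' t)"
    by (rule wave_solution_diff[OF regular_wave[OF w] regular_wave[OF y]]) auto
  show "w t - y t \<in> H2" if "t \<in> {0..T}" for t
    by (rule subspace_diff[OF subspace_pow_dom regular_H2[OF w that] regular_H2[OF y that]])
  have "continuous_on {0..T} (\<lambda>t. op_pow D A 1 (w t) - op_pow D A 1 (y t))"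
    by (intro continuous_on_diff regular_cont[OF w] regular_cont[OF y])
  then show "continuous_on {0..T} (\<lambda>t. op_pow D A 1 (w t - y t))"
    by (rule continuous_on_eq) (simp add: op_pow_1_diff regular_H2[OF w] regular_H2[OF y])
qed

lemma regular_solution_translate:
  assumes w: "regular_solution D A T f w w'" and a: "0 \<le> a" "a + T' \<le> T"
  shows "regular_solution D A T' (\<lambda>t. f (a + t)) (\<lambda>t. w (a + t)) (\<lambda>t. w' (a + t))"
  unfolding regular_solution_def Hsp_2
proof (intro conjI ballI wave_solution_translate[OF regular_wave[OF w] a])
  have im: "(\<lambda>t. a + t) ` {0..T'} \<subseteq> {0..T}" using a by auto
  show "w (a + t) \<in> H2" if "t \<in> {0..T'}" for t
    using regular_H2[OF w] im that by auto
  show "continuous_on {0..T'} (\<lambda>t. op_pow D A 1 (w (a + t)))"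
    by (rule continuous_on_compose2[OF regular_cont[OF w] _ im]) (intro continuous_intros)
  have "(\<lambda>t. (norm (f t))\<^sup>2) integrable_on {a..a + T'}"
    by (rule integrable_subinterval_real[of _ 0 T]) (use regular_L2[OF w] a in \<open>auto simp: L2_on_def\<close>)
  then show "L2_on T' (\<lambda>t. f (a + t))"
    using measurable_translate[OF _ a, of f] regular_L2[OF w]
      integrable_translate[of "\<lambda>t. (norm (f t))\<^sup>2" a T'] by (simp add: L2_on_def)
qed

lemma regular_solution_Q:
  assumes w: "wave_solution D A {0..T} f w w'" and f: "L2_on T f"
  shows "regular_solution D A T (\<lambda>t. Q N (f t)) (\<lambda>t. Q N (w t)) (\<lambda>t. Q N (w' t))"
  unfolding regular_solution_def Hsp_2
proof (intro conjI ballI Q_pow_dom wave_solution_Q[OF w])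
  have m: "(\<lambda>t. Q N (f t)) \<in> borel_measurable (lebesgue_on {0..T})"
    by (rule measurable_compose[OF _ borel_measurable_continuous_onI])
       (use f in \<open>auto simp: L2_on_def intro: bounded_linear.continuous_on[OF bounded_linear_Q]\<close>)
  have "(\<lambda>t. (norm (Q N (f t)))\<^sup>2) integrable_on {0..T}"
  proof (rule measurable_bounded_by_integrable_imp_integrable)
    show "(\<lambda>t. (norm (Q N (f t)))\<^sup>2) \<in> borel_measurable (lebesgue_on {0..T})"
      using norm_measurable[OF m] by simp
    show "(\<lambda>t. (norm (f t))\<^sup>2) integrable_on {0..T}" using f by (simp add: L2_on_def)
    show "norm ((norm (Q N (f t)))\<^sup>2) \<le> (norm (f t))\<^sup>2" for t
      by (simp add: power_mono norm_Q_le)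
  qed simp
  then show "L2_on T (\<lambda>t. Q N (f t))" using m by (simp add: L2_on_def)
  show "continuous_on {0..T} (\<lambda>t. op_pow D A 1 (Q N (w t)))"
    by (rule bounded_linear.continuous_on[OF op_pow_Q_bounded wave_cont[OF w]])
qed auto

lemma L2_energy_estimate:
  assumes w: "wave_solution D A {0..T} f w w'" and f: "L2_on T f" and st: "s \<in> {0..T}" "t \<in> {0..T}"
  shows "(norm (state (w t) (w' t)))\<^sup>2 \<le> 2 * (norm (state (w s) (w' s)))\<^sup>2
      + 2 * (\<bar>t - s\<bar> * integral {min s t..max s t} (\<lambda>\<tau>. (norm (f \<tau>))\<^sup>2))"
proof -
  let ?J = "{min s t..max s t}"
  let ?i = "integral ?J (\<lambda>\<tau>. norm (f \<tau>))"
  have sub: "?J \<subseteq> {0..T}" using st by auto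
  have i1: "(\<lambda>\<tau>. norm (f \<tau>)) integrable_on ?J"
    by (rule integrable_subinterval_real[OF L2_on_norm_integrable[OF f] sub])
  have i2: "(\<lambda>\<tau>. (norm (f \<tau>))\<^sup>2) integrable_on ?J"
    by (rule integrable_subinterval_real[OF _ sub]) (use f in \<open>simp add: L2_on_def\<close>)
  have "(norm (state (w t) (w' t)))\<^sup>2 \<le> (norm (state (w s) (w' s)) + ?i)\<^sup>2"
    by (intro power_mono energy_estimate[OF w st L2_on_norm_integrable[OF f]]) simp
  also have "\<dots> \<le> 2 * (norm (state (w s) (w' s)))\<^sup>2 + 2 * ?i\<^sup>2"
    using zero_le_power2[of "norm (state (w s) (w' s)) - ?i"] by (simp add: power2_eq_square algebra_simps)
  also have "?i\<^sup>2 \<le> (max s t - min s t) * integral ?J (\<lambda>\<tau>. (norm (f \<tau>))\<^sup>2)"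
    by (rule integral_square_le[OF _ i1 i2]) simp
  also have "max s t - min s t = \<bar>t - s\<bar>" by auto
  finally show ?thesis by simp
qed

lemma continuous_state: "wave_solution D A I f w w' \<Longrightarrow> continuous_on I (\<lambda>t. state (w t) (w' t))"
  by (intro continuous_on_Pair wave_half_cont wave_deriv_cont)

lemma Q_state_tendsto:
  assumes "u \<in> H1"
  shows "(\<lambda>N. state (Q N u - u) (Q N v - v)) \<longlonglongrightarrow> 0"
proof -
  have "(\<lambda>N. (Q N (half u) - half u, Q N v - v)) \<longlonglongrightarrow> (half u - half u, v - v)"
    by (intro tendsto_Pair tendsto_diff Q_tendsto tendsto_const)
  moreover have "half (Q N u - u) = Q N (half u) - half u" for N
    using half_diff[OF Q_pow_dom assms, of N] by (simp add: half_Q[OF assms])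
  ultimately show ?thesis by (simp add: zero_prod_def)
qed

lemma Q_L2_tendsto:
  fixes f :: "real \<Rightarrow> 'h"
  assumes f: "L2_on T f" and m: "\<And>N. L2_on T (\<lambda>t. Q N (f t))"
  shows "L2_tendsto T (\<lambda>N t. Q N (f t)) f"
  unfolding L2_tendsto_def
proof (intro conjI allI)
  show i: "(\<lambda>t. (norm (Q N (f t) - f t))\<^sup>2) integrable_on {0..T}" for N
    using L2_on_diff[OF m f] by (simp add: L2_on_def)
  have "(\<lambda>N. integral {0..T} (\<lambda>t. (norm (Q N (f t) - f t))\<^sup>2)) \<longlonglongrightarrow> integral {0..T} (\<lambda>t. (norm (f t - f t))\<^sup>2)"
  proof (rule dominated_convergence(2)[OF i])
    show "(\<lambda>t. 4 * (norm (f t))\<^sup>2) integrable_on {0..T}"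
      using f by (intro integrable_on_mult_right) (simp add: L2_on_def)
    show "norm ((norm (Q N (f t) - f t))\<^sup>2) \<le> 4 * (norm (f t))\<^sup>2" for N t
    proof -
      have "(norm (Q N (f t) - f t))\<^sup>2 \<le> 2 * (norm (Q N (f t)))\<^sup>2 + 2 * (norm (f t))\<^sup>2"
        using norm_square_add_le[of "Q N (f t)" "- f t"] by simp
      also have "(norm (Q N (f t)))\<^sup>2 \<le> (norm (f t))\<^sup>2" by (intro power_mono norm_Q_le) simp
      finally show ?thesis by simp
    qed
    show "(\<lambda>N. (norm (Q N (f t) - f t))\<^sup>2) \<longlonglongrightarrow> (norm (f t - f t))\<^sup>2" for t
      by (intro tendsto_intros Q_tendsto)
  qed
  then show "(\<lambda>N. integral {0..T} (\<lambda>t. (norm (Q N (f t) - f t))\<^sup>2)) \<longlonglongrightarrow> 0" by simp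
qed

section \<open>The observation of solutions of energy regularity\<close>

context
  fixes B :: "'h \<times> 'h \<Rightarrow> 'g::{real_inner,complete_space}"
  assumes adm: "admissibility_hyp D A B"
begin

lemma B_diff:
  assumes "u \<in> H2" "u' \<in> H2" shows "B (u - u', v - v') = B (u, v) - B (u', v')"
proof -
  have add: "\<And>U V. U \<in> H2 \<times> UNIV \<Longrightarrow> V \<in> H2 \<times> UNIV \<Longrightarrow> B (U + V) = B U + B V"
    using adm unfolding admissibility_hyp_def bounded_H2_H_def Hsp_2 by blast
  have "u - u' \<in> H2" using assms by (rule subspace_diff[OF subspace_pow_dom])
  then have "B ((u - u', v - v') + (u', v')) = B (u - u', v - v') + B (u', v')"
    using assms by (intro add) auto
  then show ?thesis by simp
qed

lemma continuous_B:
  assumes w: "regular_solution D A T f w w'"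
  shows "continuous_on {0..T} (\<lambda>t. B (w t, w' t))"
proof -
  obtain M where M: "\<And>u v. u \<in> H2 \<Longrightarrow> norm (B (u, v)) \<le> M * norm (op_pow D A 1 u, v)"
    using adm unfolding admissibility_hyp_def bounded_H2_H_def Hsp_2 by blast
  define Y where "Y t = (op_pow D A 1 (w t), w' t)" for t
  have Y: "continuous_on {0..T} Y" unfolding Y_def
    by (intro continuous_on_Pair regular_cont[OF w] wave_deriv_cont[OF regular_wave[OF w]])
  have le: "norm (B (w s, w' s) - B (w t, w' t)) \<le> \<bar>M\<bar> * norm (Y s - Y t)" if "s \<in> {0..T}" "t \<in> {0..T}" for s t
  proof -
    note H = regular_H2[OF w that(1)] regular_H2[OF w that(2)]
    have "norm (B (w s, w' s) - B (w t, w' t)) \<le> M * norm (Y s - Y t)"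
      using M[OF subspace_diff[OF subspace_pow_dom H], of "w' s - w' t"]
      by (simp add: B_diff[OF H] Y_def op_pow_1_diff[OF H])
    also have "\<dots> \<le> \<bar>M\<bar> * norm (Y s - Y t)" by (intro mult_right_mono) auto
    finally show ?thesis .
  qed
  show ?thesis
    unfolding continuous_on_def
  proof
    fix t assume t: "t \<in> {0..T}"
    have lim: "((\<lambda>s. \<bar>M\<bar> * norm (Y s - Y t)) \<longlongrightarrow> \<bar>M\<bar> * norm (Y t - Y t)) (at t within {0..T})"
      using Y t unfolding continuous_on_def by (intro tendsto_intros) auto
    have "((\<lambda>s. B (w s, w' s) - B (w t, w' t)) \<longlongrightarrow> 0) (at t within {0..T})"
    proof (rule Lim_null_comparison)
      show "\<forall>\<^sub>F s in at t within {0..T}. norm (B (w s, w' s) - B (w t, w' t)) \<le> \<bar>M\<bar> * norm (Y s - Y t)"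
        unfolding eventually_at_filter by (intro always_eventually allI impI le t)
      show "((\<lambda>s. \<bar>M\<bar> * norm (Y s - Y t)) \<longlongrightarrow> 0) (at t within {0..T})" using lim by simp
    qed
    then show "((\<lambda>s. B (w s, w' s)) \<longlongrightarrow> B (w t, w' t)) (at t within {0..T})"
      by (rule LIM_zero_cancel)
  qed
qed

text \<open>The energy estimate removes the energies at later times, so that only quantities remain
  whose convergence is part of the definition of the extension: the initial state and the
  source.\<close>

lemma admissible_bound:
  assumes T: "T > 0"
  obtains K where "K > 0" "\<And>f w w'. regular_solution D A T f w w' \<Longrightarrow>
    integral {0..T} (\<lambda>t. (norm (B (w t, w' t)))\<^sup>2)
      \<le> K * ((norm (state (w 0) (w' 0)))\<^sup>2 + integral {0..T} (\<lambda>t. (norm (f t))\<^sup>2))"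
proof -
  have "\<forall>T>0. \<exists>K>0. \<forall>f w w'. regular_solution D A T f w w' \<longrightarrow>
        integral {0..T} (\<lambda>t. (norm (B (w t, w' t)))\<^sup>2)
          \<le> K * (energy D A 1 (w 0, w' 0) + energy D A 1 (w T, w' T)
                 + integral {0..T} (\<lambda>t. energy D A 1 (w t, w' t))
                 + integral {0..T} (\<lambda>t. (norm (f t))\<^sup>2))"
    using adm unfolding admissibility_hyp_def by blast
  from this[rule_format, OF T] obtain K where K: "K > 0" and KK: "\<And>f w w'. regular_solution D A T f w w' \<Longrightarrow>
        integral {0..T} (\<lambda>t. (norm (B (w t, w' t)))\<^sup>2)
          \<le> K * (energy D A 1 (w 0, w' 0) + energy D A 1 (w T, w' T)
                 + integral {0..T} (\<lambda>t. energy D A 1 (w t, w' t))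
                 + integral {0..T} (\<lambda>t. (norm (f t))\<^sup>2))" by blast
  show thesis
  \<comment> \<open>All energies are at most \<open>e0 + T * F\<close>; the four terms of the
    hypothesis add up to \<open>e0 + (1 + T) * (e0 + T * F) + F\<close>.\<close>
  proof (rule that[of "K * (2 + 2 * T + T\<^sup>2)"])
    show "K * (2 + 2 * T + T\<^sup>2) > 0" using K T by (intro mult_pos_pos add_pos_pos) auto
    fix f w w' assume r: "regular_solution D A T f w w'"
    define e0 where "e0 = (norm (state (w 0) (w' 0)))\<^sup>2"
    define F where "F = integral {0..T} (\<lambda>t. (norm (f t))\<^sup>2)"
    have e0: "0 \<le> e0" by (simp add: e0_def)
    have Fi: "(\<lambda>t. (norm (f t))\<^sup>2) integrable_on {0..T}" using regular_L2[OF r] by (simp add: L2_on_def)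
    have F0: "0 \<le> F" unfolding F_def by (rule integral_nonneg[OF Fi]) simp
    have en: "energy D A 1 (w t, w' t) \<le> e0 + T * F" if t: "t \<in> {0..T}" for t
    proof -
      have "(norm (state (w t) (w' t)))\<^sup>2 \<le> 2 * e0 + 2 * (\<bar>t - 0\<bar> * integral {min 0 t..max 0 t} (\<lambda>\<tau>. (norm (f \<tau>))\<^sup>2))"
        unfolding e0_def by (rule L2_energy_estimate[OF regular_wave[OF r] regular_L2[OF r] _ t]) (use T in simp)
      also have "\<bar>t - 0\<bar> * integral {min 0 t..max 0 t} (\<lambda>\<tau>. (norm (f \<tau>))\<^sup>2) \<le> T * F"
        unfolding F_def using t
        by (intro mult_mono integral_square_mono_set[OF Fi] integral_nonneg integrable_subinterval_real[OF Fi]) auto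
      finally show ?thesis by (simp add: energy_state)
    qed
    have "continuous_on {0..T} (\<lambda>t. energy D A 1 (w t, w' t))"
      unfolding energy_state by (intro continuous_intros continuous_state[OF regular_wave[OF r]]) auto
    then have "integral {0..T} (\<lambda>t. energy D A 1 (w t, w' t)) \<le> integral {0..T} (\<lambda>t. e0 + T * F)"
      by (intro integral_le integrable_continuous_real en) auto
    also have "\<dots> = T * (e0 + T * F)" using T by simp
    finally have int: "integral {0..T} (\<lambda>t. energy D A 1 (w t, w' t)) \<le> T * (e0 + T * F)" .
    have "integral {0..T} (\<lambda>t. (norm (B (w t, w' t)))\<^sup>2)
        \<le> K * (energy D A 1 (w 0, w' 0) + energy D A 1 (w T, w' T)
                 + integral {0..T} (\<lambda>t. energy D A 1 (w t, w' t)) + F)"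
      unfolding F_def by (rule KK[OF r])
    also have "\<dots> \<le> K * (e0 + (e0 + T * F) + T * (e0 + T * F) + F)"
      using K en[of T] int T e0 by (intro mult_left_mono add_mono) (auto simp: energy_state e0_def)
    also have "\<dots> \<le> K * ((2 + 2 * T + T\<^sup>2) * (e0 + F))"
    proof (rule mult_left_mono)
      have "0 \<le> T * e0" "0 \<le> T\<^sup>2 * e0" "0 \<le> T * F" using T e0 F0 by auto
      then show "e0 + (e0 + T * F) + T * (e0 + T * F) + F \<le> (2 + 2 * T + T\<^sup>2) * (e0 + F)"
        using F0 by (simp add: algebra_simps power2_eq_square)
    qed (use K in simp)
    finally show "integral {0..T} (\<lambda>t. (norm (B (w t, w' t)))\<^sup>2)
      \<le> K * (2 + 2 * T + T\<^sup>2) * ((norm (state (w 0) (w' 0)))\<^sup>2 + integral {0..T} (\<lambda>t. (norm (f t))\<^sup>2))"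
      by (simp add: e0_def F_def mult.assoc)
  qed
qed

text \<open>The choice in \<open>observation\<close> is thereby meaningful. Admissibility, applied
  to differences of cutoffs of \<open>w\<close>, makes their observations Cauchy, and a subsequence
  is fast enough for \<open>L2_limit_exists\<close>.\<close>

theorem observation_exists:
  assumes w: "wave_solution D A {0..T} f w w'" and f: "L2_on T f" and T: "T > 0"
  shows "is_observation D A B T w w' (observation D A B T w w')"
proof -
  obtain K where K: "K > 0" and KK: "\<And>f w w'. regular_solution D A T f w w' \<Longrightarrow>
    integral {0..T} (\<lambda>t. (norm (B (w t, w' t)))\<^sup>2)
      \<le> K * ((norm (state (w 0) (w' 0)))\<^sup>2 + integral {0..T} (\<lambda>t. (norm (f t))\<^sup>2))"
    using admissible_bound[OF T] by blast
  have reg: "regular_solution D A T (\<lambda>t. Q N (f t)) (\<lambda>t. Q N (w t)) (\<lambda>t. Q N (w' t))" for N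
    by (rule regular_solution_Q[OF w f])
  have w0: "w 0 \<in> H1" using wave_H1[OF w] T by simp
  note QL2 = Q_L2_tendsto[OF f regular_L2[OF reg]]
  define s where "s N = (norm (state (Q N (w 0) - w 0) (Q N (w' 0) - w' 0)))\<^sup>2" for N
  define r where "r N = integral {0..T} (\<lambda>t. (norm (Q N (f t) - f t))\<^sup>2)" for N
  have s0: "s \<longlonglongrightarrow> 0"
    unfolding s_def using tendsto_power[OF tendsto_norm_zero[OF Q_state_tendsto[OF w0, of "w' 0"]], where n = 2] by simp
  have r0: "r \<longlonglongrightarrow> 0" using QL2 by (simp add: r_def[abs_def] L2_tendsto_def)
  have diff: "integral {0..T} (\<lambda>t. (norm (B (Q N (w t), Q N (w' t)) - B (Q k (w t), Q k (w' t))))\<^sup>2)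
      \<le> K * (2 * s N + 2 * s k + (2 * r N + 2 * r k))" for N k
  proof -
    have "integral {0..T} (\<lambda>t. (norm (B (Q N (w t) - Q k (w t), Q N (w' t) - Q k (w' t))))\<^sup>2)
      \<le> K * ((norm (state (Q N (w 0) - Q k (w 0)) (Q N (w' 0) - Q k (w' 0))))\<^sup>2
          + integral {0..T} (\<lambda>t. (norm (Q N (f t) - Q k (f t)))\<^sup>2))"
      by (rule KK[OF regular_solution_diff[OF reg reg]])
    also have "\<dots> \<le> K * ((2 * s N + 2 * s k) + (2 * r N + 2 * r k))"
    proof (intro mult_left_mono add_mono)
      have "state (Q N (w 0) - Q k (w 0)) (Q N (w' 0) - Q k (w' 0))
          = state (Q N (w 0) - w 0) (Q N (w' 0) - w' 0) + - state (Q k (w 0) - w 0) (Q k (w' 0) - w' 0)"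
        using w0 by (simp add: half_diff Q_pow_dom)
      then show "(norm (state (Q N (w 0) - Q k (w 0)) (Q N (w' 0) - Q k (w' 0))))\<^sup>2 \<le> 2 * s N + 2 * s k"
        unfolding s_def by (metis norm_minus_cancel norm_square_add_le)
      have i: "(\<lambda>t. (norm (Q N (f t) - f t))\<^sup>2) integrable_on {0..T}" for N
        using QL2 by (simp add: L2_tendsto_def)
      have "integral {0..T} (\<lambda>t. (norm (Q N (f t) - Q k (f t)))\<^sup>2)
          \<le> integral {0..T} (\<lambda>t. 2 * (norm (Q N (f t) - f t))\<^sup>2 + 2 * (norm (Q k (f t) - f t))\<^sup>2)"
      proof (intro integral_le integrable_add integrable_on_mult_right i)
        show "(\<lambda>t. (norm (Q N (f t) - Q k (f t)))\<^sup>2) integrable_on {0..T}"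
          using L2_on_diff[OF regular_L2[OF reg] regular_L2[OF reg]] by (simp add: L2_on_def)
        show "(norm (Q N (f t) - Q k (f t)))\<^sup>2 \<le> 2 * (norm (Q N (f t) - f t))\<^sup>2 + 2 * (norm (Q k (f t) - f t))\<^sup>2" for t
          using norm_square_add_le[of "Q N (f t) - f t" "- (Q k (f t) - f t)"] by (simp add: norm_minus_commute)
      qed
      also have "\<dots> = 2 * r N + 2 * r k"
        unfolding r_def by (subst integral_add) (auto intro!: integrable_on_mult_right i)
      finally show "integral {0..T} (\<lambda>t. (norm (Q N (f t) - Q k (f t)))\<^sup>2) \<le> 2 * r N + 2 * r k" .
    qed (use K in auto)
    finally show ?thesis by (simp add: B_diff[OF Q_pow_dom Q_pow_dom] add.assoc)
  qed
  have "\<exists>N0. \<forall>N\<ge>N0. s N < e \<and> r N < e" if "e > 0" for e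
    using eventually_conj[OF order_tendstoD(2)[OF s0 that] order_tendstoD(2)[OF r0 that]]
    by (simp add: eventually_sequentially)
  \<comment> \<open>The bound \<open>diff\<close> has four terms with the factor
    \<open>2 * K\<close> each, hence \<open>8 * K\<close>.\<close>
  then have "\<forall>j. \<exists>N0. \<forall>N\<ge>N0. s N < (1/4) ^ j / (8 * K) \<and> r N < (1/4) ^ j / (8 * K)"
    using K by simp
  then obtain N0 where N0: "\<And>j N. N \<ge> N0 j \<Longrightarrow> s N < (1/4) ^ j / (8 * K) \<and> r N < (1/4) ^ j / (8 * K)"
    by metis
  \<comment> \<open>Both \<open>h j\<close> and \<open>h (Suc j)\<close> lie beyond
    \<open>N0 j\<close>, and the summand \<open>j\<close> makes \<open>h\<close> unbounded.\<close>
  define h where "h j = j + (\<Sum>i\<le>j. N0 i)" for j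
  have h1: "N0 j \<le> h j" for j
    unfolding h_def using member_le_sum[of j "{..j}" N0] by simp
  have h2: "h j \<le> h (Suc j)" for j unfolding h_def by simp
  have hlim: "filterlim h at_top sequentially"
    by (rule filterlim_at_top_mono[OF filterlim_ident]) (simp add: h_def)
  have "\<exists>g. L2_on T g \<and> L2_tendsto T (\<lambda>j t. B (Q (h j) (w t), Q (h j) (w' t))) g"
  proof (rule L2_limit_exists)
    show "continuous_on {0..T} (\<lambda>t. B (Q (h j) (w t), Q (h j) (w' t)))" for j
      by (rule continuous_B[OF reg])
    fix j
    have a: "N0 j \<le> h (Suc j)" using h1[of j] h2[of j] by linarith
    have "integral {0..T} (\<lambda>t. (norm (B (Q (h (Suc j)) (w t), Q (h (Suc j)) (w' t)) - B (Q (h j) (w t), Q (h j) (w' t))))\<^sup>2)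
      \<le> K * (2 * s (h (Suc j)) + 2 * s (h j) + (2 * r (h (Suc j)) + 2 * r (h j)))" by (rule diff)
    also have "\<dots> \<le> K * (2 * ((1/4) ^ j / (8 * K)) + 2 * ((1/4) ^ j / (8 * K)) + (2 * ((1/4) ^ j / (8 * K)) + 2 * ((1/4) ^ j / (8 * K))))"
      using N0[OF a] N0[OF h1[of j]] K by (intro mult_left_mono add_mono) auto
    also have "\<dots> = (1/4) ^ j" using K by simp
    finally show "integral {0..T} (\<lambda>t. (norm (B (Q (h (Suc j)) (w t), Q (h (Suc j)) (w' t)) - B (Q (h j) (w t), Q (h j) (w' t))))\<^sup>2) \<le> (1/4) ^ j" .
  qed (use T in simp)
  then obtain g where g: "L2_on T g" "L2_tendsto T (\<lambda>j t. B (Q (h j) (w t), Q (h j) (w' t))) g" by blast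
  have "is_observation D A B T w w' g"
    unfolding is_observation_def
  proof (rule conjI[OF g(1)], rule exI[of _ f], rule exI[of _ "\<lambda>j t. Q (h j) (f t)"],
      rule exI[of _ "\<lambda>j t. Q (h j) (w t)"], rule exI[of _ "\<lambda>j t. Q (h j) (w' t)"], intro conjI allI reg f w g(2))
    have "(\<lambda>j. s (h j) / 2) \<longlonglongrightarrow> 0 / 2"
      by (intro tendsto_divide tendsto_const filterlim_compose[OF s0 hlim]) simp
    then show "(\<lambda>j. energy D A 1 (Q (h j) (w 0) - w 0, Q (h j) (w' 0) - w' 0)) \<longlonglongrightarrow> 0"
      by (simp add: energy_state s_def)
    show "L2_tendsto T (\<lambda>j t. Q (h j) (f t)) f"
      using QL2 filterlim_compose[OF r0 hlim] by (simp add: L2_tendsto_def r_def)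
  qed
  then show ?thesis unfolding observation_def by (rule someI[of "is_observation D A B T w w'"])
qed

lemma observationE:
  assumes w: "wave_solution D A {0..T} f w w'" and f: "continuous_on {0..T} f" and T: "T > 0"
  obtains fs ws ws' h where "\<And>m. regular_solution D A T (fs m) (ws m) (ws' m)"
    "(\<lambda>m. norm (state (ws m 0) (ws' m 0) - state (w 0) (w' 0))) \<longlonglongrightarrow> 0"
    "L2_on T h" "wave_solution D A {0..T} h w w'" "L2_tendsto T fs h"
    "L2_tendsto T (\<lambda>m t. B (ws m t, ws' m t)) (observation D A B T w w')"
    "L2_on T (observation D A B T w w')"
proof -
  from observation_exists[OF w L2_on_continuous[OF f] T]
  obtain h fs ws ws' where g: "L2_on T (observation D A B T w w')" and h: "L2_on T h" "wave_solution D A {0..T} h w w'"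
    and reg: "\<And>m. regular_solution D A T (fs m) (ws m) (ws' m)"
    and en: "(\<lambda>m. energy D A 1 (ws m 0 - w 0, ws' m 0 - w' 0)) \<longlonglongrightarrow> 0"
    and lims: "L2_tendsto T fs h" "L2_tendsto T (\<lambda>m t. B (ws m t, ws' m t)) (observation D A B T w w')"
    unfolding is_observation_def by blast
  have "state (ws m 0 - w 0) (ws' m 0 - w' 0) = state (ws m 0) (ws' m 0) - state (w 0) (w' 0)" for m
  proof -
    have "ws m 0 \<in> H1" "w 0 \<in> H1" using wave_H1[OF regular_wave[OF reg]] wave_H1[OF w] T by auto
    then show ?thesis by (simp add: half_diff)
  qed
  then have "(\<lambda>m. sqrt (2 * ((norm (state (ws m 0) (ws' m 0) - state (w 0) (w' 0)))\<^sup>2 / 2))) \<longlonglongrightarrow> sqrt (2 * 0)"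
    using en by (intro tendsto_intros) (simp add: energy_state)
  then show thesis using that[OF reg _ h lims g] by simp
qed

text \<open>The free solution with the same state at time \<open>a\<close> is observable. Its observation differs from
  that of \<open>w\<close> by the observation of a solution vanishing at time \<open>a\<close>, to which admissibility applies.\<close>

theorem window_observability:
  assumes obs: "observability_hyp D A B"
  shows "\<exists>T1>0. \<exists>c>0. \<forall>T f w w' a. T1 \<le> T \<longrightarrow> continuous_on {0..T} f \<longrightarrow> wave_solution D A {0..T} f w w' \<longrightarrow>
     a \<in> {0..T - T1} \<longrightarrow>
     energy D A 1 (w a, w' a) \<le> c * (integral {a..a + T1} (\<lambda>t. (norm (observation D A B T w w' t))\<^sup>2)
        + integral {a..a + T1} (\<lambda>t. (norm (f t))\<^sup>2))"
proof -
  obtain T0 where T0: "T0 > 0" and obsT: "\<And>T. T > T0 \<Longrightarrow> \<exists>R>0. \<forall>w w'. wave_solution D A {0..} (\<lambda>t. 0) w w' \<longrightarrow>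
        R * energy D A 1 (w 0, w' 0) \<le> integral {0..T} (\<lambda>t. (norm (observation D A B T w w' t))\<^sup>2)"
    using obs unfolding observability_hyp_def by blast
  \<comment> \<open>One fixed length beyond the observability time; its constants serve every
    \<open>T\<close> and every window.\<close>
  define T1 where "T1 = T0 + 1"
  have T1: "T1 > 0" using T0 by (simp add: T1_def)
  obtain R where R: "R > 0" and RR: "\<And>w w'. wave_solution D A {0..} (\<lambda>t. 0) w w' \<Longrightarrow>
        R * energy D A 1 (w 0, w' 0) \<le> integral {0..T1} (\<lambda>t. (norm (observation D A B T1 w w' t))\<^sup>2)"
    using obsT[of T1] T1_def by auto
  obtain K where K: "K > 0" and KK: "\<And>f w w'. regular_solution D A T1 f w w' \<Longrightarrow>
    integral {0..T1} (\<lambda>t. (norm (B (w t, w' t)))\<^sup>2)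
      \<le> K * ((norm (state (w 0) (w' 0)))\<^sup>2 + integral {0..T1} (\<lambda>t. (norm (f t))\<^sup>2))"
    using admissible_bound[OF T1] by blast
  define c where "c = (8 + 32 * K) / R"
  have c: "c > 0" using R K by (simp add: c_def)
  have "energy D A 1 (w a, w' a) \<le> c * (integral {a..a + T1} (\<lambda>t. (norm (observation D A B T w w' t))\<^sup>2)
        + integral {a..a + T1} (\<lambda>t. (norm (f t))\<^sup>2))"
    if T: "T1 \<le> T" and f: "continuous_on {0..T} f" and w: "wave_solution D A {0..T} f w w'"
      and aT: "a \<in> {0..T - T1}" for T f w w' a
  proof -
    have a: "0 \<le> a" "a + T1 \<le> T" and aI: "a \<in> {0..T}" using aT T1 by auto
    have T': "T > 0" using T T1 by simp
    have sub: "{a..a + T1} \<subseteq> {0..T}" using a by auto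
    define g where "g = observation D A B T w w'"
    obtain fs ws ws' h where reg: "\<And>m. regular_solution D A T (fs m) (ws m) (ws' m)"
      and s0: "(\<lambda>m. norm (state (ws m 0) (ws' m 0) - state (w 0) (w' 0))) \<longlonglongrightarrow> 0"
      and h: "L2_on T h" "wave_solution D A {0..T} h w w'"
      and fl: "L2_tendsto T fs h" and gl: "L2_tendsto T (\<lambda>m t. B (ws m t, ws' m t)) g" and g: "L2_on T g"
      by (rule observationE[OF w f T', folded g_def]) (rule that; simp)
    obtain z z' where z: "wave_solution D A {0..} (\<lambda>t. 0) z z'" and z0: "z 0 = w a" "z' 0 = w' a"
      using free_solution_exists[OF wave_H1[OF w aI], of "w' a"] by blast
    have z1: "wave_solution D A {0..T1} (\<lambda>t. 0) z z'" by (rule wave_solution_subset[OF z]) auto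
    define k where "k = observation D A B T1 z z'"
    obtain ps ys ys' p where yreg: "\<And>m. regular_solution D A T1 (ps m) (ys m) (ys' m)"
      and y0: "(\<lambda>m. norm (state (ys m 0) (ys' m 0) - state (z 0) (z' 0))) \<longlonglongrightarrow> 0"
      and p: "L2_on T1 p" "wave_solution D A {0..T1} p z z'"
      and pl: "L2_tendsto T1 ps p" and kl: "L2_tendsto T1 (\<lambda>m t. B (ys m t, ys' m t)) k" and k: "L2_on T1 k"
      by (rule observationE[OF z1 continuous_on_const T1, folded k_def]) (rule that; simp)
    \<comment> \<open>The observations over \<open>T\<close> and over \<open>T1\<close> are limits
      of unrelated approximations. \<open>B\<close> is compared on the difference of
      \<open>ys\<close> and the shifted \<open>ws\<close>, which is regular, and limits are taken
      only at the end.\<close>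
    define q where "q m t = fs m (a + t)" for m t
    define v where "v m t = ws m (a + t)" for m t
    define v' where "v' m t = ws' m (a + t)" for m t
    have vreg: "regular_solution D A T1 (q m) (v m) (v' m)" for m
      unfolding q_def v_def v'_def by (rule regular_solution_translate[OF reg a])
    have dreg: "regular_solution D A T1 (\<lambda>t. ps m t - q m t) (\<lambda>t. ys m t - v m t) (\<lambda>t. ys' m t - v' m t)" for m
      by (rule regular_solution_diff[OF yreg vreg])
    define fd where "fd m = integral {0..T} (\<lambda>t. (norm (fs m t - h t))\<^sup>2)" for m
    define gd where "gd m = integral {0..T} (\<lambda>t. (norm (B (ws m t, ws' m t) - g t))\<^sup>2)" for m
    define pd where "pd m = integral {0..T1} (\<lambda>t. (norm (ps m t - p t))\<^sup>2)" for m
    define kd where "kd m = integral {0..T1} (\<lambda>t. (norm (B (ys m t, ys' m t) - k t))\<^sup>2)" for m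
    have lims: "fd \<longlonglongrightarrow> 0" "gd \<longlonglongrightarrow> 0" "pd \<longlonglongrightarrow> 0" "kd \<longlonglongrightarrow> 0"
      using fl gl pl kl by (simp_all add: fd_def[abs_def] gd_def[abs_def] pd_def[abs_def] kd_def[abs_def] L2_tendsto_def)
    have fi: "(\<lambda>t. (norm (fs m t - h t))\<^sup>2) integrable_on {0..T}"
      and gi: "(\<lambda>t. (norm (B (ws m t, ws' m t) - g t))\<^sup>2) integrable_on {0..T}"
      and pi: "(\<lambda>t. (norm (ps m t - p t))\<^sup>2) integrable_on {0..T1}"
      and ki: "(\<lambda>t. (norm (B (ys m t, ys' m t) - k t))\<^sup>2) integrable_on {0..T1}" for m
      using fl gl pl kl by (simp_all add: L2_tendsto_def)
    define sd where "sd m = (norm (state (ys m 0) (ys' m 0) - state (z 0) (z' 0)))\<^sup>2" for m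
    define td where "td m = (norm (state (ws m 0) (ws' m 0) - state (w 0) (w' 0)))\<^sup>2" for m
    have slims: "sd \<longlonglongrightarrow> 0" "td \<longlonglongrightarrow> 0"
      using tendsto_power[OF y0, where n = 2] tendsto_power[OF s0, where n = 2]
      by (simp_all add: sd_def[abs_def] td_def[abs_def])
    have td_a: "(norm (state (v m 0) (v' m 0) - state (w a) (w' a)))\<^sup>2 \<le> 2 * td m + 2 * (T * fd m)" for m
    proof -
      have dw: "wave_solution D A {0..T} (\<lambda>t. fs m t - h t) (\<lambda>t. ws m t - w t) (\<lambda>t. ws' m t - w' t)"
        by (rule wave_solution_diff[OF regular_wave[OF reg] h(2)]) auto
      have st: "state (ws m t - w t) (ws' m t - w' t) = state (ws m t) (ws' m t) - state (w t) (w' t)"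
        if "t \<in> {0..T}" for t
        using half_diff[OF wave_H1[OF regular_wave[OF reg] that] wave_H1[OF w that]] by simp
      have "(norm (state (ws m a - w a) (ws' m a - w' a)))\<^sup>2 \<le> 2 * (norm (state (ws m 0 - w 0) (ws' m 0 - w' 0)))\<^sup>2
         + 2 * (\<bar>a - 0\<bar> * integral {min 0 a..max 0 a} (\<lambda>\<tau>. (norm (fs m \<tau> - h \<tau>))\<^sup>2))"
        by (rule L2_energy_estimate[OF dw L2_on_diff[OF regular_L2[OF reg] h(1)] _ aI]) (use T' in simp)
      also have "\<bar>a - 0\<bar> * integral {min 0 a..max 0 a} (\<lambda>\<tau>. (norm (fs m \<tau> - h \<tau>))\<^sup>2) \<le> T * fd m"
        unfolding fd_def using aI
        by (intro mult_mono integral_square_mono_set[OF fi] integral_nonneg integrable_subinterval_real[OF fi]) auto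
      finally show ?thesis using st[of a] st[of 0] aI T' by (simp add: td_def v_def v'_def)
    qed
    have state_d: "(norm (state (ys m 0 - v m 0) (ys' m 0 - v' m 0)))\<^sup>2 \<le> 2 * sd m + 2 * (2 * td m + 2 * (T * fd m))" for m
    proof -
      have "state (ys m 0 - v m 0) (ys' m 0 - v' m 0)
         = (state (ys m 0) (ys' m 0) - state (z 0) (z' 0)) + - (state (v m 0) (v' m 0) - state (w a) (w' a))"
      proof -
        have "ys m 0 \<in> H1" "v m 0 \<in> H1"
          using wave_H1[OF regular_wave[OF yreg]] wave_H1[OF regular_wave[OF vreg]] T1 by auto
        then show ?thesis by (simp add: half_diff z0)
      qed
      then have "(norm (state (ys m 0 - v m 0) (ys' m 0 - v' m 0)))\<^sup>2
         \<le> 2 * (norm (state (ys m 0) (ys' m 0) - state (z 0) (z' 0)))\<^sup>2 + 2 * (norm (state (v m 0) (v' m 0) - state (w a) (w' a)))\<^sup>2"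
        by (metis norm_minus_cancel norm_square_add_le)
      then show ?thesis using td_a[of m] by (simp add: sd_def)
    qed
    define F where "F = integral {a..a + T1} (\<lambda>t. (norm (f t))\<^sup>2)"
    define Gi where "Gi = integral {a..a + T1} (\<lambda>t. (norm (g t))\<^sup>2)"
    have ff: "(\<lambda>t. (norm (f t))\<^sup>2) integrable_on {a..a + T1}"
      by (intro integrable_continuous_real continuous_intros continuous_on_subset[OF f sub])
    \<comment> \<open>The limit sources \<open>p\<close> and \<open>h\<close> agree with 0 and
      \<open>f\<close> only up to null sets, the second of which has to be shifted by
      \<open>a\<close>.\<close>
    have source: "integral {0..T1} (\<lambda>t. (norm (ps m t - q m t))\<^sup>2) \<le> 4 * pd m + 8 * F + 8 * fd m" for m
    proof -
      obtain N1 where N1: "negligible N1" "\<And>t. t \<in> {0..T1} \<Longrightarrow> t \<notin> N1 \<Longrightarrow> p t = 0"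
        using source_unique[OF p(2) z1] by blast
      obtain N2 where N2: "negligible N2" "\<And>t. t \<in> {0..T} \<Longrightarrow> t \<notin> N2 \<Longrightarrow> h t = f t"
        using source_unique[OF h(2) w] by blast
      have i0: "(\<lambda>t. (norm (ps m t - q m t))\<^sup>2) integrable_on {0..T1}"
        using regular_L2[OF dreg] by (simp add: L2_on_def)
      define N where "N = N1 \<union> (\<lambda>t. t - a) ` N2"
      have N: "negligible N" unfolding N_def
        using negligible_translation[OF N2(1), of "- a"] N1 by (simp add: negligible_Un)
      have b: "(norm (ps m t - q m t))\<^sup>2 \<le> 2 * (norm (ps m t - p t))\<^sup>2 + (4 * (norm (f (a + t)))\<^sup>2 + 4 * (norm (fs m (a + t) - h (a + t)))\<^sup>2)"
        if t: "t \<in> {0..T1} - N" for t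
      proof -
        have n2: "a + t \<notin> N2"
        proof
          assume "a + t \<in> N2"
          then have "(a + t) - a \<in> (\<lambda>t. t - a) ` N2" by (rule imageI)
          then show False using t by (simp add: N_def)
        qed
        have e: "p t = 0" "h (a + t) = f (a + t)" using N1(2)[of t] N2(2)[of "a + t"] t a n2 by (auto simp: N_def)
        have "(norm (ps m t + - q m t))\<^sup>2 \<le> 2 * (norm (ps m t))\<^sup>2 + 2 * (norm (q m t))\<^sup>2"
          using norm_square_add_le[of "ps m t" "- q m t"] by simp
        also have "(norm (q m t))\<^sup>2 \<le> 2 * (norm (f (a + t)))\<^sup>2 + 2 * (norm (q m t - f (a + t)))\<^sup>2"
          using norm_square_diff_le[of "q m t" "f (a + t)"] by simp
        finally show ?thesis by (simp add: e q_def)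
      qed
      have i1: "(\<lambda>t. (norm (f (a + t)))\<^sup>2) integrable_on {0..T1}"
        using ff integrable_translate[of "\<lambda>t. (norm (f t))\<^sup>2" a T1] by simp
      have i2: "(\<lambda>t. (norm (fs m (a + t) - h (a + t)))\<^sup>2) integrable_on {0..T1}"
        using integrable_translate[of "\<lambda>t. (norm (fs m t - h t))\<^sup>2" a T1] integrable_subinterval_real[OF fi sub] by simp
      have i3: "(\<lambda>t. 2 * (norm (ps m t - p t))\<^sup>2 + (4 * (norm (f (a + t)))\<^sup>2 + 4 * (norm (fs m (a + t) - h (a + t)))\<^sup>2)) integrable_on {0..T1}"
        by (intro integrable_add integrable_on_mult_right i1 i2 pi)
      have "integral {0..T1} (\<lambda>t. (norm (ps m t - q m t))\<^sup>2)
        \<le> integral {0..T1} (\<lambda>t. 2 * (norm (ps m t - p t))\<^sup>2 + (4 * (norm (f (a + t)))\<^sup>2 + 4 * (norm (fs m (a + t) - h (a + t)))\<^sup>2))"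
        by (rule integral_le_AE_negligible[OF i0 i3 N b])
      also have "\<dots> = 2 * pd m + (4 * F + 4 * integral {0..T1} (\<lambda>t. (norm (fs m (a + t) - h (a + t)))\<^sup>2))"
        using integral_translate[where h = "\<lambda>t. (norm (f t))\<^sup>2" and a = a and c = T1]
        by (simp add: integral_add integrable_add integrable_on_mult_right i1 i2 pi pd_def F_def)
      also have "integral {0..T1} (\<lambda>t. (norm (fs m (a + t) - h (a + t)))\<^sup>2) \<le> fd m"
        unfolding integral_translate[where h = "\<lambda>t. (norm (fs m t - h t))\<^sup>2"] fd_def
        by (rule integral_square_mono_set[OF fi]) (use a in auto)
      finally have le: "integral {0..T1} (\<lambda>t. (norm (ps m t - q m t))\<^sup>2) \<le> 2 * pd m + (4 * F + 4 * fd m)" by simp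
      have "0 \<le> pd m" "0 \<le> fd m" "0 \<le> F"
        unfolding pd_def fd_def F_def by (intro integral_nonneg pi fi ff; simp)+
      then show ?thesis using le by linarith
    qed
    have obs_v: "integral {0..T1} (\<lambda>t. (norm (B (v m t, v' m t)))\<^sup>2) \<le> 2 * gd m + 2 * Gi" for m
    proof -
      have g2: "(\<lambda>t. (norm (g t))\<^sup>2) integrable_on {a..a + T1}"
        by (rule integrable_subinterval_real[OF _ sub]) (use g in \<open>simp add: L2_on_def\<close>)
      have b2: "(\<lambda>t. (norm (B (ws m t, ws' m t)))\<^sup>2) integrable_on {a..a + T1}"
        by (intro integrable_continuous_real continuous_intros continuous_on_subset[OF continuous_B[OF reg] sub])
      have "integral {0..T1} (\<lambda>t. (norm (B (v m t, v' m t)))\<^sup>2) = integral {a..a + T1} (\<lambda>t. (norm (B (ws m t, ws' m t)))\<^sup>2)"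
        unfolding v_def v'_def by (rule integral_translate)
      also have "\<dots> \<le> 2 * integral {a..a + T1} (\<lambda>t. (norm (B (ws m t, ws' m t) - g t))\<^sup>2) + 2 * Gi"
        unfolding Gi_def by (rule integral_norm_square_diff_le[OF b2 g2 integrable_subinterval_real[OF gi sub]])
      also have "integral {a..a + T1} (\<lambda>t. (norm (B (ws m t, ws' m t) - g t))\<^sup>2) \<le> gd m"
        unfolding gd_def by (rule integral_square_mono_set[OF gi]) (use a in auto)
      finally show ?thesis by simp
    qed
    \<comment> \<open>Three estimates of a square of a sum lead from \<open>k\<close> over the
      observations of \<open>ys\<close> and \<open>v\<close> to \<open>g\<close>; admissibility
      bounds the middle difference.\<close>
    have main: "R * energy D A 1 (w a, w' a) \<le> 2 * kd m + 2 * (2 * (K * ((2 * sd m + 2 * (2 * td m + 2 * (T * fd m)))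
        + (4 * pd m + 8 * F + 8 * fd m))) + 2 * (2 * gd m + 2 * Gi))" for m
    proof -
      have k2: "(\<lambda>t. (norm (k t))\<^sup>2) integrable_on {0..T1}" using k by (simp add: L2_on_def)
      have by2: "(\<lambda>t. (norm (B (ys m t, ys' m t)))\<^sup>2) integrable_on {0..T1}"
        and bv2: "(\<lambda>t. (norm (B (v m t, v' m t)))\<^sup>2) integrable_on {0..T1}"
        and bd2: "(\<lambda>t. (norm (B (ys m t, ys' m t) - B (v m t, v' m t)))\<^sup>2) integrable_on {0..T1}"
        by (intro integrable_continuous_real continuous_intros continuous_B[OF yreg] continuous_B[OF vreg])+
      have "R * energy D A 1 (w a, w' a) \<le> integral {0..T1} (\<lambda>t. (norm (k t))\<^sup>2)"
        using RR[OF z] by (simp add: z0 k_def)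
      also have "\<dots> \<le> 2 * integral {0..T1} (\<lambda>t. (norm (k t - B (ys m t, ys' m t)))\<^sup>2)
          + 2 * integral {0..T1} (\<lambda>t. (norm (B (ys m t, ys' m t)))\<^sup>2)"
        using ki[of m] by (intro integral_norm_square_diff_le[OF k2 by2]) (simp add: norm_minus_commute)
      also have "integral {0..T1} (\<lambda>t. (norm (k t - B (ys m t, ys' m t)))\<^sup>2) = kd m"
        by (simp add: kd_def norm_minus_commute)
      also have "integral {0..T1} (\<lambda>t. (norm (B (ys m t, ys' m t)))\<^sup>2)
        \<le> 2 * integral {0..T1} (\<lambda>t. (norm (B (ys m t, ys' m t) - B (v m t, v' m t)))\<^sup>2)
          + 2 * integral {0..T1} (\<lambda>t. (norm (B (v m t, v' m t)))\<^sup>2)"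
        by (rule integral_norm_square_diff_le[OF by2 bv2 bd2])
      also have "integral {0..T1} (\<lambda>t. (norm (B (ys m t, ys' m t) - B (v m t, v' m t)))\<^sup>2)
          = integral {0..T1} (\<lambda>t. (norm (B (ys m t - v m t, ys' m t - v' m t)))\<^sup>2)"
        by (rule integral_cong) (simp add: B_diff regular_H2[OF yreg] regular_H2[OF vreg])
      also have "\<dots> \<le> K * ((norm (state (ys m 0 - v m 0) (ys' m 0 - v' m 0)))\<^sup>2
          + integral {0..T1} (\<lambda>t. (norm (ps m t - q m t))\<^sup>2))"
        by (rule KK[OF dreg])
      also have "\<dots> \<le> K * ((2 * sd m + 2 * (2 * td m + 2 * (T * fd m))) + (4 * pd m + 8 * F + 8 * fd m))"
        using K by (intro mult_left_mono add_mono state_d source) auto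
      also have "integral {0..T1} (\<lambda>t. (norm (B (v m t, v' m t)))\<^sup>2) \<le> 2 * gd m + 2 * Gi" by (rule obs_v)
      finally show ?thesis by simp
    qed
    \<comment> \<open>The approximation errors vanish and \<open>32 * K * F + 8 * Gi\<close>
      remains, which is the origin of \<open>c\<close>.\<close>
    have "(\<lambda>m. 2 * kd m + 2 * (2 * (K * ((2 * sd m + 2 * (2 * td m + 2 * (T * fd m)))
        + (4 * pd m + 8 * F + 8 * fd m))) + 2 * (2 * gd m + 2 * Gi)))
      \<longlonglongrightarrow> 2 * 0 + 2 * (2 * (K * ((2 * 0 + 2 * (2 * 0 + 2 * (T * 0)))
        + (4 * 0 + 8 * F + 8 * 0))) + 2 * (2 * 0 + 2 * Gi))"
      by (intro tendsto_intros lims slims)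
    then have "R * energy D A 1 (w a, w' a) \<le> 2 * 0 + 2 * (2 * (K * ((2 * 0 + 2 * (2 * 0 + 2 * (T * 0)))
        + (4 * 0 + 8 * F + 8 * 0))) + 2 * (2 * 0 + 2 * Gi))"
      by (rule LIMSEQ_le_const) (use main in blast)
    then have "R * energy D A 1 (w a, w' a) \<le> 32 * K * F + 8 * Gi" by simp
    also have "\<dots> \<le> (8 + 32 * K) * (Gi + F)"
    proof -
      have "0 \<le> F" unfolding F_def by (rule integral_nonneg[OF ff]) simp
      moreover have "0 \<le> Gi" unfolding Gi_def
        by (rule integral_nonneg[OF integrable_subinterval_real[OF _ sub]]) (use g in \<open>simp_all add: L2_on_def\<close>)
      ultimately have "0 \<le> K * Gi" "0 \<le> F" using K by auto
      then show ?thesis by (simp add: algebra_simps)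
    qed
    finally have "energy D A 1 (w a, w' a) \<le> c * (Gi + F)" using R by (simp add: c_def field_simps)
    then show ?thesis by (simp add: Gi_def F_def g_def)
  qed
  then show ?thesis using T1 c by blast
qed

end

end

section \<open>The cascade\<close>

text \<open>Consecutive windows starting at 0 leave a remainder shorter than \<open>T1\<close>,
  which lies in the last window \<open>{T - T1..T}\<close>. The two contributions may overlap, hence
  the factor 2.\<close>

lemma integral_le_by_windows:
  fixes g h :: "real \<Rightarrow> real"
  assumes g: "g integrable_on {0..T}" "\<And>t. 0 \<le> g t" and h: "h integrable_on {0..T}" "\<And>t. 0 \<le> h t"
    and T1: "0 < T1" "T1 \<le> T"
    and win: "\<And>a. a \<in> {0..T - T1} \<Longrightarrow> integral {a..a + T1} h \<le> integral {a..a + T1} g"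
  shows "integral {0..T} h \<le> 2 * integral {0..T} g"
proof -
  have add: "integral {0..b} u = integral {0..a} u + integral {a..b} u"
    if "u integrable_on {0..T}" "0 \<le> a" "a \<le> b" "b \<le> T" for u :: "real \<Rightarrow> real" and a b
    by (rule Henstock_Kurzweil_Integration.integral_combine[symmetric])
       (use that integrable_subinterval_real[OF that(1), of 0 b] in auto)
  have steps: "integral {0..real k * T1} h \<le> integral {0..real k * T1} g" if "real k * T1 \<le> T" for k
    using that
  proof (induction k)
    case (Suc k)
    have k: "real k * T1 + T1 \<le> T" using Suc.prems by (simp add: algebra_simps)
    then have kT: "real k * T1 \<le> T" "0 \<le> real k * T1" using T1 by auto
    have "integral {0..real k * T1 + T1} h = integral {0..real k * T1} h + integral {real k * T1..real k * T1 + T1} h"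
      by (rule add[OF h(1)]) (use k kT T1 in auto)
    also have "\<dots> \<le> integral {0..real k * T1} g + integral {real k * T1..real k * T1 + T1} g"
      by (intro add_mono Suc.IH win) (use k kT in auto)
    also have "\<dots> = integral {0..real k * T1 + T1} g"
      by (rule add[OF g(1), symmetric]) (use k kT T1 in auto)
    finally show ?case by (simp add: algebra_simps)
  qed simp
  define N where "N = nat \<lfloor>T / T1\<rfloor>"
  have N: "real N \<le> T / T1" "T / T1 < real N + 1" using T1 by (auto simp: N_def)
  have N': "real N * T1 \<le> T" "T - T1 \<le> real N * T1"
    using N T1 by (simp_all add: field_simps)
  have gsub: "integral {a..b} g \<le> integral {0..T} g" if "0 \<le> a" "b \<le> T" for a b
    by (rule integral_square_mono_set[OF g that])
  have "integral {0..T} h = integral {0..real N * T1} h + integral {real N * T1..T} h"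
    by (rule add[OF h(1)]) (use N' T1 in auto)
  also have "integral {real N * T1..T} h \<le> integral {T - T1..T} h"
    by (rule integral_subset_le)
       (use N' T1 h integrable_subinterval_real[OF h(1), of "real N * T1" T]
          integrable_subinterval_real[OF h(1), of "T - T1" T] in auto)
  also have "\<dots> \<le> integral {T - T1..T} g" using win[of "T - T1"] T1 by simp
  also have "\<dots> \<le> integral {0..T} g" by (rule gsub) (use T1 in auto)
  also have "integral {0..real N * T1} h \<le> integral {0..real N * T1} g" by (rule steps[OF N'(1)])
  also have "\<dots> \<le> integral {0..T} g" by (rule gsub) (use N' in auto)
  finally show ?thesis by simp
qed

text \<open>\<open>E\<close> is the energy of the observed component, \<open>\<phi>\<close> the square of its source, \<open>X\<close> the coupling integral.
  Over windows of length \<open>\<delta>T\<close> with small \<open>\<delta>\<close> the end point energies in the bound for \<open>X\<close> are replaced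
  by averages, at the price of a multiple of \<open>X\<close> that can be absorbed.\<close>

lemma energy_averaging:
  fixes b c1 c2 c T1 :: real
  assumes pos: "b > 0" "c1 > 0" "c2 > 0" "c > 0" "T1 > 0"
  shows "\<exists>Ts\<ge>1. \<exists>K>0. \<forall>(E :: real \<Rightarrow> real) \<phi> g X T.
     T > Ts \<longrightarrow> continuous_on {0..T} E \<longrightarrow> (\<forall>t. 0 \<le> E t) \<longrightarrow> continuous_on {0..T} \<phi> \<longrightarrow> (\<forall>t. 0 \<le> \<phi> t) \<longrightarrow>
     g integrable_on {0..T} \<longrightarrow> (\<forall>t. 0 \<le> g t) \<longrightarrow> 0 \<le> X \<longrightarrow> integral {0..T} \<phi> \<le> b * X \<longrightarrow>
     (\<forall>s\<in>{0..T}. \<forall>t\<in>{0..T}. E t \<le> 2 * E s + \<bar>t - s\<bar> * integral {min s t..max s t} \<phi>) \<longrightarrow>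
     X \<le> c1 / T * (E 0 + E T) + c2 / T\<^sup>2 * integral {0..T} E \<longrightarrow>
     (\<forall>a\<in>{0..T - T1}. E a \<le> c * (integral {a..a + T1} g + integral {a..a + T1} \<phi>)) \<longrightarrow>
     X \<le> K / T\<^sup>2 * integral {0..T} g \<and> (\<forall>s\<in>{0..T}. E s \<le> K / T * integral {0..T} g)"
proof -
  \<comment> \<open>Averaging over the two ends feeds \<open>2 * c1 * \<delta> * b\<close> times
    \<open>X\<close> back into the bound for \<open>X\<close>; this choice makes it at most half of
    \<open>X\<close>.\<close>
  define \<delta> where "\<delta> = min 1 (1 / (4 * c1 * b))"
  have \<delta>: "0 < \<delta>" "\<delta> \<le> 1" "2 * c1 * \<delta> * b \<le> 1 / 2"
  proof -
    show "0 < \<delta>" "\<delta> \<le> 1" using pos by (auto simp: \<delta>_def)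
    have "2 * c1 * b * \<delta> \<le> 2 * c1 * b * (1 / (4 * c1 * b))" using pos by (intro mult_left_mono) (auto simp: \<delta>_def)
    also have "\<dots> = 1 / 2" using pos by simp
    finally show "2 * c1 * \<delta> * b \<le> 1 / 2" by (simp add: ac_simps)
  qed
  \<comment> \<open>\<open>c3\<close> comes from absorbing that half, \<open>c4\<close> bounds the
    energy over one window by observation and source, and \<open>Ts\<close> makes the later feedback
    \<open>2 * c4 * b * X\<close> at most half of the integral of \<open>E\<close>.\<close>
  define c3 where "c3 = 2 * (4 * c1 / \<delta> + c2)"
  define c4 where "c4 = T1 * (2 * c + T1)"
  define Ts where "Ts = max (max 1 T1) (4 * c4 * b * c3)"
  define K where "K = 4 * c3 * c4 + 8 * c4 + 4 * b * c3 * c4"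
  have c3: "c3 > 0" using pos \<delta> by (simp add: c3_def add_pos_pos)
  have c4: "c4 > 0" using pos by (simp add: c4_def add_pos_pos)
  have K: "K > 0" using pos c3 c4 by (simp add: K_def add_pos_pos)
  have main: "X \<le> K / T\<^sup>2 * integral {0..T} g \<and> (\<forall>s\<in>{0..T}. E s \<le> K / T * integral {0..T} g)"
    if T: "T > Ts" and E: "continuous_on {0..T} E" "\<And>t. 0 \<le> E t"
      and \<phi>: "continuous_on {0..T} \<phi>" "\<And>t. 0 \<le> \<phi> t"
      and g: "g integrable_on {0..T}" "\<And>t. 0 \<le> g t" and X: "0 \<le> X" "integral {0..T} \<phi> \<le> b * X"
      and osc: "\<And>s t. s \<in> {0..T} \<Longrightarrow> t \<in> {0..T} \<Longrightarrow> E t \<le> 2 * E s + \<bar>t - s\<bar> * integral {min s t..max s t} \<phi>"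
      and XE: "X \<le> c1 / T * (E 0 + E T) + c2 / T\<^sup>2 * integral {0..T} E"
      and win: "\<And>a. a \<in> {0..T - T1} \<Longrightarrow> E a \<le> c * (integral {a..a + T1} g + integral {a..a + T1} \<phi>)"
    for E \<phi> g :: "real \<Rightarrow> real" and X T
  proof -
    have T1T: "T \<ge> 1" "T1 \<le> T" "4 * c4 * b * c3 \<le> T" using T by (auto simp: Ts_def)
    have Ei: "E integrable_on {0..T}" and \<phi>i: "\<phi> integrable_on {0..T}"
      by (auto intro: integrable_continuous_real E \<phi>)
    define I where "I = integral {0..T} E"
    define N where "N = integral {0..T} g"
    have I0: "0 \<le> I" unfolding I_def by (rule integral_nonneg[OF Ei]) (rule E)
    have N0: "0 \<le> N" unfolding N_def by (rule integral_nonneg[OF g(1)]) (rule g)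
    \<comment> \<open>The oscillation bound is integrated in one of its two times, which trades a
      pointwise energy for an integral.\<close>
    have avg: "(b' - a) * E s \<le> 2 * I + (b' - a)\<^sup>2 * (b * X)" if s: "0 \<le> a" "a \<le> s" "s \<le> b'" "b' \<le> T" for a b' s
    proof -
      have sub: "E integrable_on {a..b'}" by (rule integrable_subinterval_real[OF Ei]) (use s in auto)
      have "(b' - a) * E s = integral {a..b'} (\<lambda>t. E s)" using s by simp
      also have "\<dots> \<le> integral {a..b'} (\<lambda>t. 2 * E t + (b' - a) * (b * X))"
      proof (rule integral_le)
        show "(\<lambda>t. 2 * E t + (b' - a) * (b * X)) integrable_on {a..b'}"
          by (intro integrable_add integrable_on_mult_right sub) auto
        fix t assume t: "t \<in> {a..b'}"
        have "E s \<le> 2 * E t + \<bar>s - t\<bar> * integral {min t s..max t s} \<phi>" by (rule osc) (use s t in auto)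
        also have "\<bar>s - t\<bar> * integral {min t s..max t s} \<phi> \<le> (b' - a) * (b * X)"
        proof (rule mult_mono)
          have "integral {min t s..max t s} \<phi> \<le> integral {0..T} \<phi>"
            by (rule integral_square_mono_set[OF \<phi>i \<phi>(2)]) (use s t in auto)
          then show "integral {min t s..max t s} \<phi> \<le> b * X" using X by simp
          show "0 \<le> integral {min t s..max t s} \<phi>"
            by (rule integral_nonneg[OF integrable_subinterval_real[OF \<phi>i]]) (use s t \<phi> in auto)
        qed (use s t in auto)
        finally show "E s \<le> 2 * E t + (b' - a) * (b * X)" by simp
      qed auto
      also have "\<dots> = 2 * integral {a..b'} E + (b' - a)\<^sup>2 * (b * X)"
      proof -
        have "integral {a..b'} (\<lambda>t. 2 * E t + (b' - a) * (b * X))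
            = integral {a..b'} (\<lambda>t. 2 * E t) + integral {a..b'} (\<lambda>t. (b' - a) * (b * X))"
          by (rule integral_add) (auto intro!: integrable_on_mult_right sub)
        then show ?thesis using s by (simp add: power2_eq_square)
      qed
      also have "integral {a..b'} E \<le> I"
        unfolding I_def by (rule integral_square_mono_set[OF Ei E(2)]) (use s in auto)
      finally show ?thesis by simp
    qed
    have ends: "E s \<le> 2 / (\<delta> * T) * I + \<delta> * T * (b * X)" if s: "s = 0 \<or> s = T" for s
    proof -
      have l: "0 < \<delta> * T" "\<delta> * T \<le> T" using \<delta> T1T by (auto simp: mult_left_le_one_le)
      have "\<delta> * T * E s \<le> 2 * I + (\<delta> * T)\<^sup>2 * (b * X)"
        using s avg[of 0 0 "\<delta> * T"] avg[of "T - \<delta> * T" T T] l by auto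
      then have "E s \<le> (2 * I + (\<delta> * T)\<^sup>2 * (b * X)) / (\<delta> * T)"
        using l by (simp add: pos_le_divide_eq mult.commute)
      also have "\<dots> = 2 / (\<delta> * T) * I + \<delta> * T * (b * X)"
        using l by (simp add: power2_eq_square add_divide_distrib)
      finally show ?thesis .
    qed
    have X1: "X \<le> c3 / T\<^sup>2 * I"
    proof -
      have "X \<le> c1 / T * (E 0 + E T) + c2 / T\<^sup>2 * I" using XE by (simp add: I_def)
      also have "\<dots> \<le> c1 / T * (2 * (2 / (\<delta> * T) * I + \<delta> * T * (b * X))) + c2 / T\<^sup>2 * I"
      proof -
        have "E 0 + E T \<le> 2 * (2 / (\<delta> * T) * I + \<delta> * T * (b * X))"
          unfolding mult_2 by (intro add_mono ends) auto
        then show ?thesis using pos T1T by (intro add_right_mono mult_left_mono) auto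
      qed
      also have "\<dots> = (4 * c1 / \<delta> + c2) / T\<^sup>2 * I + (2 * c1 * \<delta> * b) * X"
        using T1T \<delta> by (simp add: power2_eq_square field_simps)
      also have "\<dots> \<le> (4 * c1 / \<delta> + c2) / T\<^sup>2 * I + 1 / 2 * X"
        using \<delta>(3) X by (intro add_left_mono mult_right_mono) auto
      finally have "X \<le> 2 * ((4 * c1 / \<delta> + c2) / T\<^sup>2 * I)" by linarith
      also have "\<dots> = c3 / T\<^sup>2 * I" by (simp add: c3_def)
      finally show ?thesis .
    qed
    have I1: "I \<le> 2 * (c4 * (N + b * X))"
    proof -
      have gp: "(\<lambda>t. c4 * (g t + \<phi> t)) integrable_on {0..T}"
        by (intro integrable_on_mult_right integrable_add g \<phi>i)
      have "I \<le> 2 * integral {0..T} (\<lambda>t. c4 * (g t + \<phi> t))"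
        unfolding I_def
      proof (rule integral_le_by_windows[OF gp _ Ei E(2) pos(5) T1T(2)])
        show "0 \<le> c4 * (g t + \<phi> t)" for t using c4 g \<phi> by (simp add: add_nonneg_nonneg)
        fix a assume a: "a \<in> {0..T - T1}"
        have sub: "{a..a + T1} \<subseteq> {0..T}" using a by auto
        define G F where "G = integral {a..a + T1} g" and "F = integral {a..a + T1} \<phi>"
        have G0: "0 \<le> G" "0 \<le> F" unfolding G_def F_def
          by (intro integral_nonneg integrable_subinterval_real[OF g(1) sub] g integrable_subinterval_real[OF \<phi>i sub] \<phi>)+
        have "integral {a..a + T1} E \<le> integral {a..a + T1} (\<lambda>t. 2 * E a + T1 * F)"
        proof (rule integral_le)
          show "E integrable_on {a..a + T1}" by (rule integrable_subinterval_real[OF Ei sub])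
          fix t assume t: "t \<in> {a..a + T1}"
          have "E t \<le> 2 * E a + \<bar>t - a\<bar> * integral {min a t..max a t} \<phi>" by (rule osc) (use a t pos in auto)
          also have "\<bar>t - a\<bar> * integral {min a t..max a t} \<phi> \<le> T1 * F"
          proof (rule mult_mono)
            show "integral {min a t..max a t} \<phi> \<le> F" unfolding F_def
              by (rule integral_subset_le)
                 (use t a \<phi> integrable_subinterval_real[OF \<phi>i sub] integrable_subinterval_real[OF \<phi>i, of "min a t" "max a t"] in auto)
            show "0 \<le> integral {min a t..max a t} \<phi>"
              by (rule integral_nonneg[OF integrable_subinterval_real[OF \<phi>i]]) (use a t \<phi> in auto)
          qed (use t pos in auto)
          finally show "E t \<le> 2 * E a + T1 * F" by simp
        qed auto
        also have "\<dots> = T1 * (2 * E a + T1 * F)" using pos by simp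
        also have "\<dots> \<le> T1 * (2 * (c * (G + F)) + T1 * (G + F))"
          using win[OF a] pos G0 by (intro mult_left_mono add_mono) (auto simp: G_def F_def)
        also have "\<dots> = c4 * (G + F)" by (simp add: c4_def algebra_simps)
        also have "\<dots> = integral {a..a + T1} (\<lambda>t. c4 * (g t + \<phi> t))"
          unfolding G_def F_def
          by (simp add: integral_add integrable_subinterval_real[OF g(1) sub] integrable_subinterval_real[OF \<phi>i sub])
        finally show "integral {a..a + T1} E \<le> integral {a..a + T1} (\<lambda>t. c4 * (g t + \<phi> t))" .
      qed
      also have "integral {0..T} (\<lambda>t. c4 * (g t + \<phi> t)) = c4 * (N + integral {0..T} \<phi>)"
        unfolding N_def by (simp add: integral_add g \<phi>i)
      also have "\<dots> \<le> c4 * (N + b * X)" using X c4 by (intro mult_left_mono add_left_mono) auto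
      finally show ?thesis by simp
    qed
    \<comment> \<open>\<open>I1\<close> and \<open>X1\<close> bound \<open>I\<close> and
      \<open>X\<close> by each other; the threshold on \<open>T\<close> closes the loop.\<close>
    have I2: "I \<le> 4 * c4 * N"
    proof -
      have "T \<le> T\<^sup>2" using T1T by (simp add: power2_eq_square)
      then have TT: "4 * c4 * b * c3 \<le> T\<^sup>2" using T1T by simp
      have "2 * c4 * b * X \<le> 2 * c4 * b * (c3 / T\<^sup>2 * I)"
        using X1 c4 pos by (intro mult_left_mono) auto
      also have "\<dots> = (4 * c4 * b * c3) / T\<^sup>2 * (I / 2)" by simp
      also have "\<dots> \<le> 1 * (I / 2)" using TT T1T I0 by (intro mult_right_mono) (auto simp: divide_le_eq)
      finally show ?thesis using I1 by (simp add: algebra_simps)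
    qed
    have X2: "X \<le> 4 * c3 * c4 / T\<^sup>2 * N"
    proof -
      have "c3 / T\<^sup>2 * I \<le> c3 / T\<^sup>2 * (4 * c4 * N)" using I2 c3 by (intro mult_left_mono) auto
      then show ?thesis using X1 by (simp add: ac_simps)
    qed
    have "X \<le> K / T\<^sup>2 * N"
    proof -
      have "4 * c3 * c4 / T\<^sup>2 * N \<le> K / T\<^sup>2 * N"
        unfolding K_def using pos c3 c4 N0 by (intro mult_right_mono divide_right_mono) auto
      then show ?thesis using X2 by simp
    qed
    moreover have "E s \<le> K / T * N" if s: "s \<in> {0..T}" for s
    proof -
      \<comment> \<open>Averaging over all of \<open>{0..T}\<close>: the bound \<open>X2\<close>
        offsets the factor \<open>T\<^sup>2\<close>, and one power of \<open>1 / T\<close>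
        remains.\<close>
      have "T * E s \<le> 2 * I + T\<^sup>2 * (b * X)" using avg[of 0 s T] s by simp
      also have "\<dots> \<le> 2 * (4 * c4 * N) + T\<^sup>2 * (b * (4 * c3 * c4 / T\<^sup>2 * N))"
        using I2 X2 pos by (intro add_mono mult_left_mono) auto
      also have "\<dots> = (8 * c4 + 4 * b * c3 * c4) * N" using T1T by (simp add: algebra_simps)
      also have "\<dots> \<le> K * N" unfolding K_def using N0 c3 c4 by (intro mult_right_mono) auto
      finally show ?thesis using T1T by (simp add: pos_le_divide_eq mult.commute)
    qed
    ultimately show ?thesis by (simp add: N_def)
  qed
  show ?thesis
    by (rule exI[of _ Ts], rule conjI, simp add: Ts_def, rule exI[of _ K], rule conjI[OF K], intro allI impI)
       (rule main; blast)
qed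

lemma mult_le_weighted_squares:
  fixes a b' d :: real
  assumes "d > 0" shows "a * b' \<le> d / 2 * b'\<^sup>2 + a\<^sup>2 / (2 * d)"
proof -
  have "0 \<le> (d * b' - a)\<^sup>2 / (2 * d)" using assms by simp
  also have "\<dots> = d / 2 * b'\<^sup>2 + a\<^sup>2 / (2 * d) - a * b'"
    using assms by (simp add: power2_eq_square field_simps)
  finally show ?thesis by simp
qed

section \<open>Observation of the velocity by a bounded operator\<close>

context wave_operator
begin

text \<open>The observation is defined pointwise, so \<open>w\<close> can be compared directly with
  the free solution having its state at time \<open>a\<close>: the difference starts from zero and
  is bounded by the source alone.\<close>

lemma bounded_window_observability:
  assumes L: "bounded_linear L"
    and obs: "\<exists>T0>0. \<forall>T>T0. \<exists>\<gamma>>0. \<forall>w w'. wave_solution D A {0..} (\<lambda>t. 0) w w' \<longrightarrow>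
           \<gamma> * energy D A 1 (w 0, w' 0) \<le> integral {0..T} (\<lambda>t. (norm (L (w' t) :: 'h))\<^sup>2)"
  shows "\<exists>T1>0. \<exists>c>0. \<forall>T f w w' a. T1 \<le> T \<longrightarrow> continuous_on {0..T} f \<longrightarrow> wave_solution D A {0..T} f w w' \<longrightarrow>
     a \<in> {0..T - T1} \<longrightarrow>
     energy D A 1 (w a, w' a) \<le> c * (integral {a..a + T1} (\<lambda>t. (norm (L (w' t)))\<^sup>2)
        + integral {a..a + T1} (\<lambda>t. (norm (f t))\<^sup>2))"
proof -
  obtain T0 where T0: "T0 > 0" and obsT: "\<And>T. T > T0 \<Longrightarrow> \<exists>\<gamma>>0. \<forall>w w'. wave_solution D A {0..} (\<lambda>t. 0) w w' \<longrightarrow>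
        \<gamma> * energy D A 1 (w 0, w' 0) \<le> integral {0..T} (\<lambda>t. (norm (L (w' t)))\<^sup>2)"
    using obs by blast
  define T1 where "T1 = T0 + 1"
  have T1: "T1 > 0" using T0 by (simp add: T1_def)
  obtain \<gamma> where \<gamma>: "\<gamma> > 0" and G: "\<And>w w'. wave_solution D A {0..} (\<lambda>t. 0) w w' \<Longrightarrow>
        \<gamma> * energy D A 1 (w 0, w' 0) \<le> integral {0..T1} (\<lambda>t. (norm (L (w' t)))\<^sup>2)"
    using obsT[of T1] T1_def by auto
  obtain M where M: "M > 0" "\<And>x. norm (L x) \<le> norm x * M" using bounded_linear.pos_bounded[OF L] by blast
  define c where "c = (2 + 4 * M\<^sup>2 * T1\<^sup>2) / \<gamma>"
  have c: "c > 0" using \<gamma> by (simp add: c_def add_pos_nonneg)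
  have "energy D A 1 (w a, w' a) \<le> c * (integral {a..a + T1} (\<lambda>t. (norm (L (w' t)))\<^sup>2)
        + integral {a..a + T1} (\<lambda>t. (norm (f t))\<^sup>2))"
    if T: "T1 \<le> T" and f: "continuous_on {0..T} f" and w: "wave_solution D A {0..T} f w w'"
      and aT: "a \<in> {0..T - T1}" for T f w w' a
  proof -
    have a: "0 \<le> a" "a + T1 \<le> T" and aI: "a \<in> {0..T}" using aT T1 by auto
    have im: "(\<lambda>t. a + t) ` {0..T1} \<subseteq> {0..T}" using a by auto
    obtain z z' where z: "wave_solution D A {0..} (\<lambda>t. 0) z z'" and z0: "z 0 = w a" "z' 0 = w' a"
      using free_solution_exists[OF wave_H1[OF w aI], of "w' a"] by blast
    have z1: "wave_solution D A {0..T1} (\<lambda>t. 0) z z'" by (rule wave_solution_subset[OF z]) auto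
    have d: "wave_solution D A {0..T1} (\<lambda>t. f (a + t) - 0) (\<lambda>t. w (a + t) - z t) (\<lambda>t. w' (a + t) - z' t)"
      by (rule wave_solution_diff[OF wave_solution_translate[OF w a] z1]) auto
    have fa: "continuous_on {0..T1} (\<lambda>t. f (a + t) - 0)"
      by (intro continuous_intros continuous_on_compose2[OF f _ im])
    define F where "F = integral {0..T1} (\<lambda>t. (norm (f (a + t) - 0))\<^sup>2)"
    have Fi: "(\<lambda>t. (norm (f (a + t) - 0))\<^sup>2) integrable_on {0..T1}"
      by (intro integrable_continuous_real continuous_on_power continuous_on_norm fa)
    have dle: "(norm (L (z' t) - L (w' (a + t))))\<^sup>2 \<le> M\<^sup>2 * (2 * (T1 * F))" if t: "t \<in> {0..T1}" for t
    proof -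
      have "(norm (state (w (a + t) - z t) (w' (a + t) - z' t)))\<^sup>2 \<le> 2 * (norm (state (w (a + 0) - z 0) (w' (a + 0) - z' 0)))\<^sup>2
        + 2 * (\<bar>t - 0\<bar> * integral {min 0 t..max 0 t} (\<lambda>\<tau>. (norm (f (a + \<tau>) - 0))\<^sup>2))"
        by (rule L2_energy_estimate[OF d L2_on_continuous[OF fa] _ t]) (use T1 in simp)
      also have "state (w (a + 0) - z 0) (w' (a + 0) - z' 0) = 0"
        using z0 by (simp add: op_pow_eq_fc zero_prod_def)
      also have "\<bar>t - 0\<bar> * integral {min 0 t..max 0 t} (\<lambda>\<tau>. (norm (f (a + \<tau>) - 0))\<^sup>2) \<le> T1 * F"
        unfolding F_def using t
        by (intro mult_mono integral_square_mono_set[OF Fi] integral_nonneg integrable_subinterval_real[OF Fi]) auto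
      finally have s: "(norm (state (w (a + t) - z t) (w' (a + t) - z' t)))\<^sup>2 \<le> 2 * (T1 * F)" by simp
      have "norm (L (z' t) - L (w' (a + t))) = norm (L (w' (a + t) - z' t))"
        by (simp add: linear_diff[OF bounded_linear.linear[OF L]] norm_minus_commute)
      also have "\<dots> \<le> M * norm (w' (a + t) - z' t)" using M(2) by (simp add: mult.commute)
      also have "\<dots> \<le> M * norm (state (w (a + t) - z t) (w' (a + t) - z' t))"
        using M(1) by (intro mult_left_mono norm_snd_le) auto
      finally have "(norm (L (z' t) - L (w' (a + t))))\<^sup>2 \<le> (M * norm (state (w (a + t) - z t) (w' (a + t) - z' t)))\<^sup>2"
        by (intro power_mono) auto
      also have "\<dots> \<le> M\<^sup>2 * (2 * (T1 * F))"
        unfolding power_mult_distrib by (intro mult_left_mono s) simp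
      finally show ?thesis .
    qed
    have cL: "continuous_on {0..T1} (\<lambda>t. L (z' t))" "continuous_on {0..T1} (\<lambda>t. L (w' (a + t)))"
      by (intro bounded_linear.continuous_on[OF L] wave_deriv_cont[OF z1] wave_deriv_cont[OF wave_solution_translate[OF w a]])+
    have "\<gamma> * energy D A 1 (w a, w' a) \<le> integral {0..T1} (\<lambda>t. (norm (L (z' t)))\<^sup>2)"
      using G[OF z] by (simp add: z0)
    also have "\<dots> \<le> 2 * integral {0..T1} (\<lambda>t. (norm (L (z' t) - L (w' (a + t))))\<^sup>2)
        + 2 * integral {0..T1} (\<lambda>t. (norm (L (w' (a + t))))\<^sup>2)"
      by (rule integral_norm_square_diff_le; intro integrable_continuous_real continuous_intros cL)
    also have "integral {0..T1} (\<lambda>t. (norm (L (z' t) - L (w' (a + t))))\<^sup>2) \<le> integral {0..T1} (\<lambda>t. M\<^sup>2 * (2 * (T1 * F)))"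
      by (intro integral_le dle integrable_continuous_real continuous_intros cL)
    also have "\<dots> = 2 * M\<^sup>2 * T1\<^sup>2 * F" using T1 by (simp add: power2_eq_square)
    also have "integral {0..T1} (\<lambda>t. (norm (L (w' (a + t))))\<^sup>2) = integral {a..a + T1} (\<lambda>t. (norm (L (w' t)))\<^sup>2)"
      by (rule integral_translate)
    finally have "\<gamma> * energy D A 1 (w a, w' a)
        \<le> 4 * M\<^sup>2 * T1\<^sup>2 * F + 2 * integral {a..a + T1} (\<lambda>t. (norm (L (w' t)))\<^sup>2)" by simp
    also have "F = integral {a..a + T1} (\<lambda>t. (norm (f t))\<^sup>2)"
      unfolding F_def using integral_translate[where h = "\<lambda>t. (norm (f t))\<^sup>2"] by simp
    also have "4 * M\<^sup>2 * T1\<^sup>2 * integral {a..a + T1} (\<lambda>t. (norm (f t))\<^sup>2) + 2 * integral {a..a + T1} (\<lambda>t. (norm (L (w' t)))\<^sup>2)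
       \<le> (2 + 4 * M\<^sup>2 * T1\<^sup>2) * (integral {a..a + T1} (\<lambda>t. (norm (L (w' t)))\<^sup>2) + integral {a..a + T1} (\<lambda>t. (norm (f t))\<^sup>2))"
    proof -
      have sub: "{a..a + T1} \<subseteq> {0..T}" using a by auto
      have "0 \<le> integral {a..a + T1} (\<lambda>t. (norm (f t))\<^sup>2)"
        by (intro integral_nonneg integrable_continuous_real continuous_intros continuous_on_subset[OF f sub]) simp
      moreover have "0 \<le> integral {a..a + T1} (\<lambda>t. (norm (L (w' t)))\<^sup>2)"
        by (intro integral_nonneg integrable_continuous_real continuous_intros bounded_linear.continuous_on[OF L]
            continuous_on_subset[OF wave_deriv_cont[OF w] sub]) simp
      ultimately show ?thesis by (simp add: algebra_simps)
    qed
    finally show ?thesis using \<gamma> by (simp add: c_def pos_le_divide_eq field_simps)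
  qed
  then show ?thesis using T1 c by blast
qed

end

section \<open>Cascades and their primitives\<close>

locale cascade = wave_operator D A \<omega>
  for D :: "'h::{real_inner,complete_space} set" and A \<omega> +
  fixes n :: nat and C P' :: "nat \<Rightarrow> 'h \<Rightarrow> 'h" and \<beta> :: "nat \<Rightarrow> real"
  assumes coupling: "coupling_hyp D A n C P' \<beta>"
    and coupling_obs: "coupling_observability_hyp D A n P'"
begin

lemma
  assumes "i \<in> {2..n}"
  shows C_linear: "bounded_linear (C i)"
    and C_norm: "(norm (C i u))\<^sup>2 \<le> \<beta> i * (C i u \<bullet> u)"
    and C_coercive: "\<exists>\<alpha>>0. \<forall>u. \<alpha> * (norm (P' i u))\<^sup>2 \<le> C i u \<bullet> u"
    and C_adjoint: "k \<le> n - i + 1 \<Longrightarrow> bounded_on_H D A k (adjoint (C i))"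
    and P'_linear: "bounded_linear (P' i)"
    and P'_obs: "\<exists>T0>0. \<forall>T>T0. \<exists>\<gamma>>0. \<forall>w w'. wave_solution D A {0..} (\<lambda>t. 0) w w' \<longrightarrow>
           \<gamma> * energy D A 1 (w 0, w' 0) \<le> integral {0..T} (\<lambda>t. (norm (P' i (w' t)))\<^sup>2)"
  using coupling coupling_obs assms unfolding coupling_hyp_def coupling_observability_hyp_def by auto

lemma C_nonneg: "i \<in> {2..n} \<Longrightarrow> 0 \<le> C i u \<bullet> u"
  using C_coercive[of i] by (meson less_imp_le mult_nonneg_nonneg order_trans zero_le_power2)

text \<open>Only finitely many pairs of component and index occur, so the sum of their constants
  serves them all.\<close>

lemma C_negative_norm:
  obtains M where "M > 0"
    "\<And>i k u. i \<in> {2..n} \<Longrightarrow> k \<le> n - i + 1 \<Longrightarrow> Hnorm D A (- int k) (C i u) \<le> M * Hnorm D A (- int k) u"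
proof -
  have "\<exists>M>0. \<forall>u. Hnorm D A (- int k) (C i u) \<le> M * Hnorm D A (- int k) u" if "i \<in> {2..n}" "k \<le> n - i + 1" for i k
    by (rule negative_norm_bound[OF C_linear C_adjoint]) (use that in auto)
  then obtain M where M: "\<And>i k. i \<in> {2..n} \<Longrightarrow> k \<le> n - i + 1 \<Longrightarrow> M i k > 0"
    "\<And>i k u. i \<in> {2..n} \<Longrightarrow> k \<le> n - i + 1 \<Longrightarrow> Hnorm D A (- int k) (C i u) \<le> M i k * Hnorm D A (- int k) u"
    by metis
  define S' where "S' = (SIGMA i:{2..n}. {..n - i + 1})"
  define M0 where "M0 = 1 + (\<Sum>(i, k)\<in>S'. M i k)"
  have pos: "0 \<le> (case p of (i, k) \<Rightarrow> M i k)" if "p \<in> S'" for p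
    using that M(1) by (auto simp: S'_def less_imp_le)
  have le: "M i k \<le> M0" if "i \<in> {2..n}" "k \<le> n - i + 1" for i k
    using member_le_sum[of "(i, k)" S' "\<lambda>(i, k). M i k"] that pos by (auto simp: M0_def S'_def)
  show thesis
  proof (rule that[of M0])
    show "0 < M0" unfolding M0_def using pos by (intro add_pos_nonneg sum_nonneg) auto
    show "Hnorm D A (- int k) (C i u) \<le> M0 * Hnorm D A (- int k) u" if "i \<in> {2..n}" "k \<le> n - i + 1" for i k u
      using M(2)[OF that, of u] mult_right_mono[OF le[OF that], of "Hnorm D A (- int k) u"]
      by (simp add: Hnorm_def)
  qed
qed

text \<open>Giving the first component the source 0 lets all components obey one equation, so
  arguments over \<open>{1..m}\<close> need no separate start.\<close>

definition src :: "(nat \<Rightarrow> real \<Rightarrow> 'h) \<Rightarrow> nat \<Rightarrow> real \<Rightarrow> 'h" where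
  "src w i t = (if i = 1 then 0 else - C i (w (i - 1) t))"

lemma cascade_solution_iff:
  assumes "1 \<le> m"
  shows "cascade_solution D A m C w w' \<longleftrightarrow> (\<forall>i\<in>{1..m}. wave_solution D A {0..} (src w i) (w i) (w' i))"
proof -
  have s1: "src w 1 = (\<lambda>t. 0)" by (auto simp: src_def)
  have si: "src w i = (\<lambda>t. - C i (w (i - 1) t))" if "i \<in> {2..m}" for i using that by (auto simp: src_def)
  have "{1..m} = insert 1 {2..m}" using assms by auto
  moreover have "(\<forall>i\<in>{2..m}. wave_solution D A {0..} (\<lambda>t. - C i (w (i - 1) t)) (w i) (w' i))
      \<longleftrightarrow> (\<forall>i\<in>{2..m}. wave_solution D A {0..} (src w i) (w i) (w' i))"
    by (rule ball_cong[OF refl]) (simp only: si)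
  ultimately show ?thesis unfolding cascade_solution_def using s1 by (simp only: ball_simps)
qed

lemma cascade_wave: "cascade_solution D A m C w w' \<Longrightarrow> i \<in> {1..m} \<Longrightarrow> wave_solution D A {0..} (src w i) (w i) (w' i)"
  using cascade_solution_iff[of m w w'] by auto

lemma src_derivative:
  assumes "i \<in> {1..n}" and "i \<noteq> 1 \<Longrightarrow> (u (i - 1) has_vector_derivative u' (i - 1) t) (at t within I)"
  shows "(src u i has_vector_derivative src u' i t) (at t within I)"
proof (cases "i = 1")
  case False
  then have "bounded_linear (C i)" using assms by (intro C_linear) auto
  then show ?thesis using assms(2)[OF False] False
    by (simp add: src_def[abs_def] bounded_linear.has_vector_derivative has_vector_derivative_minus)
qed (simp add: src_def[abs_def])

lemma src_continuous:
  assumes "i \<in> {1..n}" and "i \<noteq> 1 \<Longrightarrow> continuous_on I (u (i - 1))"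
  shows "continuous_on I (src u i)"
proof (cases "i = 1")
  case False
  then have "bounded_linear (C i)" using assms by (intro C_linear) auto
  then show ?thesis using assms(2)[OF False] False
    by (simp add: src_def[abs_def] bounded_linear.continuous_on continuous_on_minus)
qed (simp add: src_def[abs_def])

lemma cascade_src_continuous:
  assumes "cascade_solution D A m C w w'" "m \<le> n" "i \<in> {1..m}"
  shows "continuous_on {0..} (src w i)"
proof (rule src_continuous)
  show "continuous_on {0..} (w (i - 1))" if "i \<noteq> 1"
  proof -
    have "i - 1 \<in> {1..m}" using that assms(3) by auto
    then show ?thesis by (rule wave_cont[OF cascade_wave[OF assms(1)]])
  qed
qed (use assms in auto)

text \<open>\<open>S (S u)\<close> is the inverse of \<open>A\<close> applied to \<open>u\<close>:
  the wave equation of the primitive is solved for the primitive itself, with the source formed from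
  the preceding one. This fixes the constants of integration for which the primitives form a cascade
  again.\<close>

primrec primitive :: "(nat \<Rightarrow> real \<Rightarrow> 'h) \<Rightarrow> nat \<Rightarrow> real \<Rightarrow> 'h" where
  "primitive w' 0 = (\<lambda>t. 0)"
| "primitive w' (Suc i) = (\<lambda>t. S (S ((if i = 0 then 0 else - C (Suc i) (primitive w' i t)) - w' (Suc i) t)))"

lemma primitive_eq: "1 \<le> i \<Longrightarrow> primitive w' i t = S (S (src (primitive w') i t - w' i t))"
  by (cases i) (auto simp: src_def)

text \<open>The primitive of one component yields the primitive of the source of the next, which is
  the input of \<open>antiderivative_solution\<close>.\<close>

lemma primitive_cascade:
  assumes w: "cascade_solution D A m C w w'" and m: "1 \<le> m" "m \<le> n"
  shows "cascade_solution D A m C (primitive w') w"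
  unfolding cascade_solution_iff[OF m(1)]
proof
  have "i \<in> {1..m} \<Longrightarrow> wave_solution D A {0..} (src (primitive w') i) (primitive w' i) (w i)" for i
  proof (induction i)
    case (Suc i)
    have i: "Suc i \<in> {1..n}" using Suc.prems m by auto
    have "wave_solution D A {0..} (src (primitive w') (Suc i))
        (\<lambda>t. S (S (src (primitive w') (Suc i) t - w' (Suc i) t))) (w (Suc i))"
    proof (rule antiderivative_solution[OF cascade_wave[OF w Suc.prems] cascade_src_continuous[OF w m(2) Suc.prems]])
      fix t :: real assume t: "t \<ge> 0"
      show "(src (primitive w') (Suc i) has_vector_derivative src w (Suc i) t) (at t within {0..})"
      proof (rule src_derivative[OF i])
        assume "Suc i \<noteq> 1"
        then have "wave_solution D A {0..} (src (primitive w') i) (primitive w' i) (w i)"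
          using Suc by auto
        then show "(primitive w' (Suc i - 1) has_vector_derivative w (Suc i - 1) t) (at t within {0..})"
          using wave_deriv t by fastforce
      qed
    qed
    moreover have "primitive w' (Suc i) = (\<lambda>t. S (S (src (primitive w') (Suc i) t - w' (Suc i) t)))"
      by (rule ext) (rule primitive_eq, simp)
    ultimately show ?case by simp
  qed simp
  then show "\<And>i. i \<in> {1..m} \<Longrightarrow> wave_solution D A {0..} (src (primitive w') i) (primitive w' i) (w i)" .
qed

section \<open>The induction statement and the unobserved components\<close>

lemma cascade_solution_mono:
  assumes "cascade_solution D A p C w w'" "m \<le> p"
  shows "cascade_solution D A m C w w'"
  using assms unfolding cascade_solution_def by auto

text \<open>\<open>Ts\<close> and \<open>K\<close> depend on the window data \<open>c\<close> and
  \<open>T1\<close> alone, neither on the solution nor on \<open>g\<close>. So the estimate can be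
  applied to primitives with a bounded observation as well as to the observation by
  \<open>B\<close>.\<close>

definition order_estimate :: "nat \<Rightarrow> bool" where
  "order_estimate m \<longleftrightarrow> (\<forall>c>0. \<forall>T1>0. \<exists>Ts\<ge>1. \<exists>K>0. \<forall>w w' g T.
     cascade_solution D A m C w w' \<longrightarrow> T > Ts \<longrightarrow> g integrable_on {0..T} \<longrightarrow> (\<forall>t. 0 \<le> g t) \<longrightarrow>
     (\<forall>a\<in>{0..T - T1}. energy D A 1 (w m a, w' m a)
        \<le> c * (integral {a..a + T1} g + integral {a..a + T1} (\<lambda>t. (norm (src w m t))\<^sup>2))) \<longrightarrow>
     (\<forall>i\<in>{1..m}. \<forall>s\<in>{0..T}. energy D A (1 + int i - int m) (w i s, w' i s)
        \<le> K / (if i = m then T else T ^ 3) * integral {0..T} g))"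

lemma order_estimateD:
  assumes "order_estimate m" "c > 0" "T1 > 0"
  obtains Ts K where "Ts \<ge> 1" "K > 0" "\<And>w w' g T i s. cascade_solution D A m C w w' \<Longrightarrow> T > Ts \<Longrightarrow>
     g integrable_on {0..T} \<Longrightarrow> (\<And>t. 0 \<le> g t) \<Longrightarrow>
     (\<And>a. a \<in> {0..T - T1} \<Longrightarrow> energy D A 1 (w m a, w' m a)
        \<le> c * (integral {a..a + T1} g + integral {a..a + T1} (\<lambda>t. (norm (src w m t))\<^sup>2))) \<Longrightarrow>
     i \<in> {1..m} \<Longrightarrow> s \<in> {0..T} \<Longrightarrow> energy D A (1 + int i - int m) (w i s, w' i s)
        \<le> K / (if i = m then T else T ^ 3) * integral {0..T} g"
proof -
  obtain Ts K where "Ts \<ge> 1" "K > 0" and *: "\<forall>w w' g T.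
     cascade_solution D A m C w w' \<longrightarrow> T > Ts \<longrightarrow> g integrable_on {0..T} \<longrightarrow> (\<forall>t. 0 \<le> g t) \<longrightarrow>
     (\<forall>a\<in>{0..T - T1}. energy D A 1 (w m a, w' m a)
        \<le> c * (integral {a..a + T1} g + integral {a..a + T1} (\<lambda>t. (norm (src w m t))\<^sup>2))) \<longrightarrow>
     (\<forall>i\<in>{1..m}. \<forall>s\<in>{0..T}. energy D A (1 + int i - int m) (w i s, w' i s)
        \<le> K / (if i = m then T else T ^ 3) * integral {0..T} g)"
    using assms(1)[unfolded order_estimate_def, rule_format, OF assms(2,3)] by (elim exE conjE) (rule that)
  show thesis
  proof (rule that[of Ts K])
    fix w w' g T i s
    assume "cascade_solution D A m C w w'" "T > Ts" "g integrable_on {0..T}" "\<And>t. 0 \<le> g t"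
      "\<And>a. a \<in> {0..T - T1} \<Longrightarrow> energy D A 1 (w m a, w' m a)
        \<le> c * (integral {a..a + T1} g + integral {a..a + T1} (\<lambda>t. (norm (src w m t))\<^sup>2))"
      "i \<in> {1..m}" "s \<in> {0..T}"
    then show "energy D A (1 + int i - int m) (w i s, w' i s)
        \<le> K / (if i = m then T else T ^ 3) * integral {0..T} g"
      using *[rule_format, of w w' T g i s] by blast
  qed fact+
qed

lemma Hnorm_minus: "k \<le> 0 \<Longrightarrow> Hnorm D A k (- u) = Hnorm D A k u"
  unfolding Hnorm_def
  by (subst linear_neg[OF bounded_linear.linear[OF bounded_linear_op_pow]]) auto

lemma Hnorm_triangle:
  assumes "k \<le> 0" shows "Hnorm D A k u \<le> Hnorm D A k v + Hnorm D A k (v - u)"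
  using Hnorm_add_le[OF assms, of v "u - v"] Hnorm_minus[OF assms, of "u - v"] by simp

text \<open>The induction hypothesis, applied to the primitive of the cascade with the observation
  \<open>\<Pi>\<^sub>m\<^sub>+\<^sub>1 w\<^sub>m\<close>, bounds the unobserved components by the coupling integral.\<close>

lemma coupling_controls_lower:
  assumes est: "order_estimate m" and m: "1 \<le> m" "Suc m \<le> n"
  obtains Ta K1 where "Ta \<ge> 1" "K1 > 0" "\<And>w w' T i s. cascade_solution D A (Suc m) C w w' \<Longrightarrow> T > Ta \<Longrightarrow>
     i \<in> {1..m} \<Longrightarrow> s \<in> {0..T} \<Longrightarrow> energy D A (int i - int m) (w i s, w' i s)
        \<le> K1 / (if i = m then T else T ^ 3) * integral {0..T} (\<lambda>t. C (Suc m) (w m t) \<bullet> w m t)"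
proof -
  define p where "p = Suc m"
  have p: "p \<in> {2..n}" using m by (simp add: p_def)
  obtain \<alpha> where \<alpha>: "\<alpha> > 0" "\<And>u. \<alpha> * (norm (P' p u))\<^sup>2 \<le> C p u \<bullet> u" using C_coercive[OF p] by blast
  obtain T1 c where T1: "T1 > 0" and c: "c > 0" and win: "\<And>T f w w' a. T1 \<le> T \<Longrightarrow> continuous_on {0..T} f \<Longrightarrow>
     wave_solution D A {0..T} f w w' \<Longrightarrow> a \<in> {0..T - T1} \<Longrightarrow>
     energy D A 1 (w a, w' a) \<le> c * (integral {a..a + T1} (\<lambda>t. (norm (P' p (w' t)))\<^sup>2)
        + integral {a..a + T1} (\<lambda>t. (norm (f t))\<^sup>2))"
    using bounded_window_observability[OF P'_linear[OF p] P'_obs[OF p]] by blast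
  obtain Ts K where Ts: "Ts \<ge> 1" and K: "K > 0" and IH: "\<And>w w' g T i s. cascade_solution D A m C w w' \<Longrightarrow> T > Ts \<Longrightarrow>
     g integrable_on {0..T} \<Longrightarrow> (\<And>t. 0 \<le> g t) \<Longrightarrow>
     (\<And>a. a \<in> {0..T - T1} \<Longrightarrow> energy D A 1 (w m a, w' m a)
        \<le> c * (integral {a..a + T1} g + integral {a..a + T1} (\<lambda>t. (norm (src w m t))\<^sup>2))) \<Longrightarrow>
     i \<in> {1..m} \<Longrightarrow> s \<in> {0..T} \<Longrightarrow> energy D A (1 + int i - int m) (w i s, w' i s)
        \<le> K / (if i = m then T else T ^ 3) * integral {0..T} g"
    using order_estimateD[OF est c T1] by metis
  obtain M where M: "M > 0"
    "\<And>i k u. i \<in> {2..n} \<Longrightarrow> k \<le> n - i + 1 \<Longrightarrow> Hnorm D A (- int k) (C i u) \<le> M * Hnorm D A (- int k) u"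
    using C_negative_norm by blast
  define r where "r = \<omega> powr (- (1/2))"
  define K1 where "K1 = (3 + 2 * (M * r)\<^sup>2) * K / \<alpha>"
  have K1: "K1 > 0" using K \<alpha> by (simp add: K1_def add_pos_nonneg)
  have "energy D A (int i - int m) (w i s, w' i s)
        \<le> K1 / (if i = m then T else T ^ 3) * integral {0..T} (\<lambda>t. C p (w m t) \<bullet> w m t)"
    if w: "cascade_solution D A p C w w'" and T: "T > Ts" and i: "i \<in> {1..m}" and s: "s \<in> {0..T}" for w w' T i s
  proof -
    have T0: "T \<ge> 1" using T Ts by simp
    have wm: "cascade_solution D A m C w w'" by (rule cascade_solution_mono[OF w]) (simp add: p_def)
    have mn: "m \<le> n" using m by simp
    define v where "v = primitive w'"
    \<comment> \<open>Here \<open>w m\<close> is the velocity of the last component, so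
      \<open>P' p\<close> observes it as in the coupling observability hypothesis.\<close>
    have v: "cascade_solution D A m C v w" unfolding v_def by (rule primitive_cascade[OF wm m(1) mn])
    have cwm: "continuous_on {0..T} (w m)"
      by (rule continuous_on_subset[OF wave_cont[OF cascade_wave[OF wm]]]) (use m in auto)
    have cP: "continuous_on I (\<lambda>t. P' p (w m t))" if "continuous_on I (w m)" for I
      by (rule bounded_linear.continuous_on[OF P'_linear[OF p] that])
    define Y where "Y = integral {0..T} (\<lambda>t. (norm (P' p (w m t)))\<^sup>2)"
    define X where "X = integral {0..T} (\<lambda>t. C p (w m t) \<bullet> w m t)"
    have Yi: "(\<lambda>t. (norm (P' p (w m t)))\<^sup>2) integrable_on {0..T}"
      by (intro integrable_continuous_real continuous_intros cP cwm)
    have Xi: "(\<lambda>t. C p (w m t) \<bullet> w m t) integrable_on {0..T}"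
      by (intro integrable_continuous_real continuous_intros cwm bounded_linear.continuous_on[OF C_linear[OF p] cwm])
    have Y0: "0 \<le> Y" unfolding Y_def by (rule integral_nonneg[OF Yi]) simp
    have YX: "\<alpha> * Y \<le> X"
    proof -
      have "\<alpha> * Y = integral {0..T} (\<lambda>t. \<alpha> * (norm (P' p (w m t)))\<^sup>2)" by (simp add: Y_def)
      also have "\<dots> \<le> X" unfolding X_def by (intro integral_le integrable_on_mult_right Yi Xi \<alpha>(2))
      finally show ?thesis .
    qed
    define \<tau> where "\<tau> k = (if k = m then T else T ^ 3)" for k
    have \<tau>: "0 < \<tau> k" "\<tau> k \<le> T ^ 3" for k
      using T0 self_le_power[of T 3] by (auto simp: \<tau>_def)
    have e: "energy D A (1 + int k - int m) (v k s, w k s) \<le> K / \<tau> k * Y" if "k \<in> {1..m}" for k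
      unfolding \<tau>_def Y_def
    proof (rule IH[OF v T Yi _ _ that s])
      fix a assume a: "a \<in> {0..T - T1}"
      show "energy D A 1 (v m a, w m a) \<le> c * (integral {a..a + T1} (\<lambda>t. (norm (P' p (w m t)))\<^sup>2)
         + integral {a..a + T1} (\<lambda>t. (norm (src v m t))\<^sup>2))"
      proof (rule win[OF _ _ _ a])
        show "T1 \<le> T" using a by auto
        show "continuous_on {0..T} (src v m)"
          by (rule continuous_on_subset[OF cascade_src_continuous[OF v mn]]) (use m in auto)
        show "wave_solution D A {0..T} (src v m) (v m) (w m)"
          by (rule wave_solution_subset[OF cascade_wave[OF v]]) (use m in auto)
      qed
    qed simp
    \<comment> \<open>The index of the velocity in the energy to be bounded. The estimate
      \<open>e\<close> controls \<open>v i\<close> at index \<open>j + 2\<close> and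
      \<open>w i\<close> at index \<open>j + 1\<close>, so only \<open>w' i\<close> at index
      \<open>j\<close> is missing.\<close>
    define j where "j = int i - int m - 1"
    have j: "j \<le> - 1" "j = - int (Suc m - i)" "j + 2 = 1 + int i - int m" "j + 1 = int i - int m"
      using i by (auto simp: j_def)
    have jneg: "j \<le> 0" using j(1) by simp
    define Z where "Z = K / \<tau> i * Y"
    have Z0: "0 \<le> Z" using K \<tau>[of i] Y0 by (simp add: Z_def)
    have h1: "(Hnorm D A (j + 1) (w i s))\<^sup>2 \<le> 2 * Z" and h2: "(Hnorm D A (j + 2) (v i s))\<^sup>2 \<le> 2 * Z"
    proof -
      have "energy D A (j + 2) (v i s, w i s) \<le> Z" using e[OF i] by (simp only: j(3) Z_def)
      then have "((Hnorm D A (j + 2) (v i s))\<^sup>2 + (Hnorm D A (j + 1) (w i s))\<^sup>2) / 2 \<le> Z"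
        by (simp add: energy_def add.commute)
      moreover have "x \<le> 2 * z \<and> y \<le> 2 * z" if "(y + x) / 2 \<le> z" "0 \<le> y" "0 \<le> x" for x y z :: real
        using that by auto
      ultimately have "(Hnorm D A (j + 1) (w i s))\<^sup>2 \<le> 2 * Z \<and> (Hnorm D A (j + 2) (v i s))\<^sup>2 \<le> 2 * Z"
        using zero_le_power2 by blast
      then show "(Hnorm D A (j + 1) (w i s))\<^sup>2 \<le> 2 * Z" "(Hnorm D A (j + 2) (v i s))\<^sup>2 \<le> 2 * Z"
        by auto
    qed
    \<comment> \<open>\<open>v i\<close> is the inverse of \<open>A\<close> applied to
      \<open>src v i - w' i\<close>, and \<open>A\<close> shifts the index by two.\<close>
    have h3: "Hnorm D A j (src v i s - w' i s) = Hnorm D A (j + 2) (v i s)"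
    proof -
      have "v i s = op_pow D A (-1) (src v i s - w' i s)"
        unfolding v_def S_S[symmetric] by (rule primitive_eq) (use i in simp)
      moreover have "op_pow D A (real_of_int (j + 2) / 2) (op_pow D A (-1) u) = op_pow D A (real_of_int (j + 2) / 2 + - 1) u" for u
        by (rule op_pow_comp(2)) (use j(1) in auto)
      ultimately have "op_pow D A (real_of_int (j + 2) / 2) (v i s) = op_pow D A (real_of_int (j + 2) / 2 + - 1) (src v i s - w' i s)"
        by metis
      also have "real_of_int (j + 2) / 2 + - 1 = real_of_int j / 2" by (simp add: field_simps)
      finally show ?thesis by (simp add: Hnorm_def)
    qed
    \<comment> \<open>The mapping property of the adjoint of \<open>C i\<close> enters here, with
      \<open>k = Suc m - i\<close>. The estimate for \<open>v (i - 1)\<close> has index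
      \<open>j + 1\<close>, one better than required; the gap costs the factor
      \<open>r\<close>.\<close>
    have h4: "(Hnorm D A j (src v i s))\<^sup>2 \<le> (M * r)\<^sup>2 * (2 * Z)"
    proof (cases "i = 1")
      case True
      have "Hnorm D A j 0 = 0" by (simp add: Hnorm_def op_pow_eq_fc)
      then show ?thesis using True Z0 by (simp add: src_def)
    next
      case False
      then have i': "i \<in> {2..n}" "i - 1 \<in> {1..m}" "i - 1 \<noteq> m" "int (i - 1) = int i - 1" using i mn by auto
      have "Hnorm D A j (src v i s) = Hnorm D A j (C i (v (i - 1) s))"
        using False Hnorm_minus[of j "C i (v (i - 1) s)"] j(1) by (simp add: src_def)
      also have "\<dots> \<le> M * Hnorm D A j (v (i - 1) s)"
        unfolding j(2) by (rule M(2)[OF i'(1)]) (use i m in auto)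
      also have "\<dots> \<le> M * (\<omega> powr (real_of_int (j - (j + 1)) / 2) * Hnorm D A (j + 1) (v (i - 1) s))"
        using M(1) j by (intro mult_left_mono Hnorm_mono) auto
      also have "\<dots> = (M * r) * Hnorm D A (j + 1) (v (i - 1) s)" by (simp add: r_def)
      finally have "(Hnorm D A j (src v i s))\<^sup>2 \<le> ((M * r) * Hnorm D A (j + 1) (v (i - 1) s))\<^sup>2"
        by (intro power_mono) (auto simp: Hnorm_def)
      also have "\<dots> = (M * r)\<^sup>2 * (Hnorm D A (j + 1) (v (i - 1) s))\<^sup>2" by (simp add: power_mult_distrib)
      also have "(Hnorm D A (j + 1) (v (i - 1) s))\<^sup>2 \<le> 2 * Z"
      proof -
        have "(Hnorm D A (j + 1) (v (i - 1) s))\<^sup>2 \<le> 2 * energy D A (1 + int (i - 1) - int m) (v (i - 1) s, w (i - 1) s)"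
          using i'(4) by (simp add: energy_def j_def)
        also have "\<dots> \<le> 2 * (K / \<tau> (i - 1) * Y)" using e[OF i'(2)] by simp
        also have "K / \<tau> (i - 1) * Y \<le> Z"
        proof -
          \<comment> \<open>Component \<open>i - 1\<close> is never the last of the first
            \<open>m\<close>, so it has the cubic rate.\<close>
          have "\<tau> i \<le> \<tau> (i - 1)" using \<tau>(2)[of i] i'(3) by (simp only: \<tau>_def[of "i - 1"] if_False)
          then show ?thesis unfolding Z_def using K \<tau>(1) Y0
            by (intro mult_right_mono divide_left_mono) auto
        qed
        finally show ?thesis by simp
      qed
      finally show ?thesis by (simp add: mult_left_mono)
    qed
    have "(Hnorm D A j (w' i s))\<^sup>2 \<le> (Hnorm D A j (src v i s) + Hnorm D A (j + 2) (v i s))\<^sup>2"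
      using Hnorm_triangle[OF jneg, of "w' i s" "src v i s"] unfolding h3
      by (rule power_mono) (simp add: Hnorm_def)
    also have "\<dots> \<le> 2 * (Hnorm D A j (src v i s))\<^sup>2 + 2 * (Hnorm D A (j + 2) (v i s))\<^sup>2"
      using norm_square_add_le[of "Hnorm D A j (src v i s)" "Hnorm D A (j + 2) (v i s)"] by simp
    also have "\<dots> \<le> 2 * ((M * r)\<^sup>2 * (2 * Z)) + 2 * (2 * Z)" using h2 h4 by simp
    finally have "((Hnorm D A (j + 1) (w i s))\<^sup>2 + (Hnorm D A j (w' i s))\<^sup>2) / 2 \<le> (3 + 2 * (M * r)\<^sup>2) * Z"
      using h1 by (simp add: algebra_simps)
    then have "energy D A (int i - int m) (w i s, w' i s) \<le> (3 + 2 * (M * r)\<^sup>2) * Z"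
      by (simp add: energy_def j_def)
    also have "\<dots> = (3 + 2 * (M * r)\<^sup>2) * K / \<tau> i * Y" by (simp add: Z_def)
    also have "\<dots> \<le> (3 + 2 * (M * r)\<^sup>2) * K / \<tau> i * (X / \<alpha>)"
      using YX \<alpha> K \<tau>[of i] by (intro mult_left_mono) (auto simp: pos_le_divide_eq mult.commute)
    also have "\<dots> = K1 / \<tau> i * X" by (simp add: K1_def)
    finally show ?thesis by (simp add: \<tau>_def X_def)
  qed
  then show thesis using that[OF Ts K1] by (simp add: p_def)
qed

end

section \<open>Base and step of the induction\<close>

context cascade
begin

text \<open>A free wave has neither source nor coupling: \<open>energy_averaging\<close> applies
  with \<open>X = 0\<close> and \<open>\<phi> = 0\<close>, and its constants \<open>b\<close>,
  \<open>c1\<close>, \<open>c2\<close> are set to 1.\<close>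

lemma order_estimate_1: "order_estimate 1"
  unfolding order_estimate_def
proof (intro allI impI)
  fix c T1 :: real assume pos: "c > 0" "T1 > 0"
  from energy_averaging[OF zero_less_one zero_less_one zero_less_one pos]
  obtain Ts K :: real where Ts: "Ts \<ge> 1" and K: "K > 0" and avg: "\<And>(en :: real \<Rightarrow> real) \<phi> g X T. T > Ts \<Longrightarrow> continuous_on {0..T} en \<Longrightarrow>
     (\<forall>t. 0 \<le> en t) \<Longrightarrow> continuous_on {0..T} \<phi> \<Longrightarrow> (\<forall>t. 0 \<le> \<phi> t) \<Longrightarrow>
     g integrable_on {0..T} \<Longrightarrow> (\<forall>t. 0 \<le> g t) \<Longrightarrow> 0 \<le> X \<Longrightarrow> integral {0..T} \<phi> \<le> 1 * X \<Longrightarrow>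
     (\<forall>s\<in>{0..T}. \<forall>t\<in>{0..T}. en t \<le> 2 * en s + \<bar>t - s\<bar> * integral {min s t..max s t} \<phi>) \<Longrightarrow>
     X \<le> 1 / T * (en 0 + en T) + 1 / T\<^sup>2 * integral {0..T} en \<Longrightarrow>
     (\<forall>a\<in>{0..T - T1}. en a \<le> c * (integral {a..a + T1} g + integral {a..a + T1} \<phi>)) \<Longrightarrow>
     X \<le> K / T\<^sup>2 * integral {0..T} g \<and> (\<forall>s\<in>{0..T}. en s \<le> K / T * integral {0..T} g)" by metis
  show "\<exists>Ts\<ge>1. \<exists>K>0. \<forall>w w' g T. cascade_solution D A 1 C w w' \<longrightarrow> T > Ts \<longrightarrow> g integrable_on {0..T} \<longrightarrow> (\<forall>t. 0 \<le> g t) \<longrightarrow>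
     (\<forall>a\<in>{0..T - T1}. energy D A 1 (w 1 a, w' 1 a)
        \<le> c * (integral {a..a + T1} g + integral {a..a + T1} (\<lambda>t. (norm (src w 1 t))\<^sup>2))) \<longrightarrow>
     (\<forall>i\<in>{1..1}. \<forall>s\<in>{0..T}. energy D A (1 + int i - int 1) (w i s, w' i s)
        \<le> K / (if i = 1 then T else T ^ 3) * integral {0..T} g)"
  proof (rule exI[of _ Ts], rule conjI[OF Ts], rule exI[of _ K], rule conjI[OF K], intro allI impI)
    fix w w' and g :: "real \<Rightarrow> real" and T
    assume w: "cascade_solution D A 1 C w w'" and T: "T > Ts" and g: "g integrable_on {0..T}" "\<forall>t. 0 \<le> g t"
      and win: "\<forall>a\<in>{0..T - T1}. energy D A 1 (w 1 a, w' 1 a)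
        \<le> c * (integral {a..a + T1} g + integral {a..a + T1} (\<lambda>t. (norm (src w 1 t))\<^sup>2))"
    have s0: "src w 1 t = 0" for t by (simp add: src_def)
    have w1: "wave_solution D A {0..T} (\<lambda>t. 0) (w 1) (w' 1)"
      using wave_solution_subset[of "{0..}" _ _ _ "{0..T}"] w by (auto simp: cascade_solution_def)
    have "0 \<le> K / T\<^sup>2 * integral {0..T} g \<and> (\<forall>s\<in>{0..T}. energy D A 1 (w 1 s, w' 1 s) \<le> K / T * integral {0..T} g)"
    proof (rule avg[OF T _ _ _ _ g, where \<phi> = "\<lambda>t. 0"])
      show "continuous_on {0..T} (\<lambda>t. energy D A 1 (w 1 t, w' 1 t))"
        unfolding energy_state by (intro continuous_intros continuous_state[OF w1]) auto
      show "\<forall>s\<in>{0..T}. \<forall>t\<in>{0..T}. energy D A 1 (w 1 t, w' 1 t)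
          \<le> 2 * energy D A 1 (w 1 s, w' 1 s) + \<bar>t - s\<bar> * integral {min s t..max s t} (\<lambda>t. 0)"
      proof (intro ballI)
        fix s t assume "s \<in> {0..T}" "t \<in> {0..T}"
        from L2_energy_estimate[OF w1 L2_on_continuous[OF continuous_on_const] this]
        show "energy D A 1 (w 1 t, w' 1 t)
          \<le> 2 * energy D A 1 (w 1 s, w' 1 s) + \<bar>t - s\<bar> * integral {min s t..max s t} (\<lambda>t. 0)"
          by (simp add: energy_state)
      qed
      show "0 \<le> 1 / T * (energy D A 1 (w 1 0, w' 1 0) + energy D A 1 (w 1 T, w' 1 T))
          + 1 / T\<^sup>2 * integral {0..T} (\<lambda>t. energy D A 1 (w 1 t, w' 1 t))"
        using T Ts energy_nonneg
        by (intro add_nonneg_nonneg mult_nonneg_nonneg integral_nonneg integrable_continuous_real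
            \<open>continuous_on {0..T} (\<lambda>t. energy D A 1 (w 1 t, w' 1 t))\<close>) auto
      show "\<forall>a\<in>{0..T - T1}. energy D A 1 (w 1 a, w' 1 a)
          \<le> c * (integral {a..a + T1} g + integral {a..a + T1} (\<lambda>t. 0))"
        using win unfolding s0 by simp
    qed (auto simp: energy_nonneg)
    then show "\<forall>i\<in>{1..1}. \<forall>s\<in>{0..T}. energy D A (1 + int i - int 1) (w i s, w' i s)
        \<le> K / (if i = 1 then T else T ^ 3) * integral {0..T} g" by simp
  qed
qed

text \<open>The bracket of \<open>w\<^sub>m\<^sub>+\<^sub>1\<close> with \<open>w\<^sub>m\<close> expresses the coupling integral through end point terms and
  the pairing of \<open>w\<^sub>m\<^sub>+\<^sub>1\<close> with the source of \<open>w\<^sub>m\<close>. By \<open>lower\<close>, both are at most half of the coupling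
  integral plus energies of \<open>w\<^sub>m\<^sub>+\<^sub>1\<close>, which gain powers of \<open>1/T\<close>.\<close>

lemma coupling_integral_estimate:
  assumes w: "cascade_solution D A (Suc m) C w w'" and m: "1 \<le> m" "Suc m \<le> n" and T: "T \<ge> 1"
    and K1: "K1 > 0" and M: "M > 0"
    and CM: "\<And>u. m \<noteq> 1 \<Longrightarrow> Hnorm D A (-1) (C m u) \<le> M * Hnorm D A (-1) u"
  defines "X \<equiv> integral {0..T} (\<lambda>t. C (Suc m) (w m t) \<bullet> w m t)"
    and "en \<equiv> \<lambda>t. energy D A 1 (w (Suc m) t, w' (Suc m) t)"
  assumes lower: "\<And>i s. i \<in> {1..m} \<Longrightarrow> s \<in> {0..T} \<Longrightarrow> energy D A (int i - int m) (w i s, w' i s)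
        \<le> K1 / (if i = m then T else T ^ 3) * X"
  shows "X \<le> 16 * K1 / T * (en 0 + en T) + 8 * M\<^sup>2 * K1 / T\<^sup>2 * integral {0..T} en"
proof -
  define p where "p = Suc m"
  have p: "p \<in> {2..n}" "p \<noteq> 1" "p - 1 = m" using m by (auto simp: p_def)
  have T0: "T > 0" using T by simp
  have wp: "wave_solution D A {0..T} (src w p) (w p) (w' p)"
    by (rule wave_solution_subset[OF cascade_wave[OF w]]) (auto simp: p_def)
  have wm: "wave_solution D A {0..T} (src w m) (w m) (w' m)"
    by (rule wave_solution_subset[OF cascade_wave[OF w]]) (use m in auto)
  have sp: "continuous_on {0..T} (src w p)"
    by (rule continuous_on_subset[OF cascade_src_continuous[OF w m(2)]]) (auto simp: p_def)
  have sm: "continuous_on {0..T} (src w m)"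
    by (rule continuous_on_subset[OF cascade_src_continuous[OF w m(2)]]) (use m in auto)
  have Xi: "((\<lambda>t. C p (w m t) \<bullet> w m t) has_integral X) {0..T}"
    unfolding X_def p_def[symmetric]
    by (intro integrable_integral integrable_continuous_real continuous_intros wave_cont[OF wm]
        bounded_linear.continuous_on[OF C_linear[OF p(1)]])
  define br where "br t = w' p t \<bullet> w m t - w p t \<bullet> w' m t" for t
  have "((\<lambda>t. src w p t \<bullet> w m t - w p t \<bullet> src w m t) has_integral br T - br 0) {0..T}"
    unfolding br_def by (rule wave_bracket[OF wp wm _ sp sm]) (use T in simp)
  \<comment> \<open>The source of \<open>w p\<close> contributes minus the coupling density to the
    bracket; adding \<open>X\<close> cancels it.\<close>
  from has_integral_add[OF this Xi]
  have R: "((\<lambda>t. - (w p t \<bullet> src w m t)) has_integral br T - br 0 + X) {0..T}"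
    using p by (simp add: src_def[of w p])
  \<comment> \<open>Half a power of \<open>A\<close> changes sides: \<open>w p\<close> is measured
    by its energy and the other factor in the norm of index -1, where \<open>lower\<close> is
    available.\<close>
  have half_S_inner: "w p t \<bullet> u = half (w p t) \<bullet> S u" if "t \<in> {0..T}" for t u
    using wave_H1[OF wp that] by (simp flip: S_sym add: S_half)
  have Ei: "en integrable_on {0..T}"
  proof (rule integrable_continuous_real)
    show "continuous_on {0..T} en"
      unfolding en_def energy_state p_def[symmetric] by (intro continuous_intros continuous_state[OF wp]) auto
  qed
  define nE where "nE t = norm (state (w p t) (w' p t))" for t
  have nE: "(nE t)\<^sup>2 = 2 * en t" for t by (simp add: nE_def en_def energy_state p_def)
  have br_le: "\<bar>br t\<bar> \<le> X / 8 + 8 * K1 / T * en t" if t: "t \<in> {0..T}" for t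
  proof -
    define b where "b = norm (- S (w' m t), w m t)"
    have "energy D A 0 (w m t, w' m t) \<le> K1 / T * X" using lower[of m t] m t by simp
    moreover have "b\<^sup>2 = 2 * energy D A 0 (w m t, w' m t)"
      by (simp add: b_def norm_prod_def energy_def Hnorm_0 Hnorm_m1)
    ultimately have b: "b\<^sup>2 \<le> 2 * K1 / T * X" by simp
    have "br t = state (w p t) (w' p t) \<bullet> (- S (w' m t), w m t)"
      by (simp add: br_def half_S_inner[OF t])
    then have "\<bar>br t\<bar> \<le> nE t * b"
      using Cauchy_Schwarz_ineq2[of "state (w p t) (w' p t)" "(- S (w' m t), w m t)"] by (simp only: nE_def b_def)
    \<comment> \<open>This weight gives \<open>X / 8\<close> at each end point, a quarter of
      \<open>X\<close> in total.\<close>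
    also have "\<dots> \<le> T / (8 * K1) / 2 * b\<^sup>2 + (nE t)\<^sup>2 / (2 * (T / (8 * K1)))"
      by (rule mult_le_weighted_squares) (use T0 K1 in simp)
    also have "T / (8 * K1) / 2 * b\<^sup>2 \<le> T / (8 * K1) / 2 * (2 * K1 / T * X)"
      by (rule mult_left_mono[OF b]) (use T0 K1 in simp)
    also have "\<dots> = X / 8" using T0 K1 by simp
    also have "(nE t)\<^sup>2 / (2 * (T / (8 * K1))) = 8 * K1 / T * en t" using T0 K1 by (simp add: nE)
    finally show ?thesis by simp
  qed
  have R_le: "- (w p t \<bullet> src w m t) \<le> X / (4 * T) + 4 * M\<^sup>2 * K1 / T\<^sup>2 * en t" if t: "t \<in> {0..T}" for t
  proof -
    define b where "b = norm (S (src w m t))"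
    have X0: "0 \<le> X" unfolding X_def
      by (rule integral_nonneg) (use Xi C_nonneg p in \<open>auto simp: p_def\<close>)
    have b: "b\<^sup>2 \<le> M\<^sup>2 * (2 * K1 / T ^ 3 * X)"
    proof (cases "m = 1")
      case True
      then have "b = 0" by (simp add: b_def src_def op_pow_eq_fc)
      then show ?thesis using X0 K1 T0 by simp
    next
      case False
      then have i: "m - 1 \<in> {1..m}" "m - 1 \<noteq> m" "int (m - 1) - int m = -1" using m by auto
      have "b = Hnorm D A (-1) (C m (w (m - 1) t))"
        using False by (simp add: b_def src_def Hnorm_m1 linear_neg[OF bounded_linear.linear[OF bounded_linear_S]])
      also have "\<dots> \<le> M * Hnorm D A (-1) (w (m - 1) t)" by (rule CM[OF False])
      finally have "b\<^sup>2 \<le> (M * Hnorm D A (-1) (w (m - 1) t))\<^sup>2" by (intro power_mono) (auto simp: b_def)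
      also have "\<dots> = M\<^sup>2 * (Hnorm D A (-1) (w (m - 1) t))\<^sup>2" by (simp add: power_mult_distrib)
      also have "(Hnorm D A (-1) (w (m - 1) t))\<^sup>2 \<le> 2 * energy D A (int (m - 1) - int m) (w (m - 1) t, w' (m - 1) t)"
        unfolding i(3) by (simp add: energy_def)
      also have "\<dots> \<le> 2 * (K1 / T ^ 3 * X)" using lower[OF i(1) t] i(2) by simp
      finally show ?thesis by (simp add: mult_left_mono)
    qed
    have "- (w p t \<bullet> src w m t) \<le> \<bar>half (w p t) \<bullet> S (src w m t)\<bar>" by (simp add: half_S_inner[OF t])
    also have "\<dots> \<le> norm (half (w p t)) * b" unfolding b_def by (rule Cauchy_Schwarz_ineq2)
    also have "\<dots> \<le> nE t * b" unfolding nE_def b_def by (intro mult_right_mono norm_fst_le) auto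
    \<comment> \<open>The rate \<open>1 / T ^ 3\<close> of component \<open>m - 1\<close> permits a
      weight of order \<open>T\<^sup>2\<close>. It gives \<open>X / (4 * T)\<close>, which
      integrates to another quarter of \<open>X\<close>, so half of \<open>X\<close> can be
      absorbed.\<close>
    also have "\<dots> \<le> T\<^sup>2 / (4 * M\<^sup>2 * K1) / 2 * b\<^sup>2 + (nE t)\<^sup>2 / (2 * (T\<^sup>2 / (4 * M\<^sup>2 * K1)))"
      by (rule mult_le_weighted_squares) (use T0 K1 M in simp)
    also have "T\<^sup>2 / (4 * M\<^sup>2 * K1) / 2 * b\<^sup>2 \<le> T\<^sup>2 / (4 * M\<^sup>2 * K1) / 2 * (M\<^sup>2 * (2 * K1 / T ^ 3 * X))"
      by (rule mult_left_mono[OF b]) (use T0 K1 in simp)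
    also have "\<dots> = X / (4 * T)" using T0 K1 M by (simp add: power2_eq_square power3_eq_cube)
    also have "(nE t)\<^sup>2 / (2 * (T\<^sup>2 / (4 * M\<^sup>2 * K1))) = 4 * M\<^sup>2 * K1 / T\<^sup>2 * en t"
      using T0 K1 by (simp add: nE)
    finally show ?thesis by simp
  qed
  have "((\<lambda>t. X / (4 * T) + 4 * M\<^sup>2 * K1 / T\<^sup>2 * en t) has_integral
      T * (X / (4 * T)) + 4 * M\<^sup>2 * K1 / T\<^sup>2 * integral {0..T} en) {0..T}"
    using has_integral_const_real[of "X / (4 * T)" 0 T] T0
    by (intro has_integral_add has_integral_mult_right integrable_integral Ei) simp
  from has_integral_le[OF R this R_le]
  have "br T - br 0 + X \<le> T * (X / (4 * T)) + 4 * M\<^sup>2 * K1 / T\<^sup>2 * integral {0..T} en" .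
  also have "T * (X / (4 * T)) = X / 4" using T0 by simp
  finally have "X / 2 \<le> 8 * K1 / T * en 0 + 8 * K1 / T * en T + 4 * M\<^sup>2 * K1 / T\<^sup>2 * integral {0..T} en"
    using br_le[of 0] br_le[of T] T0 by simp
  also have "\<dots> = (16 * K1 / T * (en 0 + en T) + 8 * M\<^sup>2 * K1 / T\<^sup>2 * integral {0..T} en) / 2"
    by (simp add: distrib_left add_divide_distrib mult_ac)
  finally show ?thesis by simp
qed

text \<open>The previous order bounds the first \<open>m\<close> components by \<open>X\<close>, and
  the bracket converts this into the inequality for \<open>X\<close> that
  \<open>energy_averaging\<close> asks for. Its output bounds the new component and
  \<open>X\<close>, hence all components.\<close>

theorem order_estimate_Suc:
  assumes est: "order_estimate m" and m: "1 \<le> m" "Suc m \<le> n"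
  shows "order_estimate (Suc m)"
  unfolding order_estimate_def
proof (intro allI impI)
  fix c T1 :: real assume pos: "c > 0" "T1 > 0"
  define p where "p = Suc m"
  have p: "p \<in> {2..n}" using m by (simp add: p_def)
  obtain Ta K1 where Ta: "Ta \<ge> 1" and K1: "K1 > 0" and lower: "\<And>w w' T i s. cascade_solution D A (Suc m) C w w' \<Longrightarrow> T > Ta \<Longrightarrow>
     i \<in> {1..m} \<Longrightarrow> s \<in> {0..T} \<Longrightarrow> energy D A (int i - int m) (w i s, w' i s)
        \<le> K1 / (if i = m then T else T ^ 3) * integral {0..T} (\<lambda>t. C (Suc m) (w m t) \<bullet> w m t)"
    by (rule coupling_controls_lower[OF est m]) (rule that; blast)
  obtain M where M: "M > 0"
    "\<And>i k u. i \<in> {2..n} \<Longrightarrow> k \<le> n - i + 1 \<Longrightarrow> Hnorm D A (- int k) (C i u) \<le> M * Hnorm D A (- int k) u"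
    using C_negative_norm by blast
  have CM: "Hnorm D A (-1) (C m u) \<le> M * Hnorm D A (-1) u" if "m \<noteq> 1" for u
    using M(2)[of m 1 u] that m by simp
  \<comment> \<open>The coupling inequality bounds the squared source of the new component by
    \<open>\<beta> p\<close> times the coupling density; this variant is visibly positive.\<close>
  define b where "b = \<bar>\<beta> p\<bar> + 1"
  have b: "b > 0" by (simp add: b_def)
  have c12: "16 * K1 > 0" "8 * M\<^sup>2 * K1 > 0" using K1 M by auto
  from energy_averaging[OF b c12 pos]
  obtain Tb K :: real where Tb: "Tb \<ge> 1" and K: "K > 0" and avg: "\<And>(en :: real \<Rightarrow> real) \<phi> g X T. T > Tb \<Longrightarrow> continuous_on {0..T} en \<Longrightarrow>
     (\<forall>t. 0 \<le> en t) \<Longrightarrow> continuous_on {0..T} \<phi> \<Longrightarrow> (\<forall>t. 0 \<le> \<phi> t) \<Longrightarrow>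
     g integrable_on {0..T} \<Longrightarrow> (\<forall>t. 0 \<le> g t) \<Longrightarrow> 0 \<le> X \<Longrightarrow> integral {0..T} \<phi> \<le> b * X \<Longrightarrow>
     (\<forall>s\<in>{0..T}. \<forall>t\<in>{0..T}. en t \<le> 2 * en s + \<bar>t - s\<bar> * integral {min s t..max s t} \<phi>) \<Longrightarrow>
     X \<le> 16 * K1 / T * (en 0 + en T) + 8 * M\<^sup>2 * K1 / T\<^sup>2 * integral {0..T} en \<Longrightarrow>
     (\<forall>a\<in>{0..T - T1}. en a \<le> c * (integral {a..a + T1} g + integral {a..a + T1} \<phi>)) \<Longrightarrow>
     X \<le> K / T\<^sup>2 * integral {0..T} g \<and> (\<forall>s\<in>{0..T}. en s \<le> K / T * integral {0..T} g)" by metis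
  define Ts where "Ts = max Ta Tb"
  define K2 where "K2 = K1 * K + K"
  have Ts: "Ts \<ge> 1" and K2: "K2 > 0" using Ta K K1 by (auto simp: Ts_def K2_def add_pos_pos)
  show "\<exists>Ts\<ge>1. \<exists>K>0. \<forall>w w' g T. cascade_solution D A (Suc m) C w w' \<longrightarrow> T > Ts \<longrightarrow> g integrable_on {0..T} \<longrightarrow> (\<forall>t. 0 \<le> g t) \<longrightarrow>
     (\<forall>a\<in>{0..T - T1}. energy D A 1 (w (Suc m) a, w' (Suc m) a)
        \<le> c * (integral {a..a + T1} g + integral {a..a + T1} (\<lambda>t. (norm (src w (Suc m) t))\<^sup>2))) \<longrightarrow>
     (\<forall>i\<in>{1..Suc m}. \<forall>s\<in>{0..T}. energy D A (1 + int i - int (Suc m)) (w i s, w' i s)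
        \<le> K / (if i = Suc m then T else T ^ 3) * integral {0..T} g)"
  proof (rule exI[of _ Ts], rule conjI[OF Ts], rule exI[of _ K2], rule conjI[OF K2], intro allI impI ballI)
    fix w w' and g :: "real \<Rightarrow> real" and T i s
    assume w: "cascade_solution D A (Suc m) C w w'" and T: "T > Ts" and g: "g integrable_on {0..T}" "\<forall>t. 0 \<le> g t"
      and win: "\<forall>a\<in>{0..T - T1}. energy D A 1 (w (Suc m) a, w' (Suc m) a)
        \<le> c * (integral {a..a + T1} g + integral {a..a + T1} (\<lambda>t. (norm (src w (Suc m) t))\<^sup>2))"
      and i: "i \<in> {1..Suc m}" and s: "s \<in> {0..T}"
    have T': "T > Ta" "T > Tb" "T \<ge> 1" using T Ts by (auto simp: Ts_def)
    define X where "X = integral {0..T} (\<lambda>t. C (Suc m) (w m t) \<bullet> w m t)"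
    define en where "en t = energy D A 1 (w (Suc m) t, w' (Suc m) t)" for t
    have wp: "wave_solution D A {0..T} (src w (Suc m)) (w (Suc m)) (w' (Suc m))"
      by (rule wave_solution_subset[OF cascade_wave[OF w]]) auto
    have cwm: "continuous_on {0..T} (w m)"
      by (rule continuous_on_subset[OF wave_cont[OF cascade_wave[OF w]]]) (use m in auto)
    have sp: "continuous_on {0..T} (src w (Suc m))"
      by (rule continuous_on_subset[OF cascade_src_continuous[OF w m(2)]]) auto
    have Xi: "(\<lambda>t. C (Suc m) (w m t) \<bullet> w m t) integrable_on {0..T}"
      using p by (intro integrable_continuous_real continuous_intros cwm
        bounded_linear.continuous_on[OF C_linear]) (auto simp: p_def)
    have X0: "0 \<le> X" unfolding X_def
      by (rule integral_nonneg[OF Xi]) (use C_nonneg p in \<open>auto simp: p_def\<close>)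
    have \<phi>i: "continuous_on {0..T} (\<lambda>t. (norm (src w (Suc m) t))\<^sup>2)"
      by (intro continuous_intros sp)
    have N0: "0 \<le> integral {0..T} g" by (rule integral_nonneg[OF g(1)]) (use g(2) in simp)
    have "X \<le> K / T\<^sup>2 * integral {0..T} g \<and> (\<forall>s\<in>{0..T}. en s \<le> K / T * integral {0..T} g)"
    proof (rule avg[OF T'(2) _ _ \<phi>i _ g X0])
      show "continuous_on {0..T} en"
        unfolding en_def energy_state by (intro continuous_intros continuous_state[OF wp]) auto
      show "integral {0..T} (\<lambda>t. (norm (src w (Suc m) t))\<^sup>2) \<le> b * X"
      proof -
        have le: "(norm (src w (Suc m) t))\<^sup>2 \<le> b * (C (Suc m) (w m t) \<bullet> w m t)" for t
        proof -
          have "(norm (src w (Suc m) t))\<^sup>2 \<le> \<beta> p * (C p (w m t) \<bullet> w m t)"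
            using C_norm[OF p, of "w m t"] m by (simp add: src_def p_def)
          also have "\<dots> \<le> b * (C p (w m t) \<bullet> w m t)"
            using C_nonneg[OF p] by (intro mult_right_mono) (auto simp: b_def)
          finally show ?thesis by (simp add: p_def)
        qed
        have "integral {0..T} (\<lambda>t. (norm (src w (Suc m) t))\<^sup>2) \<le> integral {0..T} (\<lambda>t. b * (C (Suc m) (w m t) \<bullet> w m t))"
          by (intro integral_le integrable_continuous_real[OF \<phi>i] integrable_on_mult_right Xi le)
        then show ?thesis by (simp add: X_def)
      qed
      show "\<forall>s\<in>{0..T}. \<forall>t\<in>{0..T}. en t \<le> 2 * en s + \<bar>t - s\<bar> * integral {min s t..max s t} (\<lambda>t. (norm (src w (Suc m) t))\<^sup>2)"
      proof (intro ballI)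
        fix s t assume "s \<in> {0..T}" "t \<in> {0..T}"
        from L2_energy_estimate[OF wp L2_on_continuous[OF sp] this]
        show "en t \<le> 2 * en s + \<bar>t - s\<bar> * integral {min s t..max s t} (\<lambda>t. (norm (src w (Suc m) t))\<^sup>2)"
          by (simp add: en_def energy_state)
      qed
      show "X \<le> 16 * K1 / T * (en 0 + en T) + 8 * M\<^sup>2 * K1 / T\<^sup>2 * integral {0..T} en"
        unfolding X_def en_def
        by (rule coupling_integral_estimate[OF w m T'(3) K1 M(1) CM lower[OF w T'(1)]])
      show "\<forall>a\<in>{0..T - T1}. en a \<le> c * (integral {a..a + T1} g + integral {a..a + T1} (\<lambda>t. (norm (src w (Suc m) t))\<^sup>2))"
        using win by (simp add: en_def)
    qed (auto simp: en_def energy_nonneg)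
    then have XN: "X \<le> K / T\<^sup>2 * integral {0..T} g" and EN: "en s \<le> K / T * integral {0..T} g" using s by auto
    show "energy D A (1 + int i - int (Suc m)) (w i s, w' i s)
        \<le> K2 / (if i = Suc m then T else T ^ 3) * integral {0..T} g"
    proof (cases "i = Suc m")
      case True
      have "K / T * integral {0..T} g \<le> K2 / T * integral {0..T} g"
        using N0 T' K K1 by (intro mult_right_mono divide_right_mono) (auto simp: K2_def)
      then show ?thesis using EN True by (simp add: en_def)
    next
      case False
      then have i': "i \<in> {1..m}" using i by auto
      \<comment> \<open>For \<open>i = m\<close>, \<open>1 / T\<close> times
        \<open>1 / T\<^sup>2\<close> is the claimed rate; for smaller \<open>i\<close> the bound is
        weakened through \<open>T \<le> \<tau>\<close>.\<close>
      define \<tau> where "\<tau> = (if i = m then T else T ^ 3)"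
      have \<tau>: "T \<le> \<tau>" using T' self_le_power[of T 3] by (auto simp: \<tau>_def)
      have "energy D A (1 + int i - int (Suc m)) (w i s, w' i s) \<le> K1 / \<tau> * X"
        using lower[OF w T'(1) i' s] by (simp add: \<tau>_def X_def)
      also have "\<dots> \<le> K1 / T * (K / T\<^sup>2 * integral {0..T} g)"
        using K1 \<tau> T' X0 XN by (intro mult_mono divide_left_mono) auto
      also have "\<dots> = K1 * K / T ^ 3 * integral {0..T} g"
        by (simp add: power2_eq_square power3_eq_cube)
      also have "\<dots> \<le> K2 / T ^ 3 * integral {0..T} g"
        using N0 T' K by (intro mult_right_mono divide_right_mono) (auto simp: K2_def)
      finally show ?thesis using False by simp
    qed
  qed
qed

corollary order_estimate_n: "1 \<le> n \<Longrightarrow> order_estimate n"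
proof -
  have "m \<le> n \<Longrightarrow> order_estimate m" if "1 \<le> m" for m
    using that
  proof (induction m rule: dec_induct)
    case base show ?case by (rule order_estimate_1)
  next
    case (step m) then show ?case by (intro order_estimate_Suc) auto
  qed
  then show "1 \<le> n \<Longrightarrow> order_estimate n" by simp
qed

end

theorem theorem2p5:
  fixes D :: "'h::{real_inner, complete_space} set"
    and A :: "'h \<Rightarrow> 'h"
    and \<omega> :: real
    and n :: nat
    and C P :: "nat \<Rightarrow> 'h \<Rightarrow> 'h"
    and \<beta> :: "nat \<Rightarrow> real"
    and B :: "'h \<times> 'h \<Rightarrow> 'g::{real_inner, complete_space}"
  assumes "self_adjoint_op D A" and "positive_op D A" and "compact_resolvent D A"
    and "\<omega> > 0" and "\<forall>u\<in>D. \<omega> * norm u \<le> norm (A u)"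
    and "n \<ge> 2"
    and "coupling_hyp D A n C P \<beta>"
    and "coupling_observability_hyp D A n P"
    and "admissibility_hyp D A B"
    and "observability_hyp D A B"
  shows "\<exists>Tstar>0. \<exists>(d :: nat \<Rightarrow> real \<Rightarrow> real) (K :: real \<Rightarrow> real).
    (\<forall>i\<in>{1..n}. \<forall>T>Tstar. d i T > 0) \<and>
    (\<forall>w w'. cascade_solution D A n C w w' \<longrightarrow>
       (\<forall>T>Tstar. \<forall>i\<in>{1..n}.
          energy D A (1 + int i - int n) (w i 0, w' i 0)
            \<le> d i T * integral {0..T} (\<lambda>t. (norm (observation D A B T (w n) (w' n) t))\<^sup>2))) \<and>
    bounded (K ` {Tstar<..}) \<and>
    (\<forall>T>Tstar. (\<forall>i\<in>{1..n - 1}. d i T \<le> K T / T ^ 3) \<and> d n T \<le> K T / T)"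
proof -
  interpret cascade D A \<omega> n C P \<beta>
    by unfold_locales (use assms in auto)
  have n: "1 \<le> n" "n \<le> n" using assms(6) by auto
  obtain T1 c where T1: "T1 > 0" and c: "c > 0" and win: "\<And>T f w w' a. T1 \<le> T \<Longrightarrow> continuous_on {0..T} f \<Longrightarrow>
     wave_solution D A {0..T} f w w' \<Longrightarrow> a \<in> {0..T - T1} \<Longrightarrow>
     energy D A 1 (w a, w' a) \<le> c * (integral {a..a + T1} (\<lambda>t. (norm (observation D A B T w w' t))\<^sup>2)
        + integral {a..a + T1} (\<lambda>t. (norm (f t))\<^sup>2))"
    using window_observability[OF assms(9,10)] by blast
  obtain Ts K where Ts: "Ts \<ge> 1" and K: "K > 0" and est: "\<And>w w' g T i s. cascade_solution D A n C w w' \<Longrightarrow> T > Ts \<Longrightarrow>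
     g integrable_on {0..T} \<Longrightarrow> (\<And>t. 0 \<le> g t) \<Longrightarrow>
     (\<And>a. a \<in> {0..T - T1} \<Longrightarrow> energy D A 1 (w n a, w' n a)
        \<le> c * (integral {a..a + T1} g + integral {a..a + T1} (\<lambda>t. (norm (src w n t))\<^sup>2))) \<Longrightarrow>
     i \<in> {1..n} \<Longrightarrow> s \<in> {0..T} \<Longrightarrow> energy D A (1 + int i - int n) (w i s, w' i s)
        \<le> K / (if i = n then T else T ^ 3) * integral {0..T} g"
    using order_estimateD[OF order_estimate_n[OF n(1)] c T1] by metis
  \<comment> \<open>One constant serves all components and all times, so the bounding function is
    constant in \<open>T\<close>.\<close>
  define d where "d i T = K / (if i = n then T else T ^ 3)" for i T
  show ?thesis
  proof (intro exI[of _ Ts] exI[of _ d] exI[of _ "\<lambda>T. K"] conjI allI impI ballI)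
    show "0 < Ts" using Ts by simp
    show "0 < d i T" if "T > Ts" for i T using that Ts K by (simp add: d_def)
    show "bounded ((\<lambda>T. K) ` {Ts<..})" by (rule bounded_subset[of "{K}"]) auto
    show "d i T \<le> K / T ^ 3" if "i \<in> {1..n - 1}" for i T using that n by (auto simp: d_def)
    show "d n T \<le> K / T" for T by (simp add: d_def)
    fix w w' T i assume w: "cascade_solution D A n C w w'" and T: "Ts < T" and i: "i \<in> {1..n}"
    have T0: "T > 0" using T Ts by simp
    have wn: "wave_solution D A {0..T} (src w n) (w n) (w' n)"
      by (rule wave_solution_subset[OF cascade_wave[OF w]]) (use n in auto)
    have sn: "continuous_on {0..T} (src w n)"
      by (rule continuous_on_subset[OF cascade_src_continuous[OF w]]) (use n in auto)
    have "L2_on T (observation D A B T (w n) (w' n))"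
      \<comment> \<open>Existence of the observation makes its squared norm integrable, as required
        of \<open>g\<close>.\<close>
      using observationE[OF assms(9) wn sn T0] by blast
    then have "(\<lambda>t. (norm (observation D A B T (w n) (w' n) t))\<^sup>2) integrable_on {0..T}"
      by (simp add: L2_on_def)
    then show "energy D A (1 + int i - int n) (w i 0, w' i 0)
        \<le> d i T * integral {0..T} (\<lambda>t. (norm (observation D A B T (w n) (w' n) t))\<^sup>2)"
      unfolding d_def
    proof (rule est[OF w T _ _ _ i])
      fix a assume a: "a \<in> {0..T - T1}"
      show "energy D A 1 (w n a, w' n a) \<le> c * (integral {a..a + T1} (\<lambda>t. (norm (observation D A B T (w n) (w' n) t))\<^sup>2)
         + integral {a..a + T1} (\<lambda>t. (norm (src w n t))\<^sup>2))"
        by (rule win[OF _ sn wn a]) (use a in auto)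
    qed (use T0 in auto)
  qed
qed

end
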